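(* Let $S=\mathbb{C}[x,y,z]$ and let $\mathcal{CL}_1,\mathcal{CL}_2\subset\mathbb{P}^2_{\mathbb{C}}$ be the conic-line arrangements (each consisting of one smooth conic and six lines) given by $Q_1=0$ and $Q_2=0$ respectively, where $$Q_1=(-24x^{2}-23y^{2}+76yz+195z^{2})(y-3x-5z)(y+3x-5z)(y+z)(y-3z)\,x\,(x+y+z),$$ $$Q_2=(-24x^{2}-23y^{2}+76yz+195z^{2})(y-2x-3z)(y+2x-3z)(y+z)(y-3z)\,x\,(x+y+z).$$ Then each of $\mathcal{CL}_1$ and $\mathcal{CL}_2$ has only ordinary quasi-homogeneous singularities, namely exactly $12$ nodes, $3$ ordinary triple points and $1$ ordinary quadruple point. Moreover, the graded $S$-modules $\mathrm{AR}(Q_1)$ and $\mathrm{AR}(Q_2)$ have minimal graded free resolutions of the form $$0\to S(-7)\oplus S(-6)\to S(-6)\oplus S(-5)^{\oplus 2}\oplus S(-4)\to \mathrm{AR}(Q_1)\to 0,$$ $$0\to S(-7)\to S(-5)^{\oplus 2}\oplus S(-4)\to \mathrm{AR}(Q_2)\to 0.$$ In particular, $\mathcal{CL}_1$ and $\mathcal{CL}_2$ have the same weak-combinatorics but different $\mathrm{AR}$ modules, i.e. they form a weak Ziegler pair (2nd variant).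
   Context: For a homogeneous polynomial $f\in S=\mathbb{C}[x,y,z]$ defining a reduced plane curve, $\mathrm{AR}(f)=\{(a,b,c)\in S^{\oplus 3}: a\,\partial_x f+b\,\partial_y f+c\,\partial_z f=0\}$, a graded $S$-module whose degree $r$ part $\mathrm{AR}(f)_r$ consists of triples of forms of degree $r$. A singular point of a curve is ordinary of multiplicity $m$ if exactly $m$ smooth local branches with pairwise distinct tangents meet there (a node is the case $m=2$). A singularity is quasi-homogeneous if after a holomorphic change of local coordinates its local equation becomes weighted homogeneous; equivalently its local Milnor number equals its local Tjurina number. For a reduced curve all of whose irreducible components are smooth, its weak-combinatorics is the vector $(d_1,\dots,d_s;m_1,\dots,m_p)$, where $d_i$ is the number of irreducible components of degree $i$ and $m_j$ is the number of singular points of a given type $M_j$. Types are determined by local normal forms in Arnold's sense: nodes are $A_1$ ($x^2+y^2=0$), ordinary triple points are $D_4$ ($y^2x+x^3=0$), ordinary quadruple points are $X_9$ ($x^4+y^4+ax^2y^2=0$ with $a^2\neq 4$, the modulus $a$ not being part of the type). Two reduced plane curves with all irreducible components smooth form a weak Ziegler pair (2nd variant) if they have the same weak-combinatorics but different $\mathrm{AR}$ modules of algebraic relations; here the $\mathrm{AR}$ modules differ in that their minimal graded free resolutions have different graded Betti numbers. *)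

theory Defs
  imports
    "HOL-Analysis.Product_Vector"
    "HOL-Computational_Algebra.Polynomial"
    "HOL-Computational_Algebra.Squarefree"
    "Jordan_Normal_Form.Matrix"
begin

section \<open>The graded polynomial ring\<close>

text \<open>The ring of complex polynomials in x, y, z, written as C[x][y][z]: the innermost polynomial
  variable is x, the outermost one is z.\<close>

type_synonym polyS = "complex poly poly poly"

definition varX :: polyS where "varX = [:[:[:0, 1:]:]:]"
definition varY :: polyS where "varY = [:[:0, 1:]:]"
definition varZ :: polyS where "varZ = [:0, 1:]"

definition mono_coeff :: "polyS \<Rightarrow> nat \<Rightarrow> nat \<Rightarrow> nat \<Rightarrow> complex" where
  "mono_coeff p i j k = coeff (coeff (coeff p k) j) i"

definition is_form :: "nat \<Rightarrow> polyS \<Rightarrow> bool" where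
  "is_form d p \<longleftrightarrow> (\<forall>i j k. mono_coeff p i j k \<noteq> 0 \<longrightarrow> i + j + k = d)"

fun eval :: "polyS \<Rightarrow> complex \<times> complex \<times> complex \<Rightarrow> complex" where
  "eval p (a, b, c) = poly (poly (poly p [:[:c:]:]) [:b:]) a"

definition dX :: "polyS \<Rightarrow> polyS" where "dX = map_poly (map_poly pderiv)"
definition dY :: "polyS \<Rightarrow> polyS" where "dY = map_poly pderiv"
definition dZ :: "polyS \<Rightarrow> polyS" where "dZ = pderiv"

definition Q1 :: polyS where
  "Q1 = (- 24 * varX^2 - 23 * varY^2 + 76 * varY * varZ + 195 * varZ^2)
      * (varY - 3 * varX - 5 * varZ) * (varY + 3 * varX - 5 * varZ)
      * (varY + varZ) * (varY - 3 * varZ) * varX * (varX + varY + varZ)"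

definition Q2 :: polyS where
  "Q2 = (- 24 * varX^2 - 23 * varY^2 + 76 * varY * varZ + 195 * varZ^2)
      * (varY - 2 * varX - 3 * varZ) * (varY + 2 * varX - 3 * varZ)
      * (varY + varZ) * (varY - 3 * varZ) * varX * (varX + varY + varZ)"


section \<open>Graded free modules and minimal graded free resolutions\<close>

text \<open>A list of shifts \<open>[a\<^sub>0, \<dots>, a\<^sub>n]\<close> stands for the graded free module
  \<open>S(-a\<^sub>0) \<oplus> \<dots> \<oplus> S(-a\<^sub>n)\<close>. Its elements are the vectors of the corresponding length;
  \<open>free_part as r\<close> is its part of degree \<open>r\<close>.\<close>

abbreviation free_module :: "nat list \<Rightarrow> polyS vec set" where
  "free_module as \<equiv> carrier_vec (length as)"

definition free_part :: "nat list \<Rightarrow> nat \<Rightarrow> polyS vec set" where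
  "free_part as r = {v \<in> free_module as. \<forall>i < length as.
     if as ! i \<le> r then is_form (r - as ! i) (v $ i) else v $ i = 0}"

definition graded_hom :: "nat list \<Rightarrow> nat list \<Rightarrow> (polyS vec \<Rightarrow> polyS vec) \<Rightarrow> bool" where
  "graded_hom as bs \<phi> \<longleftrightarrow>
     \<phi> \<in> free_module as \<rightarrow> free_module bs \<and>
     (\<forall>u \<in> free_module as. \<forall>v \<in> free_module as. \<phi> (u + v) = \<phi> u + \<phi> v) \<and>
     (\<forall>p. \<forall>v \<in> free_module as. \<phi> (p \<cdot>\<^sub>v v) = p \<cdot>\<^sub>v \<phi> v) \<and>
     (\<forall>r. \<phi> ` free_part as r \<subseteq> free_part bs r)"

text \<open>The submodule \<open>\<mm> F\<close> of a free module \<open>F\<close>, with \<open>\<mm> = (x, y, z)\<close>.\<close>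

definition irrelevant_part :: "nat list \<Rightarrow> polyS vec set" where
  "irrelevant_part as = {v \<in> free_module as. \<forall>i < length as. mono_coeff (v $ i) 0 0 0 = 0}"

text \<open>\<open>min_graded_free_res M [F\<^sub>0, \<dots>, F\<^sub>p]\<close>: the graded submodule \<open>M\<close> of \<open>S\<^sup>3\<close> has a minimal
  graded free resolution \<open>0 \<rightarrow> F\<^sub>p \<rightarrow> \<dots> \<rightarrow> F\<^sub>0 \<rightarrow> M \<rightarrow> 0\<close>. With \<open>S\<^sup>3\<close> (shifts \<open>[0, 0, 0]\<close>) put in
  front, \<open>\<phi> i\<close> goes from the member \<open>Suc i\<close> of the resulting list to the member \<open>i\<close>, and \<open>\<phi> 0\<close>
  is the augmentation onto \<open>M\<close>.\<close>

definition min_graded_free_res :: "polyS vec set \<Rightarrow> nat list list \<Rightarrow> bool" where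
  "min_graded_free_res M Fs \<longleftrightarrow> Fs \<noteq> [] \<and>
     (\<exists>\<phi>. let G = [0, 0, 0] # Fs; p = length Fs in
        (\<forall>i < p. graded_hom (G ! Suc i) (G ! i) (\<phi> i)) \<and>
        \<phi> 0 ` free_module (G ! 1) = M \<and>
        (\<forall>i. Suc i < p \<longrightarrow>
           \<phi> (Suc i) ` free_module (G ! Suc (Suc i)) =
             {v \<in> free_module (G ! Suc i). \<phi> i v = 0\<^sub>v (length (G ! i))} \<and>
           \<phi> (Suc i) ` free_module (G ! Suc (Suc i)) \<subseteq> irrelevant_part (G ! Suc i)) \<and>
        inj_on (\<phi> (p - 1)) (free_module (G ! p)))"

text \<open>\<open>\<beta> i j\<close> is the multiplicity of \<open>S(-j)\<close> in \<open>F\<^sub>i\<close>.\<close>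

definition has_graded_betti_numbers :: "polyS vec set \<Rightarrow> (nat \<Rightarrow> nat \<Rightarrow> nat) \<Rightarrow> bool" where
  "has_graded_betti_numbers M \<beta> \<longleftrightarrow> (\<exists>Fs. min_graded_free_res M Fs \<and>
     \<beta> = (\<lambda>i j. if i < length Fs then count_list (Fs ! i) j else 0))"

definition AR :: "polyS \<Rightarrow> polyS vec set" where
  "AR f = {v \<in> carrier_vec 3. v $ 0 * dX f + v $ 1 * dY f + v $ 2 * dZ f = 0}"


section \<open>Germs of holomorphic functions at the origin of the plane\<close>

type_synonym germ = "complex \<times> complex \<Rightarrow> complex"

definition holomorphic2_on :: "germ \<Rightarrow> (complex \<times> complex) set \<Rightarrow> bool" where
  "holomorphic2_on F U \<longleftrightarrow>
     (\<forall>w \<in> U. \<exists>a b. (F has_derivative (\<lambda>(s, t). a * s + b * t)) (at w))"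

definition biholomorphic ::
  "(complex \<times> complex \<Rightarrow> complex \<times> complex) \<Rightarrow>
     (complex \<times> complex) set \<Rightarrow> (complex \<times> complex) set \<Rightarrow> bool" where
  "biholomorphic \<phi> U V \<longleftrightarrow> open U \<and> open V \<and> bij_betw \<phi> U V \<and>
     holomorphic2_on (\<lambda>w. fst (\<phi> w)) U \<and> holomorphic2_on (\<lambda>w. snd (\<phi> w)) U \<and>
     holomorphic2_on (\<lambda>w. fst (inv_into U \<phi> w)) V \<and>
     holomorphic2_on (\<lambda>w. snd (inv_into U \<phi> w)) V"

definition equivalent_germs :: "germ \<Rightarrow> germ \<Rightarrow> bool" where
  "equivalent_germs F G \<longleftrightarrow> (\<exists>\<phi> U V. biholomorphic \<phi> U V \<and> (0, 0) \<in> U \<and> \<phi> (0, 0) = (0, 0) \<and>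
     (\<forall>w \<in> U. F (\<phi> w) = G w))"

text \<open>Exactly \<open>m\<close> smooth branches \<open>g i = 0\<close>, with pairwise distinct tangents
  \<open>a i * s + b i * t = 0\<close>. The factors are taken with multiplicity one, and a unit can be absorbed
  into one of them.\<close>

definition ordinary :: "nat \<Rightarrow> germ \<Rightarrow> bool" where
  "ordinary m F \<longleftrightarrow> (\<exists>U g a b. open U \<and> (0, 0) \<in> U \<and>
     (\<forall>i < m. holomorphic2_on (g i) U \<and> g i (0, 0) = 0 \<and>
        (g i has_derivative (\<lambda>(s, t). a i * s + b i * t)) (at (0, 0)) \<and> (a i, b i) \<noteq> (0, 0)) \<and>
     (\<forall>i < m. \<forall>j < m. i \<noteq> j \<longrightarrow> a i * b j \<noteq> a j * b i) \<and>
     (\<forall>w \<in> U. F w = (\<Prod>i<m. g i w)))"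

definition weighted_homogeneous :: "complex poly poly \<Rightarrow> bool" where
  "weighted_homogeneous h \<longleftrightarrow> h \<noteq> 0 \<and> (\<exists>w1 w2 d :: nat. 0 < w1 \<and> 0 < w2 \<and> 0 < d \<and>
     (\<forall>i j. coeff (coeff h j) i \<noteq> 0 \<longrightarrow> w1 * i + w2 * j = d))"

definition quasi_homogeneous :: "germ \<Rightarrow> bool" where
  "quasi_homogeneous F \<longleftrightarrow> (\<exists>h. weighted_homogeneous h \<and>
     equivalent_germs F (\<lambda>(s, t). poly (poly h [:t:]) s))"

datatype singularity_type = A1 | D4 | X9

fun normal_forms :: "singularity_type \<Rightarrow> germ set" where
  "normal_forms A1 = {\<lambda>(x, y). x^2 + y^2}"
| "normal_forms D4 = {\<lambda>(x, y). y^2 * x + x^3}"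
| "normal_forms X9 = {\<lambda>(x, y). x^4 + y^4 + a * x^2 * y^2 | a. a^2 \<noteq> 4}"

definition has_type :: "singularity_type \<Rightarrow> germ \<Rightarrow> bool" where
  "has_type T F \<longleftrightarrow> (\<exists>G \<in> normal_forms T. equivalent_germs F G)"


section \<open>Projective plane curves\<close>

fun proj_point :: "complex \<times> complex \<times> complex \<Rightarrow> (complex \<times> complex \<times> complex) set" where
  "proj_point (a, b, c) = {(t * a, t * b, t * c) | t. t \<noteq> 0}"

definition zero_locus :: "polyS \<Rightarrow> (complex \<times> complex \<times> complex) set set" where
  "zero_locus f = proj_point ` {v. v \<noteq> (0, 0, 0) \<and> eval f v = 0}"

definition singular_at :: "polyS \<Rightarrow> complex \<times> complex \<times> complex \<Rightarrow> bool" where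
  "singular_at f v \<longleftrightarrow> v \<noteq> (0, 0, 0) \<and> eval f v = 0 \<and>
     eval (dX f) v = 0 \<and> eval (dY f) v = 0 \<and> eval (dZ f) v = 0"

text \<open>The local equation at the point \<open>(a : b : c)\<close>, moved to the origin, in the first of the
  standard charts \<open>z = 1\<close>, \<open>y = 1\<close>, \<open>x = 1\<close> that contains the point. Another chart changes it
  by a coordinate change and a unit; a unit in front of a weighted homogeneous polynomial is
  removed by rescaling the coordinates, so the notions above do not depend on this choice.\<close>

fun local_equation :: "polyS \<Rightarrow> complex \<times> complex \<times> complex \<Rightarrow> germ" where
  "local_equation f (a, b, c) = (\<lambda>(s, t).
     if c \<noteq> 0 then eval f (a / c + s, b / c + t, 1)
     else if b \<noteq> 0 then eval f (a / b + s, 1, t)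
     else eval f (1, s, t))"

definition singular_points ::
  "polyS \<Rightarrow> (germ \<Rightarrow> bool) \<Rightarrow> (complex \<times> complex \<times> complex) set set" where
  "singular_points f P = proj_point ` {v. singular_at f v \<and> P (local_equation f v)}"

definition reduced_curve :: "polyS \<Rightarrow> bool" where
  "reduced_curve f \<longleftrightarrow> (\<exists>d > 0. is_form d f) \<and> f \<noteq> 0 \<and> squarefree f"

definition components_of_degree :: "polyS \<Rightarrow> nat \<Rightarrow> (complex \<times> complex \<times> complex) set set set" where
  "components_of_degree f i = {zero_locus p | p. irreducible p \<and> p dvd f \<and> is_form i p}"

definition smooth_components :: "polyS \<Rightarrow> bool" where
  "smooth_components f \<longleftrightarrow> (\<forall>p. irreducible p \<and> p dvd f \<longrightarrow> (\<forall>v. \<not> singular_at p v))"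

definition conic_line_arrangement :: "nat \<Rightarrow> nat \<Rightarrow> polyS \<Rightarrow> bool" where
  "conic_line_arrangement k l f \<longleftrightarrow> reduced_curve f \<and> smooth_components f \<and>
     card (components_of_degree f 2) = k \<and> card (components_of_degree f 1) = l \<and>
     (\<forall>i. i \<notin> {1, 2} \<longrightarrow> components_of_degree f i = {})"

text \<open>The vectors \<open>(d\<^sub>i)\<close> and \<open>(m\<^sub>j)\<close> as functions of the degree and of the type.\<close>

definition weak_combinatorics ::
  "polyS \<Rightarrow> (nat \<Rightarrow> nat) \<times> (singularity_type \<Rightarrow> nat)" where
  "weak_combinatorics f =
     (\<lambda>i. card (components_of_degree f i), \<lambda>T. card (singular_points f (has_type T)))"

text \<open>Every singular point is required to be of one of the listed types, since otherwise
  \<open>weak_combinatorics\<close> would not count all of them.\<close>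

definition weak_ziegler_pair :: "polyS \<Rightarrow> polyS \<Rightarrow> bool" where
  "weak_ziegler_pair f g \<longleftrightarrow>
     (\<forall>h \<in> {f, g}. reduced_curve h \<and> smooth_components h \<and>
        (\<forall>v. singular_at h v \<longrightarrow> (\<exists>T. has_type T (local_equation h v)))) \<and>
     weak_combinatorics f = weak_combinatorics g \<and>
     (\<exists>\<beta>. has_graded_betti_numbers (AR f) \<beta>) \<and> (\<exists>\<gamma>. has_graded_betti_numbers (AR g) \<gamma>) \<and>
     (\<forall>\<beta> \<gamma>. has_graded_betti_numbers (AR f) \<beta> \<and> has_graded_betti_numbers (AR g) \<gamma> \<longrightarrow> \<beta> \<noteq> \<gamma>)"

end

theory Submission
  imports Defs
    "HOL-Computational_Algebra.Polynomial_Factorial"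
    "HOL-Computational_Algebra.Field_as_Ring"
    "HOL-Analysis.Complex_Transcendental"
    "Jordan_Normal_Form.Determinant"
begin

text \<open>Both arrangements consist of one conic, the four lines \<open>x\<close>, \<open>y + z\<close>, \<open>y - 3 z\<close>, \<open>x + y + z\<close>, and
  the two lines of slopes \<open>\<plusminus> r\<close> through the points \<open>(\<mp>2 : -1 : 1)\<close> of the conic, with \<open>r = 3\<close> or
  \<open>r = 2\<close>. For \<open>r = 3\<close> the conic passes through the quadruple point \<open>(0 : 5 : 1)\<close>; for \<open>r = 2\<close> the
  quadruple point \<open>(0 : 3 : 1)\<close> is off the conic. The numbers of components and singular points
  do not see this difference, the Jacobian syzygies do.

  The singular points are the intersection points of the components
  (\<open>intersections_represented\<close>). At a node the two branches are local coordinates. At a triple or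
  quadruple point a linear relation between multiples of the branches by units shows that the local
  equation is a unit times a homogeneous polynomial in two local coordinates (\<open>triple_germ\<close>,
  \<open>harmonic_quadruple_germ\<close>), and an \<open>m\<close>-th root of the unit is absorbed in the coordinates
  (\<open>equivalent_to_homogeneous\<close>). The order of vanishing along a general smooth curve separates the
  three types (\<open>ordinary_multiplicity\<close>), so that the points of each type can be counted.

  Modulo the Euler derivation \<open>AR Q\<close> is the module of derivations that preserve the ideal of \<open>Q\<close>.
  Since \<open>y + z\<close> is a component, these derivations can be normalized so as to kill \<open>y + z\<close>; then they
  are given by two polynomials \<open>p\<close>, \<open>r\<close> (\<open>log_basis\<close>), on which each of the other components imposes
  one divisibility condition (\<open>factor_dvd_der\<close>). The conditions are solved one after the other: a
  product of linear forms is cancelled modulo an ideal factor by factor, each time because some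
  polynomial does not vanish at an explicit point (\<open>cancel_on_line\<close>, \<open>cancel_mod_two_lines\<close>). For
  \<open>Q1\<close> four generators with two relations result (\<open>generate1\<close>, \<open>exact1\<close>), for \<open>Q2\<close> three generators
  with one relation (\<open>generate2\<close>, \<open>exact2\<close>). No entry of the relation matrices is a unit, so both
  resolutions are minimal. The number of minimal generators does not depend on the resolution
  (\<open>min_graded_free_res_rank_unique\<close>), hence the graded Betti numbers of the two modules differ.\<close>

unbundle no vec_syntax
hide_type (open) Finite_Cartesian_Product.vec
hide_const (open) Finite_Cartesian_Product.vec Finite_Cartesian_Product.mat

section \<open>The ring C[x,y,z]: evaluation, derivations, forms\<close>

definition cst :: "complex \<Rightarrow> polyS" where "cst c = [:[:[:c:]:]:]"

lemma eval_simps [simp]: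
  "eval (p + q) v = eval p v + eval q v"
  "eval (p - q) v = eval p v - eval q v"
  "eval (- p) v = - eval p v"
  "eval (p * q) v = eval p v * eval q v"
  "eval (p ^ n) v = eval p v ^ n"
  "eval 0 v = 0" "eval 1 v = 1"
  "eval (numeral k) v = numeral k"
  "eval (cst c) v = c"
  "eval varX v = fst v" "eval varY v = fst (snd v)" "eval varZ v = snd (snd v)"
  by (cases v; simp add: cst_def varX_def varY_def varZ_def numeral_poly)+

declare eval.simps [simp del]

lemma map_poly_additive:
  fixes D :: "'a::comm_ring_1 \<Rightarrow> 'a"
  assumes "D 0 = 0" "\<And>a b. D (a + b) = D a + D b"
  shows "map_poly D (p + q) = map_poly D p + map_poly D q"
  by (rule poly_eqI) (simp add: coeff_map_poly assms)

lemma map_poly_Leibniz: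
  fixes D :: "'a::comm_ring_1 \<Rightarrow> 'a"
  assumes D0: "D 0 = 0" and D_add: "\<And>a b. D (a + b) = D a + D b"
    and D_mult: "\<And>a b. D (a * b) = D a * b + a * D b"
  shows "map_poly D (p * q) = map_poly D p * q + p * map_poly D q"
proof (rule poly_eqI)
  fix n
  have D_sum: "D (sum g A) = (\<Sum>a\<in>A. D (g a))" for g :: "nat \<Rightarrow> 'a" and A
    by (induction A rule: infinite_finite_induct) (auto simp: D0 D_add)
  show "coeff (map_poly D (p * q)) n = coeff (map_poly D p * q + p * map_poly D q) n"
    by (simp add: coeff_map_poly D0 coeff_mult D_sum D_mult sum.distrib)
qed

lemma dX_zero [simp]: "dX 0 = 0" and dY_zero [simp]: "dY 0 = 0" and dZ_zero [simp]: "dZ 0 = 0"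
  by (simp_all add: dX_def dY_def dZ_def)

lemma dX_add [simp]: "dX (p + q) = dX p + dX q"
  unfolding dX_def by (intro map_poly_additive) (auto intro: map_poly_additive simp: pderiv_add)

lemma dY_add [simp]: "dY (p + q) = dY p + dY q"
  unfolding dY_def by (intro map_poly_additive) (auto simp: pderiv_add)

lemma dZ_add [simp]: "dZ (p + q) = dZ p + dZ q"
  by (simp add: dZ_def pderiv_add)

lemma dX_mult [simp]: "dX (p * q) = dX p * q + p * dX q"
  unfolding dX_def
  by (intro map_poly_Leibniz)
    (auto intro!: map_poly_Leibniz map_poly_additive simp: pderiv_add pderiv_mult)

lemma dY_mult [simp]: "dY (p * q) = dY p * q + p * dY q"
  unfolding dY_def by (intro map_poly_Leibniz) (auto simp: pderiv_add pderiv_mult)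

lemma dZ_mult [simp]: "dZ (p * q) = dZ p * q + p * dZ q"
  by (simp add: dZ_def pderiv_mult algebra_simps)

definition der :: "polyS \<Rightarrow> polyS \<Rightarrow> polyS \<Rightarrow> polyS \<Rightarrow> polyS" where
  "der a b c f = a * dX f + b * dY f + c * dZ f"

lemma der_add [simp]: "der a b c (f + g) = der a b c f + der a b c g"
  by (simp add: der_def algebra_simps)

lemma der_mult [simp]: "der a b c (f * g) = der a b c f * g + f * der a b c g"
  by (simp add: der_def algebra_simps)

lemma der_zero [simp]: "der a b c 0 = 0"
  by (simp add: der_def)

lemma der_uminus [simp]: "der a b c (- f) = - der a b c f"
  using der_add[of a b c f "- f"] by (simp add: eq_neg_iff_add_eq_0 add.commute)

lemma der_diff [simp]: "der a b c (f - g) = der a b c f - der a b c g"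
  using der_add[of a b c f "- g"] by simp

lemma der_cst [simp]: "der a b c (cst k) = 0"
  by (simp add: der_def dX_def dY_def dZ_def cst_def map_poly_pCons pderiv_pCons)

lemma cst_numeral: "cst (numeral k) = numeral k" and cst_1: "cst 1 = 1" and cst_0: "cst 0 = 0"
  by (simp_all add: cst_def numeral_poly one_pCons)

lemma cst_mult: "cst a * cst b = cst (a * b)"
  by (simp add: cst_def)

lemma der_numeral [simp]: "der a b c (numeral k) = 0" and der_1 [simp]: "der a b c 1 = 0"
  using der_cst[of a b c "numeral k"] der_cst[of a b c 1]
  by (simp_all add: cst_numeral cst_1 del: der_cst)

lemma der_power2 [simp]: "der a b c (f ^ 2) = 2 * f * der a b c f"
  by (simp add: power2_eq_square algebra_simps)

lemma der_var [simp]: "der a b c varX = a" "der a b c varY = b" "der a b c varZ = c"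
  by (simp_all add: der_def dX_def dY_def dZ_def varX_def varY_def varZ_def map_poly_pCons
      map_poly_1 pderiv_pCons flip: one_pCons)

lemma dX_der: "dX f = der 1 0 0 f" and dY_der: "dY f = der 0 1 0 f" and dZ_der: "dZ f = der 0 0 1 f"
  by (simp_all add: der_def)

lemma is_unit_cst: "c \<noteq> 0 \<Longrightarrow> cst c dvd 1"
  by (auto simp: cst_def is_unit_const_poly_iff dvd_field_iff)

lemma is_unit_iff_cst: "p dvd 1 \<longleftrightarrow> (\<exists>c. c \<noteq> 0 \<and> p = cst c)"
  by (auto simp: cst_def is_unit_poly_iff dvd_field_iff)

lemma numeral_unit: "(numeral k :: polyS) dvd 1"
  using is_unit_cst[of "numeral k"] by (simp add: cst_numeral)

lemma dvd_numeral_mult_iff [simp]: "(L :: polyS) dvd numeral k * f \<longleftrightarrow> L dvd f"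
  using numeral_unit[of k] by (simp add: dvd_mult_unit_iff')

subsection \<open>Forms\<close>

lemma mono_coeff_mult_nonzero:
  assumes "mono_coeff (p * q) i j k \<noteq> 0"
  obtains i1 j1 k1 i2 j2 k2 where "i = i1 + i2" "j = j1 + j2" "k = k1 + k2"
    "mono_coeff p i1 j1 k1 \<noteq> 0" "mono_coeff q i2 j2 k2 \<noteq> 0"
proof -
  have "coeff (coeff (\<Sum>k1\<le>k. coeff p k1 * coeff q (k - k1)) j) i \<noteq> 0"
    using assms by (simp add: mono_coeff_def coeff_mult)
  then have "(\<Sum>k1\<le>k. \<Sum>j1\<le>j. \<Sum>i1\<le>i.
      mono_coeff p i1 j1 k1 * mono_coeff q (i - i1) (j - j1) (k - k1)) \<noteq> 0"
    by (simp add: coeff_sum coeff_mult mono_coeff_def)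
  then obtain k1 where k1: "k1 \<le> k" and "(\<Sum>j1\<le>j. \<Sum>i1\<le>i.
      mono_coeff p i1 j1 k1 * mono_coeff q (i - i1) (j - j1) (k - k1)) \<noteq> 0"
    by (meson atMost_iff sum.not_neutral_contains_not_neutral)
  then obtain j1 where j1: "j1 \<le> j" and "(\<Sum>i1\<le>i.
      mono_coeff p i1 j1 k1 * mono_coeff q (i - i1) (j - j1) (k - k1)) \<noteq> 0"
    by (meson atMost_iff sum.not_neutral_contains_not_neutral)
  then obtain i1 where i1: "i1 \<le> i"
    and "mono_coeff p i1 j1 k1 * mono_coeff q (i - i1) (j - j1) (k - k1) \<noteq> 0"
    by (meson atMost_iff sum.not_neutral_contains_not_neutral)
  with k1 j1 show thesis
    by (intro that[of i1 "i - i1" j1 "j - j1" k1 "k - k1"]) auto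
qed

lemma is_form_0 [simp, intro]: "is_form d 0"
  by (simp add: is_form_def mono_coeff_def)

lemma is_form_add [intro]: "is_form d p \<Longrightarrow> is_form d q \<Longrightarrow> is_form d (p + q)"
  unfolding is_form_def mono_coeff_def by (metis add.right_neutral coeff_add)

lemma is_form_uminus [intro]: "is_form d p \<Longrightarrow> is_form d (- p)"
  by (simp add: is_form_def mono_coeff_def)

lemma is_form_diff [intro]: "is_form d p \<Longrightarrow> is_form d q \<Longrightarrow> is_form d (p - q)"
  using is_form_add[of d p "- q"] is_form_uminus[of d q] by simp

lemma is_form_mult:
  assumes "is_form d p" "is_form e q"
  shows "is_form (d + e) (p * q)"
  unfolding is_form_def
proof (intro allI impI)
  fix i j k assume "mono_coeff (p * q) i j k \<noteq> 0"
  then obtain i1 j1 k1 i2 j2 k2 where "i = i1 + i2" "j = j1 + j2" "k = k1 + k2"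
    and nz: "mono_coeff p i1 j1 k1 \<noteq> 0" "mono_coeff q i2 j2 k2 \<noteq> 0"
    by (rule mono_coeff_mult_nonzero)
  moreover have "i1 + j1 + k1 = d" "i2 + j2 + k2 = e"
    using assms nz by (auto simp: is_form_def)
  ultimately show "i + j + k = d + e" by linarith
qed

lemma is_form_sum: "(\<And>i. i \<in> A \<Longrightarrow> is_form d (f i)) \<Longrightarrow> is_form d (sum f A)"
  by (induction A rule: infinite_finite_induct) auto

lemma is_form_cst: "is_form 0 (cst c)"
  by (auto simp: is_form_def mono_coeff_def cst_def coeff_pCons split: nat.splits)

lemma is_form_numeral: "is_form 0 (numeral k)" and is_form_1: "is_form 0 1"
  using is_form_cst[of "numeral k"] is_form_cst[of 1] by (simp_all add: cst_numeral cst_1)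

lemma is_form_var: "is_form 1 varX" "is_form 1 varY" "is_form 1 varZ"
  by (auto simp: is_form_def mono_coeff_def varX_def varY_def varZ_def coeff_pCons one_pCons
      split: nat.splits)

lemma is_form_power: "is_form d p \<Longrightarrow> is_form (n * d) (p ^ n)"
  by (induction n) (auto simp: is_form_1 intro: is_form_mult)

text \<open>Variants with a degree equation as a premise, so that the degree of an explicit expression
  can be found by resolution.\<close>

lemma is_form_mult': "is_form d p \<Longrightarrow> is_form e q \<Longrightarrow> d + e = n \<Longrightarrow> is_form n (p * q)"
  using is_form_mult by blast

lemma is_form_power': "is_form d p \<Longrightarrow> n * d = e \<Longrightarrow> is_form e (p ^ n)"
  using is_form_power by blast

lemma is_form_numeral_mult: "is_form d q \<Longrightarrow> is_form d (numeral k * q)"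
  using is_form_mult[OF is_form_numeral] by fastforce

lemma is_form_degree_unique: "p \<noteq> 0 \<Longrightarrow> is_form d p \<Longrightarrow> is_form e p \<Longrightarrow> d = e"
proof -
  assume p: "p \<noteq> 0" "is_form d p" "is_form e p"
  from p(1) obtain i j k where "mono_coeff p i j k \<noteq> 0"
    by (metis coeff_0 poly_eqI mono_coeff_def)
  with p show "d = e" by (auto simp: is_form_def)
qed

lemma mono_coeff_000: "mono_coeff p 0 0 0 = eval p (0, 0, 0)"
  by (simp add: mono_coeff_def eval.simps poly_0_coeff_0)

lemma eval_as_sum:
  "eval p (a, b, c) = (\<Sum>k\<le>degree p. \<Sum>j\<le>degree (coeff p k). \<Sum>i\<le>degree (coeff (coeff p k) j).
     mono_coeff p i j k * a ^ i * b ^ j * c ^ k)"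
proof -
  have z: "eval p (a, b, c) = (\<Sum>k\<le>degree p. poly (poly (coeff p k) [:b:]) a * c ^ k)"
    unfolding eval.simps by (subst poly_altdef) (simp add: poly_sum poly_power)
  have y: "poly (poly q [:b:]) a = (\<Sum>j\<le>degree q. poly (coeff q j) a * b ^ j)" for q
    by (subst poly_altdef) (simp add: poly_sum poly_power)
  show ?thesis
    unfolding z unfolding y unfolding poly_altdef[where x = a] mono_coeff_def
    by (simp only: sum_distrib_right)
qed

lemma eval_form_scale:
  assumes "is_form d p"
  shows "eval p (t * a, t * b, t * c) = t ^ d * eval p (a, b, c)"
proof -
  have h: "mono_coeff p i j k * (t * a) ^ i * (t * b) ^ j * (t * c) ^ k
      = t ^ d * (mono_coeff p i j k * a ^ i * b ^ j * c ^ k)" for i j k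
  proof (cases "mono_coeff p i j k = 0")
    case False
    then have "d = i + j + k" using assms by (auto simp: is_form_def)
    then show ?thesis by (simp add: power_mult_distrib power_add algebra_simps)
  qed simp
  show ?thesis by (simp only: eval_as_sum sum_distrib_left h)
qed

section \<open>Linear forms and their ideals\<close>

lemma prime_elem_linear_unit:
  fixes g u :: "'a::idom_divide"
  assumes "u dvd 1"
  shows "prime_elem [:g, u:]"
proof -
  obtain w where w: "1 = u * w" using assms by blast
  have root: "[:w * g, 1:] dvd f \<longleftrightarrow> poly f (- (w * g)) = 0" for f
    using poly_eq_0_iff_dvd[of f "- (w * g)"] by simp
  have "prime_elem [:w * g, 1:]"
  proof (rule prime_elemI)
    show "\<not> [:w * g, 1:] dvd 1"
      by (simp add: is_unit_poly_iff)
    fix a b assume "[:w * g, 1:] dvd a * b"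
    then show "[:w * g, 1:] dvd a \<or> [:w * g, 1:] dvd b"
      unfolding root by simp
  qed simp
  moreover have "[:g, u:] = [:u:] * [:w * g, 1:]"
    using w by (simp add: algebra_simps)
  moreover have "[:u:] dvd 1" using assms by (simp add: is_unit_const_poly_iff)
  ultimately show ?thesis by (metis prime_elem_mult_unit_left)
qed

definition lin :: "complex \<Rightarrow> complex \<Rightarrow> complex \<Rightarrow> polyS" where
  "lin a b c = cst a * varX + cst b * varY + cst c * varZ"

lemma lin_pCons: "lin a b c = [:[:[:0, a:], [:b:]:], [:[:c:]:]:]"
  by (simp add: lin_def cst_def varX_def varY_def varZ_def)

lemma prime_lin: "c \<noteq> 0 \<Longrightarrow> prime_elem (lin a b c)"
  unfolding lin_pCons by (rule prime_elem_linear_unit) (simp add: is_unit_const_poly_iff dvd_field_iff)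

lemma prime_varX: "prime_elem varX"
  unfolding varX_def by (intro lift_prime_elem_poly prime_elem_linear_unit) simp

text \<open>As a quadratic polynomial in \<open>z\<close> the conic has an invertible leading coefficient, and its
  discriminant \<open>18720 x\<^sup>2 + 23716 y\<^sup>2\<close> is not a square.\<close>

lemma prime_conic:
  "prime_elem (- 24 * varX^2 - 23 * varY^2 + 76 * varY * varZ + 195 * varZ^2)" (is "prime_elem ?C")
proof -
  let ?c0 = "[:[:0, 0, -24:], 0, [:-23:]:] :: complex poly poly"
  let ?c1 = "[:0, [:76:]:] :: complex poly poly"
  let ?c2 = "[:[:195:]:] :: complex poly poly"
  have C: "?C = [:?c0, ?c1, ?c2:]"
    by (simp add: varX_def varY_def varZ_def power2_eq_square numeral_poly)
  have no_root: "poly [:?c0, ?c1, ?c2:] r \<noteq> 0" for r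
  proof
    assume "poly [:?c0, ?c1, ?c2:] r = 0"
    then have root: "?c0 + r * (?c1 + r * ?c2) = 0"
      unfolding poly_pCons by (simp only: poly_0 mult_zero_right add_0_right)
    have "(2 * c * r + b)^2 = b^2 - 4 * a * c + 4 * c * (a + r * (b + r * c))"
      for a b c :: "complex poly poly"
      by (simp add: power2_eq_square algebra_simps)
    from this[of ?c2 ?c1 ?c0] have "(2 * ?c2 * r + ?c1)^2 = ?c1^2 - 4 * ?c0 * ?c2"
      unfolding root by (simp only: mult_zero_right add_0_right)
    also have "\<dots> = [:[:0, 0, 18720:], 0, [:23716:]:]"
      by (simp add: power2_eq_square numeral_poly)
    finally have sq: "(2 * ?c2 * r + ?c1)^2 = [:[:0, 0, 18720:], 0, [:23716:]:]" .
    define s where "s = 2 * ?c2 * r + ?c1"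
    have s2: "s^2 = [:[:0, 0, 18720:], 0, [:23716:]:]" using sq by (simp add: s_def)
    have "degree (s^2) = 2" by (simp add: s2)
    moreover have "degree (s^2) = 2 * degree s"
      by (cases "s = 0") (simp_all add: power2_eq_square degree_mult_eq)
    ultimately have "degree s = 1" by simp
    then obtain u v where s: "s = [:u, v:]"
      by (metis One_nat_def degree1_coeffs)
    have "u * u = [:0, 0, 18720:]" "u * v + v * u = 0" "v * v = [:23716:]"
      using s2 by (simp_all add: s power2_eq_square)
    then show False by (auto simp: algebra_simps)
  qed
  have "irreducible ?C"
  proof (rule irreducibleI)
    show "?C \<noteq> 0" unfolding C by simp
    show "\<not> ?C dvd 1" unfolding C by (simp add: is_unit_poly_iff)
    fix a b assume ab: "?C = a * b"
    then have nz: "a \<noteq> 0" "b \<noteq> 0" using \<open>?C \<noteq> 0\<close> by auto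
    have "degree a + degree b = degree ?C"
      using degree_mult_eq[OF nz] by (simp only: ab)
    then have deg: "degree a + degree b = 2" unfolding C by simp
    have "lead_coeff a * lead_coeff b = lead_coeff ?C"
      by (simp only: ab lead_coeff_mult)
    also have "\<dots> = ?c2" unfolding C by simp
    finally have "lead_coeff a * lead_coeff b dvd 1"
      by (simp add: is_unit_const_poly_iff dvd_field_iff)
    then have u: "lead_coeff a dvd 1" "lead_coeff b dvd 1"
      by (simp_all add: is_unit_mult_iff)
    have nod1: "degree p \<noteq> 1" if "lead_coeff p dvd 1" "p dvd ?C" for p
    proof
      assume "degree p = 1"
      then obtain g l where p: "p = [:g, l:]" "l \<noteq> 0" by (metis One_nat_def degree1_coeffs)
      with that obtain w where w: "1 = l * w" by (auto elim: dvdE)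
      have "poly p (- (w * g)) = g * (1 - l * w)" by (simp add: p algebra_simps)
      then have "poly p (- (w * g)) = 0" by (simp flip: w)
      moreover obtain k where "?C = p * k" using \<open>p dvd ?C\<close> by (elim dvdE)
      ultimately have "poly ?C (- (w * g)) = 0" by simp
      with no_root show False unfolding C by blast
    qed
    have "degree a \<noteq> 1" using nod1[OF u(1)] ab by (metis dvd_triv_left)
    then consider "degree a = 0" | "degree b = 0" using deg by linarith
    then show "a dvd 1 \<or> b dvd 1"
      using u by cases (auto elim!: degree_eq_zeroE simp: is_unit_const_poly_iff)
  qed
  then show ?thesis by (rule irreducible_imp_prime_elem)
qed

text \<open>Two linear forms with independent coefficients generate the prime ideal of the point where both
  vanish, the cross product of their coefficients. So a polynomial that does not vanish there can be
  cancelled modulo this ideal. If the first coordinate of the point is nonzero, then \<open>y\<close> and \<open>z\<close> are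
  multiples of \<open>x\<close> modulo the ideal, and the residue ring is \<open>\<complex>[x]\<close>.\<close>

lemma cancel_mod_two_lines:
  assumes L: "L = lin a1 b1 c1" and M: "M = lin a2 b2 c2" and D: "b1 * c2 - b2 * c1 \<noteq> 0"
    and p: "eval p (b1 * c2 - b2 * c1, c1 * a2 - c2 * a1, a1 * b2 - a2 * b1) \<noteq> 0"
    and eq: "p * f = L * q + M * r"
  shows "\<exists>q r. f = L * q + M * r"
proof -
  define d where "d = b1 * c2 - b2 * c1"
  define al where "al = (a1 * b2 - a2 * b1) / d"
  define de where "de = (c1 * a2 - c2 * a1) / d"
  define g :: "complex poly poly" where "g = [:[:0, al:]:]"
  define h :: "complex poly" where "h = [:0, de:]"
  define res where "res f = poly (poly f g) h" for f :: polyS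
  have d: "d \<noteq> 0" using D by (simp add: d_def)
  have res_mult: "res (f * g) = res f * res g" and res_add: "res (f + g) = res f + res g" for f g
    by (simp_all add: res_def)
  have "res L = 0" "res M = 0"
    using d by (simp_all add: res_def L M lin_pCons g_def h_def al_def de_def d_def field_simps)
  then have "res p * res f = 0"
    using arg_cong[OF eq, of res] by (simp add: res_mult res_add)
  moreover have "poly (res p) d = eval p (b1 * c2 - b2 * c1, c1 * a2 - c2 * a1, a1 * b2 - a2 * b1)"
  proof -
    have 0: "poly (poly P h) d = poly (poly P [:de * d:]) d" for P
      by (induction P) (auto simp: h_def)
    have 1: "poly (poly (poly P g) h) d = eval P (d, de * d, al * d)" for P
      unfolding eval.simps by (induction P) (auto simp: g_def 0)
    show ?thesis using d unfolding res_def 1 by (simp add: al_def de_def d_def)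
  qed
  ultimately have res_f: "res f = 0" using p by auto
  have "[:- g, 1:] dvd f - [:poly f g:]"
    by (simp add: poly_eq_0_iff_dvd[symmetric])
  then obtain q1 where q1: "f = [:- g, 1:] * q1 + [:poly f g:]"
    by (metis diff_add_cancel dvdE)
  have "[:- h, 1:] dvd poly f g"
    using res_f by (simp add: res_def poly_eq_0_iff_dvd[symmetric])
  then obtain r1 where r1: "poly f g = [:- h, 1:] * r1" by (elim dvdE)
  have comb: "cst k * lin a b c - cst l * lin a' b' c' = lin (k * a - l * a') (k * b - l * b') (k * c - l * c')"
    for k l a b c a' b' c'
    by (simp add: lin_pCons cst_def)
  have "b1 / d * a2 - b2 / d * a1 = - al" "b1 / d * b2 - b2 / d * b1 = 0" "b1 / d * c2 - b2 / d * c1 = 1"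
    using d by (simp_all add: al_def field_simps) (simp add: d_def)
  then have "cst (b1 / d) * M - cst (b2 / d) * L = lin (- al) 0 1"
    unfolding L M comb by simp
  then have z: "[:- g, 1:] = cst (b1 / d) * M - cst (b2 / d) * L"
    by (simp add: g_def lin_pCons flip: one_pCons)
  have "c2 / d * a1 - c1 / d * a2 = - de" "c2 / d * b1 - c1 / d * b2 = 1" "c2 / d * c1 - c1 / d * c2 = 0"
    using d by (simp_all add: de_def field_simps) (simp add: d_def)
  then have "cst (c2 / d) * L - cst (c1 / d) * M = lin (- de) 1 0"
    unfolding L M comb by simp
  then have y: "[:[:- h, 1:]:] = cst (c2 / d) * L - cst (c1 / d) * M"
    by (simp add: h_def lin_pCons)
  have "f = [:- g, 1:] * q1 + [:[:- h, 1:]:] * [:r1:]"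
    using q1 by (simp add: r1)
  then have "f = L * (cst (c2 / d) * [:r1:] - cst (b2 / d) * q1)
      + M * (cst (b1 / d) * q1 - cst (c1 / d) * [:r1:])"
    unfolding z y by (simp add: algebra_simps)
  then show ?thesis by blast
qed

lemma eval_zero_if_dvd: "p dvd q \<Longrightarrow> eval p v = 0 \<Longrightarrow> eval q v = 0"
  by (elim dvdE) simp

section \<open>Germs of holomorphic functions with continuous derivative\<close>

text \<open>The inverse function theorem needs a continuous derivative; carrying its two components along avoids
  deducing their continuity from holomorphy.\<close>

definition hol1 :: "(complex \<times> complex) set \<Rightarrow> germ \<Rightarrow> germ \<Rightarrow> germ \<Rightarrow> bool" where
  "hol1 U F A B \<longleftrightarrow> (\<forall>w \<in> U. (F has_derivative (\<lambda>(s, t). A w * s + B w * t)) (at w)) \<and>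
     continuous_on U A \<and> continuous_on U B"

lemma hol1_subset: "hol1 U F A B \<Longrightarrow> V \<subseteq> U \<Longrightarrow> hol1 V F A B"
  unfolding hol1_def by (meson continuous_on_subset subsetD)

lemma hol1_holomorphic: "hol1 U F A B \<Longrightarrow> holomorphic2_on F U"
  unfolding hol1_def holomorphic2_on_def by blast

lemma hol1_continuous: "hol1 U F A B \<Longrightarrow> continuous_on U F"
  unfolding hol1_def continuous_on_eq_continuous_within
  by (meson has_derivative_at_withinI has_derivative_continuous)

lemma hol1_mult:
  assumes "hol1 U F A B" "hol1 U G C D"
  shows "hol1 U (\<lambda>w. F w * G w) (\<lambda>w. F w * C w + A w * G w) (\<lambda>w. F w * D w + B w * G w)"
  unfolding hol1_def
proof (intro conjI ballI)
  fix w assume "w \<in> U"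
  then have "(F has_derivative (\<lambda>(s, t). A w * s + B w * t)) (at w)"
    "(G has_derivative (\<lambda>(s, t). C w * s + D w * t)) (at w)"
    using assms by (auto simp: hol1_def)
  then have "((\<lambda>w. F w * G w) has_derivative
      (\<lambda>h. F w * (case h of (s, t) \<Rightarrow> C w * s + D w * t) + (case h of (s, t) \<Rightarrow> A w * s + B w * t) * G w)) (at w)"
    by (rule has_derivative_mult)
  then show "((\<lambda>w. F w * G w) has_derivative
      (\<lambda>(s, t). (F w * C w + A w * G w) * s + (F w * D w + B w * G w) * t)) (at w)"
    by (rule has_derivative_eq_rhs) (auto simp: fun_eq_iff algebra_simps)
next
  show "continuous_on U (\<lambda>w. F w * C w + A w * G w)" "continuous_on U (\<lambda>w. F w * D w + B w * G w)"
    using assms hol1_continuous[OF assms(1)] hol1_continuous[OF assms(2)]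
    by (auto simp: hol1_def intro!: continuous_intros)
qed

lemma hol1_compose:
  assumes F: "hol1 U F A B" and S: "\<And>w. w \<in> U \<Longrightarrow> F w \<in> S"
    and f: "\<And>z. z \<in> S \<Longrightarrow> (f has_field_derivative f' z) (at z)" and f': "continuous_on S f'"
  shows "hol1 U (\<lambda>w. f (F w)) (\<lambda>w. f' (F w) * A w) (\<lambda>w. f' (F w) * B w)"
  unfolding hol1_def
proof (intro conjI ballI)
  fix w assume w: "w \<in> U"
  then have "(F has_derivative (\<lambda>(s, t). A w * s + B w * t)) (at w)"
    using F by (auto simp: hol1_def)
  moreover have "(f has_derivative (*) (f' (F w))) (at (F w))"
    using f[OF S[OF w]] by (simp add: has_field_derivative_def)
  ultimately have "((\<lambda>w. f (F w)) has_derivative (\<lambda>h. f' (F w) * (case h of (s, t) \<Rightarrow> A w * s + B w * t))) (at w)"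
    by (rule has_derivative_compose)
  then show "((\<lambda>w. f (F w)) has_derivative (\<lambda>(s, t). f' (F w) * A w * s + f' (F w) * B w * t)) (at w)"
    by (rule has_derivative_eq_rhs) (auto simp: fun_eq_iff algebra_simps)
next
  have "continuous_on U (\<lambda>w. f' (F w))"
    by (rule continuous_on_compose2[OF f' hol1_continuous[OF F]]) (use S in auto)
  then show "continuous_on U (\<lambda>w. f' (F w) * A w)" "continuous_on U (\<lambda>w. f' (F w) * B w)"
    using F by (auto simp: hol1_def intro!: continuous_intros)
qed

lemma hol1_inverse:
  assumes "hol1 U F A B" "\<And>w. w \<in> U \<Longrightarrow> F w \<noteq> 0"
  shows "\<exists>A B. hol1 U (\<lambda>w. inverse (F w)) A B"
proof -
  have "hol1 U (\<lambda>w. inverse (F w)) (\<lambda>w. (\<lambda>z. - (inverse z ^ 2)) (F w) * A w)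
      (\<lambda>w. (\<lambda>z. - (inverse z ^ 2)) (F w) * B w)"
  proof (rule hol1_compose[OF assms(1), where S = "- {0}"])
    show "(inverse has_field_derivative - ((inverse z)\<^sup>2)) (at z)" if "z \<in> - {0}" for z :: complex
      using DERIV_inverse[of z UNIV] that by (simp add: numeral_2_eq_2)
  qed (use assms in \<open>auto intro!: continuous_intros\<close>)
  then show ?thesis by blast
qed

text \<open>The value \<open>F w0\<close> may lie on the branch cut of the logarithm, so the root is taken of \<open>F w / F w0\<close>.\<close>

lemma hol1_root:
  assumes F: "hol1 U F A B" and U: "open U" "w0 \<in> U" and F0: "F w0 \<noteq> 0" and m: "m > 0"
  shows "\<exists>V r A B. open V \<and> w0 \<in> V \<and> V \<subseteq> U \<and> hol1 V r A B \<and> (\<forall>w\<in>V. r w ^ m = F w) \<and> r w0 \<noteq> 0"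
proof -
  define f where "f z = exp (Ln (z / F w0) / of_nat m) * exp (Ln (F w0) / of_nat m)" for z
  define f' where "f' z = f z / (of_nat m * z)" for z
  define S where "S = (\<lambda>z. z / F w0) -` (- \<real>\<^sub>\<le>\<^sub>0)"
  define V where "V = U \<inter> F -` S"
  have S: "open S"
    unfolding S_def using F0 by (intro open_vimage) (auto intro!: continuous_intros)
  have V: "open V"
    unfolding V_def using hol1_continuous[OF F] U S by (intro continuous_open_preimage) auto
  have f: "(f has_field_derivative f' z) (at z)" if "z \<in> S" for z
  proof -
    have z: "z / F w0 \<notin> \<real>\<^sub>\<le>\<^sub>0" "z \<noteq> 0" using that by (auto simp: S_def)
    show ?thesis
      unfolding f_def f'_def using z(1)
      by (auto intro!: derivative_eq_intros) (use z F0 m in \<open>simp add: field_simps\<close>)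
  qed
  have f': "continuous_on S f'"
  proof -
    have "continuous_on S f"
      using f by (meson DERIV_continuous continuous_at_imp_continuous_on)
    moreover have "0 \<notin> S" by (auto simp: S_def)
    ultimately show ?thesis unfolding f'_def using m by (auto intro!: continuous_intros)
  qed
  have "hol1 V (\<lambda>w. f (F w)) (\<lambda>w. f' (F w) * A w) (\<lambda>w. f' (F w) * B w)"
    by (rule hol1_compose[OF hol1_subset[OF F] _ f f']) (auto simp: V_def)
  moreover have "f z ^ m = z" if "z \<in> S" for z
  proof -
    have "z \<noteq> 0" using that by (auto simp: S_def)
    then show ?thesis using F0 m
      by (simp add: f_def power_mult_distrib flip: exp_of_nat_mult)
  qed
  moreover have "w0 \<in> V" using U F0 by (auto simp: V_def S_def)
  moreover have "f (F w0) \<noteq> 0" by (simp add: f_def)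
  moreover have "V \<subseteq> U" "\<And>w. w \<in> V \<Longrightarrow> F w \<in> S" by (auto simp: V_def)
  ultimately show ?thesis using V by blast
qed

text \<open>The complex inverse function theorem in two variables, from the real one: the inverse of an
  invertible complex-linear map is complex-linear.\<close>

lemma local_coordinates:
  assumes X: "hol1 U X A B" and Y: "hol1 U Y C D" and U: "open U" "(0, 0) \<in> U"
    and XY0: "X (0, 0) = 0" "Y (0, 0) = 0"
    and det: "A (0, 0) * D (0, 0) - B (0, 0) * C (0, 0) \<noteq> 0"
  shows "\<exists>\<phi> V W. biholomorphic \<phi> V W \<and> (0, 0) \<in> V \<and> \<phi> (0, 0) = (0, 0) \<and> W \<subseteq> U \<and>
    (\<forall>w\<in>V. X (\<phi> w) = fst w \<and> Y (\<phi> w) = snd w)"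
proof -
  define f where "f w = (X w, Y w)" for w
  define T where "T w = (\<lambda>(s, t). (A w * s + B w * t, C w * s + D w * t))" for w
  have lin_T: "bounded_linear (T w)" for w
  proof -
    have "linear (T w)"
      by (rule linearI) (auto simp: T_def algebra_simps scaleR_conv_of_real)
    then show ?thesis by (simp add: linear_conv_bounded_linear)
  qed
  define f' where "f' w = Blinfun (T w)" for w
  have f'[simp]: "blinfun_apply (f' w) = T w" for w
    by (simp add: f'_def bounded_linear_Blinfun_apply lin_T)
  have derf: "(f has_derivative T w) (at w)" if "w \<in> U" for w
    using X Y that unfolding f_def T_def hol1_def
    by (auto intro!: has_derivative_eq_rhs[OF has_derivative_Pair])
  have contf: "continuous_on U f'"
    by (rule continuous_on_blinfun_componentwise)
      (use X Y in \<open>auto simp: T_def hol1_def split_def intro!: continuous_intros\<close>)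
  define S where "S w = (\<lambda>(s, t). ((D w * s - B w * t) / (A w * D w - B w * C w),
    (A w * t - C w * s) / (A w * D w - B w * C w)))" for w
  have lin_S: "bounded_linear (S w)" for w
  proof -
    have "linear (S w)"
      by (rule linearI) (auto simp: S_def algebra_simps scaleR_conv_of_real add_divide_distrib diff_divide_distrib)
    then show ?thesis by (simp add: linear_conv_bounded_linear)
  qed
  have ST: "S w (T w v) = v" if det: "A w * D w - B w * C w \<noteq> 0" for w v
  proof -
    have "D w * (A w * s + B w * t) - B w * (C w * s + D w * t) = s * (A w * D w - B w * C w)"
      "A w * (C w * s + D w * t) - C w * (A w * s + B w * t) = t * (A w * D w - B w * C w)" for s t
      by (simp_all add: algebra_simps)
    then show ?thesis using det by (simp add: S_def T_def split_def)
  qed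
  have TS: "T w (S w v) = v" if det: "A w * D w - B w * C w \<noteq> 0" for w v
  proof -
    define e where "e = A w * D w - B w * C w"
    have "A w * ((D w * s - B w * t) / e) + B w * ((A w * t - C w * s) / e) = s * e / e"
      "C w * ((D w * s - B w * t) / e) + D w * ((A w * t - C w * s) / e) = t * e / e" for s t
      unfolding times_divide_eq_right add_divide_distrib[symmetric]
      by (simp_all add: e_def algebra_simps)
    moreover have "e \<noteq> 0" using det by (simp add: e_def)
    ultimately show ?thesis by (simp add: S_def T_def split_def flip: e_def)
  qed
  have "Blinfun (S (0, 0)) o\<^sub>L f' (0, 0) = id_blinfun"
    by (rule blinfun_eqI) (simp add: bounded_linear_Blinfun_apply lin_S ST[OF det])
  from inverse_function_theorem[OF U(1) _ contf U(2) this, of f] derf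
  obtain U' V g g' where U': "open U'" "U' \<subseteq> U" "(0, 0) \<in> U'" and V: "open V" "f (0, 0) \<in> V"
    and hom: "homeomorphism U' V f g"
    and g: "\<And>y. y \<in> V \<Longrightarrow> (g has_derivative g' y) (at y)"
    and g': "\<And>y. y \<in> V \<Longrightarrow> g' y = inv_into UNIV (T (g y))"
    and bij: "\<And>y. y \<in> V \<Longrightarrow> bij (T (g y))"
    by (metis f')
  have gU: "g y \<in> U'" "f (g y) = y" if "y \<in> V" for y
    using hom that by (auto simp: homeomorphism_def)
  have fV: "f w \<in> V" "g (f w) = w" if "w \<in> U'" for w
    using hom that by (auto simp: homeomorphism_def)
  have derg: "(g has_derivative S (g y)) (at y)" if y: "y \<in> V" for y
  proof -
    let ?w = "g y"
    have "A ?w * D ?w - B ?w * C ?w \<noteq> 0"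
    proof
      assume 0: "A ?w * D ?w - B ?w * C ?w = 0"
      have inj: "T ?w v = T ?w (0, 0) \<Longrightarrow> v = (0, 0)" for v
        using bij[OF y] by (meson bij_def injD)
      have "(D ?w, - C ?w) = (0, 0)" "(B ?w, - A ?w) = (0, 0)"
        by (rule inj, use 0 in \<open>simp add: T_def algebra_simps\<close>)+
      then have "(1, 0) = (0 :: complex, 0 :: complex)"
        by (intro inj) (simp add: T_def)
      then show False by simp
    qed
    then have "inv_into UNIV (T ?w) = S ?w"
      using ST TS by (intro inv_equality) auto
    then show ?thesis using g[OF y] g'[OF y] by simp
  qed
  have inv_g: "inv_into V g w = f w" if "w \<in> U'" for w
    using that fV gU by (metis inj_on_inverseI inv_into_f_f)
  have "biholomorphic g V U'"
    unfolding biholomorphic_def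
  proof (intro conjI)
    show "bij_betw g V U'"
      by (rule bij_betwI[where g = f]) (use gU fV in auto)
    show "holomorphic2_on (\<lambda>w. fst (g w)) V"
      unfolding holomorphic2_on_def
    proof
      fix y assume "y \<in> V"
      from has_derivative_fst[OF derg[OF this]]
      have "((\<lambda>w. fst (g w)) has_derivative (\<lambda>(s, t). D (g y) / (A (g y) * D (g y) - B (g y) * C (g y)) * s
         + (- B (g y) / (A (g y) * D (g y) - B (g y) * C (g y))) * t)) (at y)"
        by (rule has_derivative_eq_rhs) (auto simp: S_def diff_divide_distrib)
      then show "\<exists>a b. ((\<lambda>w. fst (g w)) has_derivative (\<lambda>(s, t). a * s + b * t)) (at y)" by blast
    qed
    show "holomorphic2_on (\<lambda>w. snd (g w)) V"
      unfolding holomorphic2_on_def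
    proof
      fix y assume "y \<in> V"
      from has_derivative_snd[OF derg[OF this]]
      have "((\<lambda>w. snd (g w)) has_derivative (\<lambda>(s, t). - C (g y) / (A (g y) * D (g y) - B (g y) * C (g y)) * s
         + A (g y) / (A (g y) * D (g y) - B (g y) * C (g y)) * t)) (at y)"
        by (rule has_derivative_eq_rhs) (auto simp: S_def diff_divide_distrib)
      then show "\<exists>a b. ((\<lambda>w. snd (g w)) has_derivative (\<lambda>(s, t). a * s + b * t)) (at y)" by blast
    qed
    have "((\<lambda>w. fst (inv_into V g w)) has_derivative (\<lambda>(s, t). A w * s + B w * t)) (at w)"
      "((\<lambda>w. snd (inv_into V g w)) has_derivative (\<lambda>(s, t). C w * s + D w * t)) (at w)" if "w \<in> U'" for w
    proof -
      have dX: "(X has_derivative (\<lambda>(s, t). A w * s + B w * t)) (at w)"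
        and dY: "(Y has_derivative (\<lambda>(s, t). C w * s + D w * t)) (at w)"
        using X Y that U' by (auto simp: hol1_def)
      show "((\<lambda>w. fst (inv_into V g w)) has_derivative (\<lambda>(s, t). A w * s + B w * t)) (at w)"
        by (rule has_derivative_transform_within_open[OF dX U'(1) that]) (simp add: inv_g f_def)
      show "((\<lambda>w. snd (inv_into V g w)) has_derivative (\<lambda>(s, t). C w * s + D w * t)) (at w)"
        by (rule has_derivative_transform_within_open[OF dY U'(1) that]) (simp add: inv_g f_def)
    qed
    then show "holomorphic2_on (\<lambda>w. fst (inv_into V g w)) U'" "holomorphic2_on (\<lambda>w. snd (inv_into V g w)) U'"
      unfolding holomorphic2_on_def by blast+
  qed (use U' V in auto)
  moreover have "X (g w) = fst w \<and> Y (g w) = snd w" if "w \<in> V" for w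
    using gU(2)[OF that] unfolding f_def by (metis fst_conv snd_conv)
  moreover have "g (0, 0) = (0, 0)" "(0, 0) \<in> V"
    using fV[OF U'(3)] V(2) by (simp_all add: f_def XY0)
  ultimately show ?thesis
    using U'(2) by (intro exI[of _ g] exI[of _ V] exI[of _ U'] conjI ballI) simp_all
qed

text \<open>A unit in front of a homogeneous function of two local coordinates is removed by rescaling both
  coordinates with its \<open>m\<close>-th root.\<close>

lemma equivalent_to_homogeneous:
  assumes X: "hol1 U X A B" and Y: "hol1 U Y C D" and N: "hol1 U N A' B'"
    and U: "open U" "(0, 0) \<in> U" and XY0: "X (0, 0) = 0" "Y (0, 0) = 0" and N0: "N (0, 0) \<noteq> 0"
    and det: "A (0, 0) * D (0, 0) - B (0, 0) * C (0, 0) \<noteq> 0"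
    and F: "\<And>w. w \<in> U \<Longrightarrow> F w = N w * H (X w) (Y w)"
    and H: "\<And>k a b. H (k * a) (k * b) = k ^ m * H a b" and m: "m > 0"
  shows "equivalent_germs F (\<lambda>(x, y). H x y)"
proof -
  obtain V r R R' where V: "open V" "(0, 0) \<in> V" "V \<subseteq> U" and r: "hol1 V r R R'"
    "\<And>w. w \<in> V \<Longrightarrow> r w ^ m = N w" "r (0, 0) \<noteq> 0"
    using hol1_root[OF N U N0 m] by blast
  note X1 = hol1_mult[OF r(1) hol1_subset[OF X V(3)]]
  note Y1 = hol1_mult[OF r(1) hol1_subset[OF Y V(3)]]
  have "\<exists>\<phi> V' W. biholomorphic \<phi> V' W \<and> (0, 0) \<in> V' \<and> \<phi> (0, 0) = (0, 0) \<and> W \<subseteq> V \<and>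
    (\<forall>w\<in>V'. r (\<phi> w) * X (\<phi> w) = fst w \<and> r (\<phi> w) * Y (\<phi> w) = snd w)"
  proof (rule local_coordinates[OF X1 Y1 V(1,2)])
    have "(r (0, 0))\<^sup>2 * (A (0, 0) * D (0, 0) - B (0, 0) * C (0, 0)) \<noteq> 0" using det r(3) by simp
    then show "(r (0, 0) * A (0, 0) + R (0, 0) * X (0, 0)) * (r (0, 0) * D (0, 0) + R' (0, 0) * Y (0, 0)) -
      (r (0, 0) * B (0, 0) + R' (0, 0) * X (0, 0)) * (r (0, 0) * C (0, 0) + R (0, 0) * Y (0, 0)) \<noteq> 0"
      by (simp add: XY0 power2_eq_square algebra_simps)
  qed (simp_all add: XY0)
  then obtain \<phi> V' W where \<phi>: "biholomorphic \<phi> V' W" "(0, 0) \<in> V'" "\<phi> (0, 0) = (0, 0)" "W \<subseteq> V"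
    and coord: "\<And>w. w \<in> V' \<Longrightarrow> r (\<phi> w) * X (\<phi> w) = fst w \<and> r (\<phi> w) * Y (\<phi> w) = snd w"
    by blast
  have "F (\<phi> w) = (\<lambda>(x, y). H x y) w" if "w \<in> V'" for w
  proof -
    have "\<phi> w \<in> V" using \<phi> that by (auto simp: biholomorphic_def bij_betw_def)
    then have "F (\<phi> w) = r (\<phi> w) ^ m * H (X (\<phi> w)) (Y (\<phi> w))"
      using F[of "\<phi> w"] r(2)[of "\<phi> w"] V(3) by auto
    also have "\<dots> = H (fst w) (snd w)" unfolding H[symmetric] using coord[OF that] by simp
    finally show ?thesis by (simp add: split_def)
  qed
  then show ?thesis
    unfolding equivalent_germs_def using \<phi>
    by (intro exI[of _ \<phi>] exI[of _ V'] exI[of _ W] conjI ballI) simp_all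
qed

text \<open>The multiplicity of an ordinary singularity is the order of vanishing along a general smooth
  curve germ, so it is not changed by a change of coordinates.\<close>

lemma ordinary_multiplicity:
  assumes ord: "ordinary m F" and eq: "equivalent_germs F G"
    and hom: "\<And>k a b. G (k * a, k * b) = k ^ d * G (a, b)"
  shows "m = d"
proof -
  obtain U g a b where *: "open U \<and> (0, 0) \<in> U \<and>
     (\<forall>i < m. holomorphic2_on (g i) U \<and> g i (0, 0) = 0 \<and>
        (g i has_derivative (\<lambda>(s, t). a i * s + b i * t)) (at (0, 0)) \<and> (a i, b i) \<noteq> (0, 0)) \<and>
     (\<forall>i < m. \<forall>j < m. i \<noteq> j \<longrightarrow> a i * b j \<noteq> a j * b i) \<and>
     (\<forall>w \<in> U. F w = (\<Prod>i<m. g i w))"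
    using ord unfolding ordinary_def by (elim exE)
  then have U: "open U" "(0, 0) \<in> U"
    and g: "\<And>i. i < m \<Longrightarrow> g i (0, 0) = 0"
      "\<And>i. i < m \<Longrightarrow> (g i has_derivative (\<lambda>(s, t). a i * s + b i * t)) (at (0, 0))"
      "\<And>i. i < m \<Longrightarrow> (a i, b i) \<noteq> (0, 0)"
    and F: "\<And>w. w \<in> U \<Longrightarrow> F w = (\<Prod>i<m. g i w)"
    by blast+
  obtain \<phi> V W where bih: "biholomorphic \<phi> V W" and V0: "(0, 0) \<in> V" and \<phi>0: "\<phi> (0, 0) = (0, 0)"
    and FG: "\<And>w. w \<in> V \<Longrightarrow> F (\<phi> w) = G w"
    using eq unfolding equivalent_germs_def by blast
  define \<psi> where "\<psi> = inv_into V \<phi>"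
  have V: "open V" "open W" and bij: "bij_betw \<phi> V W" using bih by (auto simp: biholomorphic_def)
  have W0: "(0, 0) \<in> W" using bij V0 \<phi>0 by (metis bij_betwE)
  have h\<phi>: "holomorphic2_on (\<lambda>w. fst (\<phi> w)) V" "holomorphic2_on (\<lambda>w. snd (\<phi> w)) V"
    "holomorphic2_on (\<lambda>w. fst (\<psi> w)) W" "holomorphic2_on (\<lambda>w. snd (\<psi> w)) W"
    using bih by (simp_all add: biholomorphic_def \<psi>_def)
  obtain p q r s where pq: "((\<lambda>w. fst (\<phi> w)) has_derivative (\<lambda>(x, y). p * x + q * y)) (at (0, 0))"
    and rs: "((\<lambda>w. snd (\<phi> w)) has_derivative (\<lambda>(x, y). r * x + s * y)) (at (0, 0))"
    using h\<phi>(1,2)[unfolded holomorphic2_on_def, rule_format, OF V0] by blast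
  obtain p' q' r' s' where pq': "((\<lambda>w. fst (\<psi> w)) has_derivative (\<lambda>(x, y). p' * x + q' * y)) (at (0, 0))"
    and rs': "((\<lambda>w. snd (\<psi> w)) has_derivative (\<lambda>(x, y). r' * x + s' * y)) (at (0, 0))"
    using h\<phi>(3,4)[unfolded holomorphic2_on_def, rule_format, OF W0] by blast
  have d\<phi>: "(\<phi> has_derivative (\<lambda>(x, y). (p * x + q * y, r * x + s * y))) (at (0, 0))"
    using has_derivative_Pair[OF pq rs] by (auto simp: split_def)
  have d\<psi>: "(\<psi> has_derivative (\<lambda>(x, y). (p' * x + q' * y, r' * x + s' * y))) (at (0, 0))"
    using has_derivative_Pair[OF pq' rs'] by (auto simp: split_def)
  have \<psi>0: "\<psi> (0, 0) = (0, 0)"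
    unfolding \<psi>_def using bij V0 \<phi>0 by (metis bij_betw_inv_into_left)
  have inv: "\<phi> (\<psi> w) = w" if "w \<in> W" for w
    unfolding \<psi>_def using bij that by (metis bij_betw_inv_into_right)
  have "((\<lambda>w. \<phi> (\<psi> w)) has_derivative (\<lambda>w. (\<lambda>(x, y). (p * x + q * y, r * x + s * y))
      ((\<lambda>(x, y). (p' * x + q' * y, r' * x + s' * y)) w))) (at (0, 0))"
    by (rule has_derivative_compose[OF d\<psi>]) (simp add: \<psi>0 d\<phi>)
  then have "((\<lambda>w. w) has_derivative (\<lambda>w. (\<lambda>(x, y). (p * x + q * y, r * x + s * y))
      ((\<lambda>(x, y). (p' * x + q' * y, r' * x + s' * y)) w))) (at (0, 0))"
    by (rule has_derivative_transform_within_open[OF _ V(2) W0]) (simp add: inv)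
  from has_derivative_unique[OF this has_derivative_ident]
  have "(\<lambda>(x, y). (p * x + q * y, r * x + s * y)) ((\<lambda>(x, y). (p' * x + q' * y, r' * x + s' * y)) w) = w" for w
    by metis
  from this[of "(1, 0)"] this[of "(0, 1)"]
  have id: "p * p' + q * r' = 1" "r * p' + s * r' = 0" "p * q' + q * s' = 0" "r * q' + s * s' = 1"
    by simp_all
  define k where "k i v = (a i * p + b i * r) + (a i * q + b i * s) * v" for i v
  have "finite {v. k i v = 0}" if "i < m" for i
  proof (cases "a i * q + b i * s = 0")
    case True
    have "a i * p + b i * r \<noteq> 0"
    proof
      assume 0: "a i * p + b i * r = 0"
      have "a i = a i * (p * p' + q * r') + b i * (r * p' + s * r')" by (simp add: id)
      also have "\<dots> = (a i * p + b i * r) * p' + (a i * q + b i * s) * r'" by (simp add: algebra_simps)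
      finally have "a i = 0" using 0 True by simp
      have "b i = a i * (p * q' + q * s') + b i * (r * q' + s * s')" by (simp add: id)
      also have "\<dots> = (a i * p + b i * r) * q' + (a i * q + b i * s) * s'" by (simp add: algebra_simps)
      finally have "b i = 0" using 0 True by simp
      with \<open>a i = 0\<close> g(3)[OF that] show False by simp
    qed
    then show ?thesis by (simp add: k_def True)
  next
    case False
    then have "{v. k i v = 0} \<subseteq> {- (a i * p + b i * r) / (a i * q + b i * s)}"
      by (auto simp: k_def field_simps add_eq_0_iff)
    then show ?thesis by (rule finite_subset) simp
  qed
  then have "finite (\<Union>i<m. {v. k i v = 0})" by auto
  from ex_new_if_finite[OF infinite_UNIV_char_0 this]
  obtain v where "v \<notin> (\<Union>i<m. {v. k i v = 0})" by blast
  then have v: "\<And>i. i < m \<Longrightarrow> k i v \<noteq> 0" by simp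
  define \<gamma> where "\<gamma> x = \<phi> (x, x * v)" for x
  have d\<gamma>: "(\<gamma> has_derivative (\<lambda>h. (p * h + q * (h * v), r * h + s * (h * v)))) (at 0)"
  proof -
    have "((\<lambda>x. (x, x * v)) has_derivative (\<lambda>h. (h, h * v))) (at 0)"
      by (auto intro!: derivative_eq_intros)
    then have "((\<lambda>x. \<phi> (x, x * v)) has_derivative (\<lambda>h. (\<lambda>(x, y). (p * x + q * y, r * x + s * y)) (h, h * v))) (at 0)"
      by (rule has_derivative_compose) (simp add: d\<phi>)
    then show ?thesis by (simp add: \<gamma>_def[abs_def])
  qed
  have \<gamma>0: "\<gamma> 0 = (0, 0)" by (simp add: \<gamma>_def \<phi>0)
  have lim_i: "((\<lambda>x. g i (\<gamma> x) / x) \<longlongrightarrow> k i v) (at 0)" if "i < m" for i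
  proof -
    have "((\<lambda>x. g i (\<gamma> x)) has_derivative
        (\<lambda>h. (\<lambda>(s, t). a i * s + b i * t) (p * h + q * (h * v), r * h + s * (h * v)))) (at 0)"
      by (rule has_derivative_compose[OF d\<gamma>]) (simp add: \<gamma>0 g(2)[OF that])
    then have "((\<lambda>x. g i (\<gamma> x)) has_field_derivative k i v) (at 0)"
      unfolding has_field_derivative_def
      by (rule has_derivative_eq_rhs) (auto simp: fun_eq_iff k_def algebra_simps)
    then show ?thesis using g(1)[OF that] by (simp add: DERIV_def \<gamma>0)
  qed
  have lim: "((\<lambda>x. \<Prod>i<m. g i (\<gamma> x) / x) \<longlongrightarrow> (\<Prod>i<m. k i v)) (at 0)"
    by (rule tendsto_prod) (use lim_i in auto)
  have "(\<Prod>i<m. k i v) \<noteq> 0" using v by auto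
  have ev: "\<forall>\<^sub>F x in at 0. (\<Prod>i<m. g i (\<gamma> x) / x) = x ^ d * G (1, v) / x ^ m"
  proof -
    have "\<forall>\<^sub>F x in at 0. (x, x * v) \<in> V"
    proof -
      have "((\<lambda>x. (x, x * v)) \<longlongrightarrow> (0, 0 * v)) (at 0)" by (intro tendsto_intros)
      then show ?thesis using V(1) V0 by (auto dest: topological_tendstoD)
    qed
    moreover have "\<forall>\<^sub>F x in at 0. \<gamma> x \<in> U"
    proof -
      have "(\<gamma> \<longlongrightarrow> \<gamma> 0) (at 0)"
        using has_derivative_continuous[OF d\<gamma>] by (simp add: continuous_within)
      then show ?thesis using U by (auto simp: \<gamma>0 dest: topological_tendstoD)
    qed
    ultimately show ?thesis
    proof eventually_elim
      case (elim x)
      then have "(\<Prod>i<m. g i (\<gamma> x)) = G (x, x * v)"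
        using F[of "\<gamma> x"] FG[of "(x, x * v)"] by (simp add: \<gamma>_def)
      also have "\<dots> = x ^ d * G (1, v)" using hom[of x 1 v] by simp
      finally show ?case by (simp add: prod_dividef)
    qed
  qed
  have lim2: "((\<lambda>x. x ^ d * G (1, v) / x ^ m) \<longlongrightarrow> (\<Prod>i<m. k i v)) (at 0)"
    by (rule Lim_transform_eventually[OF lim ev])
  show "m = d"
  proof (rule ccontr)
    assume "m \<noteq> d"
    then consider "m < d" | "d < m" by linarith
    then have "(\<Prod>i<m. k i v) = 0"
    proof cases
      case 1
      have 0: "((\<lambda>x :: complex. x ^ (d - m) * G (1, v)) \<longlongrightarrow> 0 ^ (d - m) * G (1, v)) (at 0)"
        by (intro tendsto_intros)
      have "\<forall>\<^sub>F x in at 0. x ^ (d - m) * G (1, v) = x ^ d * G (1, v) / x ^ m"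
        using eventually_neq_at_within[of 0 0] by eventually_elim (use 1 in \<open>simp add: power_diff\<close>)
      from Lim_transform_eventually[OF 0 this]
      have "((\<lambda>x. x ^ d * G (1, v) / x ^ m) \<longlongrightarrow> 0) (at 0)"
        using 1 by (simp add: power_0_left)
      then show ?thesis using lim2 LIM_unique by blast
    next
      case 2
      have 0: "((\<lambda>x. x ^ (m - d) * (x ^ d * G (1, v) / x ^ m)) \<longlongrightarrow> 0 ^ (m - d) * (\<Prod>i<m. k i v)) (at 0)"
        by (intro tendsto_intros lim2)
      have "\<forall>\<^sub>F x in at 0. x ^ (m - d) * (x ^ d * G (1, v) / x ^ m) = G (1, v)"
        using eventually_neq_at_within[of 0 0] by eventually_elim (use 2 in \<open>simp add: power_diff\<close>)
      from Lim_transform_eventually[OF 0 this]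
      have "((\<lambda>x :: complex. G (1, v)) \<longlongrightarrow> 0) (at 0)"
        using 2 by (simp add: power_0_left)
      then have "G (1, v) = 0" by (simp add: tendsto_const_iff)
      then have "((\<lambda>x :: complex. 0 :: complex) \<longlongrightarrow> (\<Prod>i<m. k i v)) (at 0)" using lim2 by simp
      then show ?thesis by (simp add: tendsto_const_iff)
    qed
    with \<open>(\<Prod>i<m. k i v) \<noteq> 0\<close> show False by simp
  qed
qed

section \<open>Local types of the germs of a form\<close>

lemma polyS_induct [case_names cst varX varY varZ add mult]:
  assumes cst: "\<And>c. P (cst c)" and vars: "P varX" "P varY" "P varZ"
    and add: "\<And>p q. P p \<Longrightarrow> P q \<Longrightarrow> P (p + q)" and mult: "\<And>p q. P p \<Longrightarrow> P q \<Longrightarrow> P (p * q)"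
  shows "P p"
proof -
  have 1: "P [:[:b:]:]" for b
  proof (induction b)
    case 0 then show ?case using cst[of 0] by (simp add: cst_def)
  next
    case (pCons a b)
    have "[:[:pCons a b:]:] = cst a + varX * [:[:b:]:]" by (simp add: cst_def varX_def)
    then show ?case using pCons cst vars add mult by metis
  qed
  have 2: "P [:b:]" for b
  proof (induction b)
    case 0 then show ?case using cst[of 0] by (simp add: cst_def)
  next
    case (pCons a b)
    have "[:pCons a b:] = [:[:a:]:] + varY * [:b:]" by (simp add: varY_def)
    then show ?case using pCons 1 vars add mult by metis
  qed
  show ?thesis
  proof (induction p)
    case 0 then show ?case using cst[of 0] by (simp add: cst_def)
  next
    case (pCons a b)
    have "pCons a b = [:a:] + varZ * b" by (simp add: varZ_def)
    then show ?case using pCons 2 vars add mult by metis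
  qed
qed

definition plane :: "complex \<times> complex \<times> complex \<Rightarrow> complex \<times> complex \<times> complex \<Rightarrow>
    complex \<times> complex \<times> complex \<Rightarrow> complex \<times> complex \<Rightarrow> complex \<times> complex \<times> complex" where
  "plane v u w = (\<lambda>(s, t). (fst v + s * fst u + t * fst w,
     fst (snd v) + s * fst (snd u) + t * fst (snd w), snd (snd v) + s * snd (snd u) + t * snd (snd w)))"

text \<open>All standard charts are restrictions to an affine plane through a representative of the point.\<close>

definition germ_at where "germ_at v u w f = (\<lambda>x. eval f (plane v u w x))"

definition dir :: "complex \<times> complex \<times> complex \<Rightarrow> polyS \<Rightarrow> polyS" where
  "dir u f = der (cst (fst u)) (cst (fst (snd u))) (cst (snd (snd u))) f"

lemma dir_add [simp]: "dir u (f + g) = dir u f + dir u g"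
  and dir_diff [simp]: "dir u (f - g) = dir u f - dir u g"
  and dir_uminus [simp]: "dir u (- f) = - dir u f"
  and dir_mult [simp]: "dir u (f * g) = dir u f * g + f * dir u g"
  and dir_power2 [simp]: "dir u (f ^ 2) = 2 * f * dir u f"
  and dir_cst [simp]: "dir u (cst c) = 0" and dir_numeral [simp]: "dir u (numeral k) = 0"
  and dir_1 [simp]: "dir u 1 = 0"
  and dir_var [simp]: "dir u varX = cst (fst u)" "dir u varY = cst (fst (snd u))"
    "dir u varZ = cst (snd (snd u))"
  by (simp_all add: dir_def)

lemma plane_0 [simp]: "plane v u w (0, 0) = v"
  by (simp add: plane_def)

lemma germ_at_0 [simp]: "germ_at v u w f (0, 0) = eval f v"
  by (simp add: germ_at_def)

lemma germ_at_has_derivative: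
  "(germ_at v u w f has_derivative (\<lambda>(s, t). germ_at v u w (dir u f) x * s + germ_at v u w (dir w f) x * t)) (at x)"
proof (induction f rule: polyS_induct)
  case (cst c)
  then show ?case by (simp add: germ_at_def)
next
  case varX
  have "((\<lambda>x. fst v + fst x * fst u + snd x * fst w) has_derivative (\<lambda>x. fst x * fst u + snd x * fst w)) (at x)"
    by (auto intro!: derivative_eq_intros)
  then show ?case by (simp add: germ_at_def plane_def split_def mult.commute)
next
  case varY
  have "((\<lambda>x. fst (snd v) + fst x * fst (snd u) + snd x * fst (snd w)) has_derivative
      (\<lambda>x. fst x * fst (snd u) + snd x * fst (snd w))) (at x)"
    by (auto intro!: derivative_eq_intros)
  then show ?case by (simp add: germ_at_def plane_def split_def mult.commute)
next
  case varZ
  have "((\<lambda>x. snd (snd v) + fst x * snd (snd u) + snd x * snd (snd w)) has_derivative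
      (\<lambda>x. fst x * snd (snd u) + snd x * snd (snd w))) (at x)"
    by (auto intro!: derivative_eq_intros)
  then show ?case by (simp add: germ_at_def plane_def split_def mult.commute)
next
  case (add p q)
  from has_derivative_add[OF this] show ?case
    unfolding germ_at_def by (simp add: split_def algebra_simps)
next
  case (mult p q)
  from has_derivative_mult[OF this] show ?case
    unfolding germ_at_def by (simp add: split_def algebra_simps)
qed

lemma hol1_germ_at:
  "hol1 U (germ_at v u w f) (germ_at v u w (dir u f)) (germ_at v u w (dir w f))"
proof -
  have "continuous_on U (germ_at v u w g)" for g
    by (meson germ_at_has_derivative continuous_at_imp_continuous_on has_derivative_continuous)
  then show ?thesis
    unfolding hol1_def using germ_at_has_derivative by blast
qed

text \<open>The form \<open>M\<close> is the denominator of the unit: identities between forms produce a multiple of \<open>Q\<close>.\<close>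

lemma germ_equivalent_to_homogeneous:
  assumes XY: "eval X v = 0" "eval Y v = 0" and NM: "eval N v \<noteq> 0" "eval M v \<noteq> 0"
    and det: "eval (dir u X) v * eval (dir w Y) v \<noteq> eval (dir w X) v * eval (dir u Y) v"
    and Q: "\<And>p. eval M p * eval Q p = eval N p * H (eval X p) (eval Y p)"
    and H: "\<And>k a b. H (k * a) (k * b) = k ^ m * H a b" and m: "m > 0"
  shows "equivalent_germs (germ_at v u w Q) (\<lambda>(x, y). H x y)"
proof -
  define U where "U = germ_at v u w M -` (- {0})"
  have U: "open U"
    unfolding U_def using hol1_continuous[OF hol1_germ_at[of UNIV v u w M]]
    by (intro open_vimage) auto
  obtain A B where inv: "hol1 U (\<lambda>x. inverse (germ_at v u w M x)) A B"
    using hol1_inverse[OF hol1_germ_at[of U v u w M]] by (auto simp: U_def)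
  show ?thesis
  proof (rule equivalent_to_homogeneous[OF hol1_germ_at hol1_germ_at hol1_mult[OF hol1_germ_at inv] U])
    show "(0, 0) \<in> U" using NM by (simp add: U_def)
    show "germ_at v u w Q x = germ_at v u w N x * inverse (germ_at v u w M x)
        * H (germ_at v u w X x) (germ_at v u w Y x)" if "x \<in> U" for x
      using that Q[of "plane v u w x"] by (simp add: U_def germ_at_def field_simps)
  qed (use assms in auto)
qed

lemma eval_prod: "eval (prod f A) v = (\<Prod>a\<in>A. eval (f a) v)"
  by (induction A rule: infinite_finite_induct) auto

text \<open>The unit \<open>N\<close> is absorbed in the first branch, whose differential it only rescales.\<close>

lemma ordinary_germ_at:
  assumes Q: "Q = N * prod_list fs" and m: "length fs = m" "m \<ge> 2" and N: "eval N v \<noteq> 0"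
    and van: "\<forall>f\<in>set fs. eval f v = 0"
    and det: "\<And>i j. i < j \<Longrightarrow> j < m \<Longrightarrow>
      eval (dir u (fs ! i)) v * eval (dir w (fs ! j)) v \<noteq> eval (dir w (fs ! i)) v * eval (dir u (fs ! j)) v"
  shows "ordinary m (germ_at v u w Q)"
proof -
  define h where "h i = (if i = 0 then N else 1) * fs ! i" for i
  define k where "k i = (if i = 0 then eval N v else 1)" for i :: nat
  have van': "eval (fs ! i) v = 0" if "i < m" for i using van m that by auto
  have h0: "eval (h i) v = 0" and dh: "eval (dir u' (h i)) v = k i * eval (dir u' (fs ! i)) v" if "i < m" for i u'
    using van'[OF that] by (auto simp: h_def k_def)
  have k: "k i \<noteq> 0" for i using N by (simp add: k_def)
  have det': "eval (dir u (h i)) v * eval (dir w (h j)) v \<noteq> eval (dir u (h j)) v * eval (dir w (h i)) v"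
    if "i < m" "j < m" "i \<noteq> j" for i j
  proof -
    have "eval (dir u (fs ! i)) v * eval (dir w (fs ! j)) v \<noteq> eval (dir u (fs ! j)) v * eval (dir w (fs ! i)) v"
      using det[of i j] det[of j i] that by (cases "i < j") (auto simp: mult.commute)
    then have "(k i * k j) * (eval (dir u (fs ! i)) v * eval (dir w (fs ! j)) v)
        \<noteq> (k i * k j) * (eval (dir u (fs ! j)) v * eval (dir w (fs ! i)) v)"
      using k by simp
    then show ?thesis using that by (simp add: dh algebra_simps)
  qed
  have "Q = (\<Prod>i<m. h i)"
    using m unfolding Q h_def prod.distrib
    by (simp add: prod.list_conv_set_nth atLeast0LessThan prod.delta)
  then have prod: "germ_at v u w Q x = (\<Prod>i<m. germ_at v u w (h i) x)" for x
    by (simp add: germ_at_def eval_prod)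
  show ?thesis
    unfolding ordinary_def
  proof (intro exI conjI allI impI ballI)
    fix i assume i: "i < m"
    show "holomorphic2_on (germ_at v u w (h i)) UNIV"
      using hol1_germ_at hol1_holomorphic by blast
    show "germ_at v u w (h i) (0, 0) = 0" using h0[OF i] by simp
    show "(germ_at v u w (h i) has_derivative
        (\<lambda>(s, t). eval (dir u (h i)) v * s + eval (dir w (h i)) v * t)) (at (0, 0))"
      using germ_at_has_derivative[of v u w "h i" "(0, 0)"] by simp
    obtain j where "j < m" "i \<noteq> j" using m i by (metis One_nat_def Suc_1 Suc_le_eq less_trans n_not_Suc_n zero_less_Suc not_gr_zero)
    from det'[OF i this] show "(eval (dir u (h i)) v, eval (dir w (h i)) v) \<noteq> (0, 0)" by auto
  next
    fix i j assume "i < m" "j < m" "i \<noteq> j"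
    then show "eval (dir u (h i)) v * eval (dir w (h j)) v \<noteq> eval (dir u (h j)) v * eval (dir w (h i)) v"
      by (rule det')
  qed (use prod in auto)
qed

fun mult_of :: "singularity_type \<Rightarrow> nat" where
  "mult_of A1 = 2" | "mult_of D4 = 3" | "mult_of X9 = 4"

text \<open>Both quadruple points below have harmonic tangents, hence modulus \<open>0\<close>.\<close>

fun normal_form :: "singularity_type \<Rightarrow> germ" where
  "normal_form A1 = (\<lambda>(x, y). x^2 + y^2)"
| "normal_form D4 = (\<lambda>(x, y). y^2 * x + x^3)"
| "normal_form X9 = (\<lambda>(x, y). x^4 + y^4)"

definition ordinary_of_type :: "singularity_type \<Rightarrow> germ \<Rightarrow> bool" where
  "ordinary_of_type T F \<longleftrightarrow> equivalent_germs F (normal_form T) \<and> ordinary (mult_of T) F"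

lemma normal_form_homogeneous:
  assumes "G \<in> normal_forms T"
  shows "G (k * a, k * b) = k ^ mult_of T * G (a, b)"
  using assms by (cases T) (auto simp: power_mult_distrib algebra_simps power2_eq_square power3_eq_cube power4_eq_xxxx)

lemma normal_form_in: "normal_form T \<in> normal_forms T"
proof (cases T)
  case X9
  have "(\<lambda>(x, y). x^4 + y^4) = (\<lambda>(x :: complex, y). x^4 + y^4 + 0 * x^2 * y^2) \<and> (0 :: complex)^2 \<noteq> 4"
    by (auto simp: fun_eq_iff)
  then show ?thesis unfolding X9 normal_form.simps normal_forms.simps by blast
qed auto

lemma ordinary_of_type_ordinary_iff: "ordinary_of_type T F \<Longrightarrow> ordinary m F \<longleftrightarrow> m = mult_of T"
  using ordinary_multiplicity normal_form_homogeneous normal_form_in unfolding ordinary_of_type_def by metis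

lemma ordinary_of_type_has_type_iff: "ordinary_of_type T F \<Longrightarrow> has_type T' F \<longleftrightarrow> T' = T"
proof -
  assume T: "ordinary_of_type T F"
  have "mult_of T = mult_of T'" if "has_type T' F"
    using that T ordinary_multiplicity normal_form_homogeneous
    unfolding has_type_def ordinary_of_type_def by metis
  moreover have "has_type T F"
    using T normal_form_in unfolding has_type_def ordinary_of_type_def by blast
  ultimately show ?thesis by (cases T; cases T') auto
qed

lemma ordinary_of_type_quasi_homogeneous: "ordinary_of_type T F \<Longrightarrow> quasi_homogeneous F"
proof -
  assume T: "ordinary_of_type T F"
  define h :: "complex poly poly" where "h = (case T of A1 \<Rightarrow> [:[:0, 0, 1:], 0, [:1:]:]
    | D4 \<Rightarrow> [:[:0, 0, 0, 1:], 0, [:0, 1:]:] | X9 \<Rightarrow> [:[:0, 0, 0, 0, 1:], 0, 0, 0, [:1:]:])"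
  have "normal_form T = (\<lambda>(s, t). poly (poly h [:t:]) s)"
    by (cases T) (auto simp: h_def fun_eq_iff power2_eq_square power3_eq_cube power4_eq_xxxx algebra_simps)
  moreover have "h \<noteq> 0" by (cases T) (auto simp: h_def)
  moreover have "\<forall>i j. coeff (coeff h j) i \<noteq> 0 \<longrightarrow> 1 * i + 1 * j = mult_of T"
    by (cases T) (auto simp: h_def coeff_pCons one_pCons split: nat.splits)
  moreover have "0 < mult_of T" by (cases T) auto
  ultimately show ?thesis
    using T unfolding quasi_homogeneous_def weighted_homogeneous_def ordinary_of_type_def
    by (intro exI[of _ h] conjI exI[of _ 1] exI[of _ "mult_of T"]) auto
qed

text \<open>Invertible linear combinations, and multiples by nonzero numbers, of two independent differentials are
  independent.\<close>

lemma det_linear_combination: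
  fixes f g h h' :: "'a \<Rightarrow> complex"
  assumes h: "\<And>u. c * h u = a * f u + b * g u" and h': "\<And>u. c' * h' u = a' * f u + b' * g u"
    and det: "f u * g w \<noteq> f w * g u" and ab: "a * b' \<noteq> a' * b"
  shows "h u * h' w \<noteq> h w * h' u"
proof
  assume eq: "h u * h' w = h w * h' u"
  have "(a * b' - a' * b) * (f u * g w - f w * g u)
      = (c * h u) * (c' * h' w) - (c * h w) * (c' * h' u)"
    unfolding h h' by (simp add: algebra_simps)
  also have "\<dots> = c * c' * (h u * h' w - h w * h' u)" by (simp add: algebra_simps)
  also have "\<dots> = 0" by (simp add: eq)
  finally show False using det ab by simp
qed

text \<open>The coordinates come from \<open>4 f g = (f + g)\<^sup>2 + (\<i> (f - g))\<^sup>2\<close>.\<close>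

lemma node_germ:
  assumes Q: "Q = N * f * g" and v: "eval N v \<noteq> 0" "eval f v = 0" "eval g v = 0"
    and det: "eval (dir u f) v * eval (dir w g) v \<noteq> eval (dir w f) v * eval (dir u g) v"
  shows "ordinary_of_type A1 (germ_at v u w Q)"
  unfolding ordinary_of_type_def
proof
  have "equivalent_germs (germ_at v u w Q) (\<lambda>(x, y). x^2 + y^2)"
  proof (rule germ_equivalent_to_homogeneous[where N = "cst (1/4) * N" and M = 1
        and X = "f + g" and Y = "cst \<i> * (f - g)" and m = 2])
    show "eval (dir u (f + g)) v * eval (dir w (cst \<i> * (f - g))) v
      \<noteq> eval (dir w (f + g)) v * eval (dir u (cst \<i> * (f - g))) v"
      by (rule det_linear_combination[where f = "\<lambda>u. eval (dir u f) v" and g = "\<lambda>u. eval (dir u g) v"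
            and a = 1 and b = 1 and c = 1 and a' = \<i> and b' = "- \<i>" and c' = 1])
        (use det in \<open>simp_all add: algebra_simps\<close>)
    show "eval 1 p * eval Q p = eval (cst (1/4) * N) p * ((eval (f + g) p)\<^sup>2 + (eval (cst \<i> * (f - g)) p)\<^sup>2)" for p
      by (simp add: Q power_mult_distrib, simp add: power2_eq_square algebra_simps)
  qed (use v in \<open>auto simp: power_mult_distrib algebra_simps\<close>)
  then show "equivalent_germs (germ_at v u w Q) (normal_form A1)" by simp
  show "ordinary (mult_of A1) (germ_at v u w Q)"
    by (rule ordinary_germ_at[of _ N "[f, g]"]) (use assms in \<open>auto simp: less_Suc_eq numeral_2_eq_2\<close>)
qed

text \<open>With the coordinates \<open>p = a f\<close> and \<open>q = b g\<close> the third branch is \<open>p + q = 0\<close>, and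
  \<open>4 p q (p + q) = (\<i> (p - q))\<^sup>2 (p + q) + (p + q)\<^sup>3\<close> is the normal form.\<close>

lemma triple_germ:
  assumes Q: "Q = N * f * g * h" and rel: "a * f + b * g = c * h"
    and v: "eval N v \<noteq> 0" "eval f v = 0" "eval g v = 0" "eval a v \<noteq> 0" "eval b v \<noteq> 0" "eval c v \<noteq> 0"
    and det: "eval (dir u f) v * eval (dir w g) v \<noteq> eval (dir w f) v * eval (dir u g) v"
  shows "ordinary_of_type D4 (germ_at v u w Q)"
  unfolding ordinary_of_type_def
proof
  let ?p = "a * f" and ?q = "b * g"
  have h0: "eval h v = 0" using arg_cong[OF rel, of "\<lambda>p. eval p v"] v by simp
  have dh: "eval c v * eval (dir u' h) v = eval a v * eval (dir u' f) v + eval b v * eval (dir u' g) v" for u'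
    using arg_cong[OF rel, of "\<lambda>p. eval (dir u' p) v"] v h0 by simp
  have "equivalent_germs (germ_at v u w Q) (\<lambda>(x, y). y^2 * x + x^3)"
  proof (rule germ_equivalent_to_homogeneous[where N = "cst (1/4) * N" and M = "a * b * c"
        and X = "?p + ?q" and Y = "cst \<i> * (?p - ?q)" and m = 3])
    show "eval (dir u (?p + ?q)) v * eval (dir w (cst \<i> * (?p - ?q))) v
      \<noteq> eval (dir w (?p + ?q)) v * eval (dir u (cst \<i> * (?p - ?q))) v"
      by (rule det_linear_combination[where f = "\<lambda>u. eval (dir u f) v" and g = "\<lambda>u. eval (dir u g) v"
            and a = "eval a v" and b = "eval b v" and c = 1
            and a' = "\<i> * eval a v" and b' = "- \<i> * eval b v" and c' = 1])
        (use det v in \<open>simp_all add: algebra_simps\<close>)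
    show "eval (a * b * c) p * eval Q p = eval (cst (1/4) * N) p *
        ((eval (cst \<i> * (?p - ?q)) p)\<^sup>2 * eval (?p + ?q) p + eval (?p + ?q) p ^ 3)" for p
    proof -
      define P R where "P = eval ?p p" "R = eval ?q p"
      have "eval (a * b * c) p * eval Q p = eval N p * P * R * eval (c * h) p"
        by (simp add: Q P_R_def algebra_simps)
      also have "eval (c * h) p = P + R" by (simp add: P_R_def flip: rel)
      also have "eval N p * P * R * (P + R) = 1/4 * eval N p * ((\<i> * (P - R))\<^sup>2 * (P + R) + (P + R) ^ 3)"
        by (simp add: power_mult_distrib, simp add: power2_eq_square power3_eq_cube algebra_simps)
      finally show ?thesis by (simp add: P_R_def)
    qed
  qed (use v in \<open>auto simp: power_mult_distrib algebra_simps power2_eq_square power3_eq_cube\<close>)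
  then show "equivalent_germs (germ_at v u w Q) (normal_form D4)" by simp
  show "ordinary (mult_of D4) (germ_at v u w Q)"
  proof (rule ordinary_germ_at[of _ N "[f, g, h]"])
    have 1: "eval (dir u f) v * eval (dir w h) v \<noteq> eval (dir w f) v * eval (dir u h) v"
      by (rule det_linear_combination[where f = "\<lambda>u. eval (dir u f) v" and g = "\<lambda>u. eval (dir u g) v"
            and a = 1 and b = 0 and c = 1, OF _ dh]) (use det v in simp_all)
    have 2: "eval (dir u g) v * eval (dir w h) v \<noteq> eval (dir w g) v * eval (dir u h) v"
      by (rule det_linear_combination[where f = "\<lambda>u. eval (dir u f) v" and g = "\<lambda>u. eval (dir u g) v"
            and a = 0 and b = 1 and c = 1, OF _ dh]) (use det v in simp_all)
    show "eval (dir u ([f, g, h] ! i)) v * eval (dir w ([f, g, h] ! j)) v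
        \<noteq> eval (dir w ([f, g, h] ! i)) v * eval (dir u ([f, g, h] ! j)) v"
      if "i < j" "j < mult_of D4" for i j
      using that det 1 2 by (auto simp: less_Suc_eq numeral_3_eq_3)
  qed (use v h0 in \<open>auto simp: Q algebra_simps\<close>)
qed

text \<open>A harmonic quadruple of branches: up to units they are \<open>p\<close>, \<open>q\<close>, \<open>p - q\<close>, \<open>p + q\<close>. Their product
  is \<open>((p + \<i> q)\<^sup>4 - (p - \<i> q)\<^sup>4) / (8 \<i>)\<close>, and a fourth root of \<open>- 1\<close> changes the sign.\<close>

lemma harmonic_quadruple_germ:
  assumes Q: "Q = N * f1 * f2 * f3 * f4"
    and rel: "k1 * f1 - k2 * f2 = k3 * f3" "k1 * f1 + k2 * f2 = k4 * f4"
    and v: "eval N v \<noteq> 0" "eval f1 v = 0" "eval f2 v = 0"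
      "eval k1 v \<noteq> 0" "eval k2 v \<noteq> 0" "eval k3 v \<noteq> 0" "eval k4 v \<noteq> 0"
    and det: "eval (dir u f1) v * eval (dir w f2) v \<noteq> eval (dir w f1) v * eval (dir u f2) v"
  shows "ordinary_of_type X9 (germ_at v u w Q)"
  unfolding ordinary_of_type_def
proof
  let ?p = "k1 * f1" and ?q = "k2 * f2"
  define z where "z = cis (pi / 4)"
  have "z ^ 4 = cis (real 4 * (pi / 4))" unfolding z_def by (rule Complex.DeMoivre)
  then have z4: "z ^ 4 = - 1" by simp
  have z0: "z \<noteq> 0" by (simp add: z_def)
  let ?X = "?p + cst \<i> * ?q" and ?Y = "cst z * (?p - cst \<i> * ?q)"
  have h0: "eval f3 v = 0" "eval f4 v = 0"
    using arg_cong[OF rel(1), of "\<lambda>p. eval p v"] arg_cong[OF rel(2), of "\<lambda>p. eval p v"] v by simp_all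
  have d3: "eval k3 v * eval (dir u' f3) v = eval k1 v * eval (dir u' f1) v + - eval k2 v * eval (dir u' f2) v" for u'
    using arg_cong[OF rel(1), of "\<lambda>p. eval (dir u' p) v"] v h0 by simp
  have d4: "eval k4 v * eval (dir u' f4) v = eval k1 v * eval (dir u' f1) v + eval k2 v * eval (dir u' f2) v" for u'
    using arg_cong[OF rel(2), of "\<lambda>p. eval (dir u' p) v"] v h0 by simp
  have "equivalent_germs (germ_at v u w Q) (\<lambda>(x, y). x^4 + y^4)"
  proof (rule germ_equivalent_to_homogeneous[where N = "cst (1/(8*\<i>)) * N" and M = "k1 * k2 * k3 * k4"
        and X = ?X and Y = ?Y and m = 4])
    show "eval (dir u ?X) v * eval (dir w ?Y) v \<noteq> eval (dir w ?X) v * eval (dir u ?Y) v"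
      by (rule det_linear_combination[where f = "\<lambda>u. eval (dir u f1) v" and g = "\<lambda>u. eval (dir u f2) v"
            and a = "eval k1 v" and b = "\<i> * eval k2 v" and c = 1
            and a' = "z * eval k1 v" and b' = "- \<i> * z * eval k2 v" and c' = 1])
        (use det v z0 in \<open>simp_all add: algebra_simps\<close>)
    show "eval (k1 * k2 * k3 * k4) p * eval Q p = eval (cst (1/(8*\<i>)) * N) p *
        (eval ?X p ^ 4 + eval ?Y p ^ 4)" for p
    proof -
      define P R where "P = eval ?p p" "R = eval ?q p"
      have "eval (k1 * k2 * k3 * k4) p * eval Q p = eval N p * P * R * eval (k3 * f3) p * eval (k4 * f4) p"
        by (simp add: Q P_R_def algebra_simps)
      also have "eval (k3 * f3) p = P - R" by (simp add: P_R_def flip: rel)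
      also have "eval (k4 * f4) p = P + R" by (simp add: P_R_def flip: rel)
      also have "eval N p * P * R * (P - R) * (P + R)
          = 1/(8*\<i>) * eval N p * ((P + \<i> * R)^4 + z^4 * (P - \<i> * R)^4)"
        unfolding z4 by (simp add: power4_eq_xxxx algebra_simps)
      finally show ?thesis by (simp add: P_R_def power_mult_distrib)
    qed
  qed (use v in \<open>auto simp: power_mult_distrib algebra_simps\<close>)
  then show "equivalent_germs (germ_at v u w Q) (normal_form X9)" by simp
  show "ordinary (mult_of X9) (germ_at v u w Q)"
  proof (rule ordinary_germ_at[of _ N "[f1, f2, f3, f4]"])
    note dets = det_linear_combination[where f = "\<lambda>u. eval (dir u f1) v" and g = "\<lambda>u. eval (dir u f2) v"]
    have 1: "eval (dir u f1) v * eval (dir w f3) v \<noteq> eval (dir w f1) v * eval (dir u f3) v"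
      by (rule dets[where a = 1 and b = 0 and c = 1, OF _ d3]) (use det v in simp_all)
    have 2: "eval (dir u f2) v * eval (dir w f3) v \<noteq> eval (dir w f2) v * eval (dir u f3) v"
      by (rule dets[where a = 0 and b = 1 and c = 1, OF _ d3]) (use det v in simp_all)
    have 3: "eval (dir u f1) v * eval (dir w f4) v \<noteq> eval (dir w f1) v * eval (dir u f4) v"
      by (rule dets[where a = 1 and b = 0 and c = 1, OF _ d4]) (use det v in simp_all)
    have 4: "eval (dir u f2) v * eval (dir w f4) v \<noteq> eval (dir w f2) v * eval (dir u f4) v"
      by (rule dets[where a = 0 and b = 1 and c = 1, OF _ d4]) (use det v in simp_all)
    have 5: "eval (dir u f3) v * eval (dir w f4) v \<noteq> eval (dir w f3) v * eval (dir u f4) v"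
      by (rule dets[OF d3 d4]) (use det v in \<open>simp_all add: algebra_simps eq_neg_iff_add_eq_0\<close>)
    show "eval (dir u ([f1, f2, f3, f4] ! i)) v * eval (dir w ([f1, f2, f3, f4] ! j)) v
        \<noteq> eval (dir w ([f1, f2, f3, f4] ! i)) v * eval (dir u ([f1, f2, f3, f4] ! j)) v"
      if "i < j" "j < mult_of X9" for i j
      using that det 1 2 3 4 5 by (auto simp: less_Suc_eq numeral_Bit0 numeral_3_eq_3)
  qed (use v h0 in \<open>auto simp: Q algebra_simps\<close>)
qed

section \<open>Arrangements of smooth prime curves\<close>

lemma singular_at_der:
  "singular_at f v \<longleftrightarrow> v \<noteq> (0, 0, 0) \<and> eval f v = 0 \<and> (\<forall>a b c. eval (der a b c f) v = 0)"
proof -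
  have "eval (dX f) v = 0 \<and> eval (dY f) v = 0 \<and> eval (dZ f) v = 0"
    if "\<forall>a b c. eval (der a b c f) v = 0"
    unfolding dX_der dY_der dZ_der using that by blast
  then show ?thesis by (auto simp: singular_at_def der_def)
qed

text \<open>A point that lies on one component only shows both that the component does not divide the product of
  the other ones and that it differs from each of them as a set.\<close>

locale arrangement =
  fixes qs :: "polyS list" and ds :: "nat list"
  assumes prime: "\<And>i. i < length qs \<Longrightarrow> prime_elem (qs ! i)"
    and form: "\<And>i. i < length qs \<Longrightarrow> is_form (ds ! i) (qs ! i)"
    and degree_pos: "\<And>i. i < length qs \<Longrightarrow> ds ! i > 0"
    and nonempty: "qs \<noteq> []"
    and smooth: "\<And>i v. i < length qs \<Longrightarrow> \<not> singular_at (qs ! i) v"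
    and point: "\<And>i. i < length qs \<Longrightarrow> \<exists>v. v \<noteq> (0, 0, 0) \<and> eval (qs ! i) v = 0 \<and>
      (\<forall>j < length qs. j \<noteq> i \<longrightarrow> eval (qs ! j) v \<noteq> 0)"
begin

definition Q :: polyS where "Q = prod_list qs"

definition cofactor :: "nat \<Rightarrow> polyS" where "cofactor i = (\<Prod>j\<in>{..<length qs} - {i}. qs ! j)"

lemma Q_eq_prod: "Q = (\<Prod>j<length qs. qs ! j)"
  by (simp add: Q_def prod.list_conv_set_nth atLeast0LessThan)

lemma Q_cofactor: "i < length qs \<Longrightarrow> Q = qs ! i * cofactor i"
  unfolding Q_eq_prod cofactor_def by (rule prod.remove) auto

lemma not_dvd_cofactor:
  assumes "i < length qs"
  shows "\<not> qs ! i dvd cofactor i"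
proof
  assume dvd: "qs ! i dvd cofactor i"
  obtain v where "eval (qs ! i) v = 0" "\<forall>j < length qs. j \<noteq> i \<longrightarrow> eval (qs ! j) v \<noteq> 0"
    using point[OF assms] by blast
  then have "eval (cofactor i) v \<noteq> 0" by (auto simp: cofactor_def eval_prod)
  with eval_zero_if_dvd[OF dvd] \<open>eval (qs ! i) v = 0\<close> show False by blast
qed

lemma Q_nonzero: "Q \<noteq> 0"
  unfolding Q_eq_prod using prime by (auto simp: prime_elem_def)

lemma dvd_prod_primes:
  assumes "finite A" "\<And>j. j \<in> A \<Longrightarrow> prime_elem (qs ! j)" "p dvd (\<Prod>j\<in>A. qs ! j)"
  shows "p dvd 1 \<or> (\<exists>j\<in>A. qs ! j dvd p)"
  using assms
proof (induction A arbitrary: p rule: finite_induct)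
  case (insert i A)
  then have "p dvd qs ! i * (\<Prod>j\<in>A. qs ! j)" by simp
  then obtain r where r: "qs ! i * (\<Prod>j\<in>A. qs ! j) = p * r" by (elim dvdE)
  then have "qs ! i dvd p * r" by (metis dvd_triv_left)
  then consider "qs ! i dvd p" | "qs ! i dvd r" using insert.prems prime_elem_dvd_mult_iff by blast
  then show ?case
  proof cases
    case 2
    then obtain s where "r = qs ! i * s" by (elim dvdE)
    then have "qs ! i * (\<Prod>j\<in>A. qs ! j) = qs ! i * (p * s)" using r by (simp add: algebra_simps)
    then have "(\<Prod>j\<in>A. qs ! j) = p * s" using insert.prems by (auto simp: prime_elem_def)
    then have "p dvd (\<Prod>j\<in>A. qs ! j)" by simp
    with insert show ?thesis by blast
  qed blast
qed auto

lemma dvd_Q_factor: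
  assumes "p dvd Q" "\<not> p dvd 1"
  obtains i where "i < length qs" "qs ! i dvd p"
  using dvd_prod_primes[of "{..<length qs}" p] assms prime unfolding Q_eq_prod by auto

lemma irreducible_dvd_Q:
  assumes "irreducible p" "p dvd Q"
  obtains i c where "i < length qs" "c \<noteq> 0" "p = cst c * qs ! i"
proof -
  obtain i where i: "i < length qs" "qs ! i dvd p"
    using dvd_Q_factor assms by (auto simp: irreducible_def)
  then obtain u where u: "p = qs ! i * u" by (elim dvdE)
  have "\<not> qs ! i dvd 1" using prime[OF i(1)] by (simp add: prime_elem_def)
  then have "u dvd 1" using assms(1) u by (auto simp: irreducible_def)
  then obtain c where "c \<noteq> 0" "u = cst c" by (auto simp: is_unit_iff_cst)
  with u i that show thesis by (simp add: mult.commute)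
qed

lemma squarefree_Q: "squarefree Q"
  unfolding squarefree_def
proof (intro allI impI)
  fix p assume p: "p\<^sup>2 dvd Q"
  show "p dvd 1"
  proof (rule ccontr)
    assume "\<not> p dvd 1"
    moreover have "p dvd Q" using p by (auto simp: power2_eq_square intro: dvd_mult_left)
    ultimately obtain i where i: "i < length qs" "qs ! i dvd p" using dvd_Q_factor by blast
    then have "qs ! i * qs ! i dvd p * p" by (simp add: mult_dvd_mono)
    also have "p * p dvd Q" using p by (simp add: power2_eq_square)
    also have "Q = qs ! i * cofactor i" by (rule Q_cofactor[OF i(1)])
    finally have "qs ! i dvd cofactor i"
      using prime[OF i(1)] by (auto simp: prime_elem_def)
    with not_dvd_cofactor i show False by blast
  qed
qed

lemma form_Q: "is_form (\<Sum>j<length qs. ds ! j) Q"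
proof -
  have "is_form (\<Sum>j\<in>A. ds ! j) (\<Prod>j\<in>A. qs ! j)" if "A \<subseteq> {..<length qs}" for A
    using that by (induction A rule: infinite_finite_induct) (auto intro!: is_form_1 is_form_mult form)
  then show ?thesis unfolding Q_eq_prod by blast
qed

lemma reduced_Q: "reduced_curve Q"
proof -
  have "0 < (\<Sum>j<length qs. ds ! j)"
    using nonempty degree_pos[of 0] by (intro sum_pos2[of _ 0]) auto
  then show ?thesis
    unfolding reduced_curve_def using form_Q Q_nonzero squarefree_Q by blast
qed

lemma singular_at_cst_mult: "c \<noteq> 0 \<Longrightarrow> singular_at (cst c * p) v \<longleftrightarrow> singular_at p v"
  unfolding singular_at_der der_mult der_cst eval_simps by simp

lemma zero_locus_cst_mult: "c \<noteq> 0 \<Longrightarrow> zero_locus (cst c * p) = zero_locus p"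
  by (simp add: zero_locus_def)

lemma smooth_Q: "smooth_components Q"
  unfolding smooth_components_def
proof (intro allI impI)
  fix p v assume "irreducible p \<and> p dvd Q"
  then obtain i c where "i < length qs" "c \<noteq> 0" "p = cst c * qs ! i" using irreducible_dvd_Q by blast
  then show "\<not> singular_at p v" using smooth by (simp add: singular_at_cst_mult)
qed

lemma is_form_cst_mult: "c \<noteq> 0 \<Longrightarrow> is_form d (cst c * p) \<longleftrightarrow> is_form d p"
  by (auto simp: is_form_def mono_coeff_def cst_def)

lemma components_Q: "components_of_degree Q d = (\<lambda>i. zero_locus (qs ! i)) ` {i. i < length qs \<and> ds ! i = d}"
proof (intro equalityI subsetI)
  fix Z assume "Z \<in> components_of_degree Q d"
  then obtain p where p: "Z = zero_locus p" "irreducible p" "p dvd Q" "is_form d p"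
    by (auto simp: components_of_degree_def)
  then obtain i c where i: "i < length qs" "c \<noteq> 0" "p = cst c * qs ! i" using irreducible_dvd_Q by blast
  then have "is_form d (qs ! i)" using p by (simp add: is_form_cst_mult)
  moreover have "qs ! i \<noteq> 0" using prime[OF i(1)] by (auto simp: prime_elem_def)
  ultimately have "ds ! i = d" using form[OF i(1)] is_form_degree_unique by blast
  then show "Z \<in> (\<lambda>i. zero_locus (qs ! i)) ` {i. i < length qs \<and> ds ! i = d}"
    using i p by (auto simp: zero_locus_cst_mult)
next
  fix Z assume "Z \<in> (\<lambda>i. zero_locus (qs ! i)) ` {i. i < length qs \<and> ds ! i = d}"
  then obtain i where i: "i < length qs" "ds ! i = d" "Z = zero_locus (qs ! i)" by blast
  moreover have "irreducible (qs ! i)" using prime[OF i(1)] by (rule prime_elem_imp_irreducible)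
  moreover have "qs ! i dvd Q" using Q_cofactor[OF i(1)] by simp
  ultimately show "Z \<in> components_of_degree Q d"
    unfolding components_of_degree_def using form by blast
qed

lemma proj_point_eq_scale: "proj_point p = proj_point q \<Longrightarrow>
   \<exists>t. t \<noteq> 0 \<and> p = (t * fst q, t * fst (snd q), t * snd (snd q))"
proof -
  assume eq: "proj_point p = proj_point q"
  have "p \<in> proj_point p" by (cases p) (auto intro: exI[of _ 1])
  then have "p \<in> proj_point q" by (simp add: eq)
  then show ?thesis by (cases q) auto
qed

lemma in_zero_locus_iff:
  assumes "is_form d p" "v \<noteq> (0, 0, 0)"
  shows "proj_point v \<in> zero_locus p \<longleftrightarrow> eval p v = 0"
proof
  assume "proj_point v \<in> zero_locus p"
  then obtain w where w: "proj_point v = proj_point w" "eval p w = 0"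
    by (auto simp: zero_locus_def)
  then obtain t where "v = (t * fst w, t * fst (snd w), t * snd (snd w))"
    using proj_point_eq_scale by blast
  then show "eval p v = 0"
    using eval_form_scale[OF assms(1), of t "fst w" "fst (snd w)" "snd (snd w)"] w by simp
qed (use assms in \<open>auto simp: zero_locus_def\<close>)

lemma inj_zero_locus: "inj_on (\<lambda>i. zero_locus (qs ! i)) {..<length qs}"
proof (rule inj_onI, rule ccontr)
  fix i j assume ij: "i \<in> {..<length qs}" "j \<in> {..<length qs}" "i \<noteq> j"
    and eq: "zero_locus (qs ! i) = zero_locus (qs ! j)"
  obtain v where "v \<noteq> (0, 0, 0)" "eval (qs ! i) v = 0" "eval (qs ! j) v \<noteq> 0"
    using point[of i] ij by force
  with ij eq form in_zero_locus_iff show False by (metis lessThan_iff)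
qed

lemma card_components_Q: "card (components_of_degree Q d) = card {i. i < length qs \<and> ds ! i = d}"
  unfolding components_Q by (intro card_image inj_on_subset[OF inj_zero_locus]) auto

text \<open>By the Leibniz rule the component divides the product of its own image with the other components,
  hence its own image.\<close>

lemma factor_dvd_der:
  assumes "Q dvd der a b c Q" "i < length qs"
  shows "qs ! i dvd der a b c (qs ! i)"
proof -
  have "qs ! i dvd der a b c Q"
    using assms Q_cofactor by (metis dvd_trans dvd_triv_left)
  also have "der a b c Q = qs ! i * der a b c (cofactor i) + der a b c (qs ! i) * cofactor i"
    unfolding Q_cofactor[OF assms(2)] by simp
  finally have "qs ! i dvd der a b c (qs ! i) * cofactor i"
    by (simp add: dvd_add_right_iff)
  then show ?thesis
    using prime[OF assms(2)] not_dvd_cofactor[OF assms(2)] prime_elem_dvd_mult_iff by blast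
qed

lemma singular_at_Q_iff:
  "singular_at Q v \<longleftrightarrow> v \<noteq> (0, 0, 0) \<and>
     (\<exists>i j. i < j \<and> j < length qs \<and> eval (qs ! i) v = 0 \<and> eval (qs ! j) v = 0)"
proof
  assume sing: "singular_at Q v"
  then have "v \<noteq> (0, 0, 0)" by (simp add: singular_at_def)
  have "eval Q v = 0" using sing by (simp add: singular_at_def)
  then obtain i where i: "i < length qs" "eval (qs ! i) v = 0"
    unfolding Q_eq_prod eval_prod by auto
  have "eval (cofactor i) v = 0"
  proof (rule ccontr)
    assume nz: "eval (cofactor i) v \<noteq> 0"
    have "eval (der a b c (qs ! i)) v = 0" for a b c
    proof -
      have "eval (der a b c Q) v = 0" using sing by (simp add: singular_at_der)
      then show ?thesis unfolding Q_cofactor[OF i(1)] using nz i by simp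
    qed
    then have "singular_at (qs ! i) v" using sing i by (simp add: singular_at_der)
    then show False using smooth i by blast
  qed
  then obtain j where j: "j < length qs" "j \<noteq> i" "eval (qs ! j) v = 0"
    unfolding cofactor_def eval_prod by auto
  with i have "\<exists>i j. i < j \<and> j < length qs \<and> eval (qs ! i) v = 0 \<and> eval (qs ! j) v = 0"
    by (metis linorder_neqE_nat)
  with \<open>v \<noteq> (0, 0, 0)\<close> show "v \<noteq> (0, 0, 0) \<and>
     (\<exists>i j. i < j \<and> j < length qs \<and> eval (qs ! i) v = 0 \<and> eval (qs ! j) v = 0)" by blast
next
  assume "v \<noteq> (0, 0, 0) \<and>
     (\<exists>i j. i < j \<and> j < length qs \<and> eval (qs ! i) v = 0 \<and> eval (qs ! j) v = 0)"
  then obtain i j where v: "v \<noteq> (0, 0, 0)" and ij: "i < j" "j < length qs"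
    and 0: "eval (qs ! i) v = 0" "eval (qs ! j) v = 0" by blast
  have "eval (cofactor i) v = 0"
    unfolding cofactor_def eval_prod using ij 0 by (intro prod_zero) auto
  moreover have "Q = qs ! i * cofactor i" by (rule Q_cofactor) (use ij in simp)
  ultimately show "singular_at Q v"
    using 0 v by (simp add: singular_at_der)
qed

end

section \<open>Counting the singular points\<close>

lemma local_equation_scale: "t \<noteq> 0 \<Longrightarrow> local_equation f (t * a, t * b, t * c) = local_equation f (a, b, c)"
  by (auto simp: fun_eq_iff)

lemma local_equation_affine: "local_equation f (a, b, 1) = germ_at (a, b, 1) (1, 0, 0) (0, 1, 0) f"
  by (auto simp: fun_eq_iff germ_at_def plane_def)

lemma local_equation_infinity: "local_equation f (1, 0, 0) = germ_at (1, 0, 0) (0, 1, 0) (0, 0, 1) f"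
  by (auto simp: fun_eq_iff germ_at_def plane_def)

text \<open>On the line \<open>z = 0\<close> the only singular point of either arrangement is \<open>(1 : 0 : 0)\<close>.\<close>

definition normalized :: "complex \<times> complex \<times> complex \<Rightarrow> bool" where
  "normalized p \<longleftrightarrow> snd (snd p) = 1 \<or> p = (1, 0, 0)"

lemma inj_on_proj_point: "inj_on proj_point {p. normalized p}"
proof (rule inj_onI)
  fix p q assume *: "p \<in> {p. normalized p}" "q \<in> {p. normalized p}" "proj_point p = proj_point q"
  have "p \<in> proj_point p" by (cases p) (auto intro: exI[of _ 1])
  then have "p \<in> proj_point q" by (simp add: *)
  with *(1,2) show "p = q" by (cases p; cases q) (auto simp: normalized_def)
qed

lemma proj_point_scale: "t \<noteq> 0 \<Longrightarrow> proj_point (t * a, t * b, t * c) = proj_point (a, b, c)"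
proof -
  assume t: "t \<noteq> 0"
  have "(s * a, s * b, s * c) \<in> proj_point (t * a, t * b, t * c)" if "s \<noteq> 0" for s
    using that t by (auto intro!: exI[of _ "s / t"])
  then show ?thesis using t by (auto simp: mult.assoc[symmetric])
qed

text \<open>Normalized representatives are unique, and the type and the multiplicity of a germ are exclusive
  properties, so that points of each kind are counted by the entries of the list.\<close>

lemma singular_points_card:
  assumes sing: "\<And>v. singular_at f v \<longleftrightarrow> (\<exists>p T t. (p, T) \<in> set ps \<and> t \<noteq> 0 \<and>
      v = (t * fst p, t * fst (snd p), t * snd (snd p)))"
    and type: "\<And>p T. (p, T) \<in> set ps \<Longrightarrow> normalized p \<and> ordinary_of_type T (local_equation f p)"
    and dist: "distinct (map fst ps)"
  shows "\<And>m. card (singular_points f (ordinary m)) = length (filter (\<lambda>(p, T). mult_of T = m) ps)"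
    and "\<And>T. card (singular_points f (has_type T)) = length (filter (\<lambda>(p, T'). T' = T) ps)"
    and "\<And>v. singular_at f v \<Longrightarrow> \<exists>T. ordinary_of_type T (local_equation f v)"
proof -
  have loc: "local_equation f (t * fst p, t * fst (snd p), t * snd (snd p)) = local_equation f p"
    if "t \<noteq> 0" for t p
    using local_equation_scale[OF that, of f "fst p" "fst (snd p)" "snd (snd p)"] by simp
  have proj: "proj_point (t * fst p, t * fst (snd p), t * snd (snd p)) = proj_point p" if "t \<noteq> 0" for t p
    using proj_point_scale[OF that, of "fst p" "fst (snd p)" "snd (snd p)"] by simp
  have gen: "card (singular_points f P) = length (filter (\<lambda>(p, T). R T) ps)"
    if PR: "\<And>T F. ordinary_of_type T F \<Longrightarrow> P F \<longleftrightarrow> R T" for P R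
  proof -
    have "singular_points f P = proj_point ` fst ` set (filter (\<lambda>(p, T). R T) ps)"
    proof (intro equalityI subsetI)
      fix x assume "x \<in> singular_points f P"
      then obtain v where v: "x = proj_point v" "singular_at f v" "P (local_equation f v)"
        by (auto simp: singular_points_def)
      then obtain p T t where p: "(p, T) \<in> set ps" "t \<noteq> 0"
          "v = (t * fst p, t * fst (snd p), t * snd (snd p))"
        using sing by blast
      then have "R T" using v(3) type[OF p(1)] PR loc by metis
      then have "p \<in> fst ` set (filter (\<lambda>(p, T). R T) ps)" using p(1) by force
      moreover have "x = proj_point p" using v(1) p(2,3) proj by simp
      ultimately show "x \<in> proj_point ` fst ` set (filter (\<lambda>(p, T). R T) ps)" by blast
    next
      fix x assume "x \<in> proj_point ` fst ` set (filter (\<lambda>(p, T). R T) ps)"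
      then obtain p T where p: "(p, T) \<in> set ps" "R T" "x = proj_point p" by auto
      have "singular_at f p" unfolding sing using p(1)
        by (intro exI[of _ p] exI[of _ T] exI[of _ 1]) simp
      moreover have "P (local_equation f p)" using type[OF p(1)] PR p(2) by blast
      ultimately show "x \<in> singular_points f P" using p(3) by (auto simp: singular_points_def)
    qed
    moreover have "inj_on proj_point (fst ` set (filter (\<lambda>(p, T). R T) ps))"
      by (rule inj_on_subset[OF inj_on_proj_point]) (use type in auto)
    moreover have "card (fst ` set (filter (\<lambda>(p, T). R T) ps)) = length (filter (\<lambda>(p, T). R T) ps)"
    proof -
      have "distinct (map fst (filter (\<lambda>(p, T). R T) ps))" by (rule distinct_map_filter[OF dist])
      from distinct_card[OF this] show ?thesis by simp
    qed
    ultimately show ?thesis by (simp add: card_image)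
  qed
  show "card (singular_points f (ordinary m)) = length (filter (\<lambda>(p, T). mult_of T = m) ps)" for m
    by (rule gen) (metis ordinary_of_type_ordinary_iff)
  show "card (singular_points f (has_type T)) = length (filter (\<lambda>(p, T'). T' = T) ps)" for T
    by (rule gen) (metis ordinary_of_type_has_type_iff)
  show "\<exists>T. ordinary_of_type T (local_equation f v)" if "singular_at f v" for v
    using that type loc unfolding sing by metis
qed

section \<open>The two conic-line arrangements\<close>

definition conic :: polyS where
  "conic = - 24 * varX^2 - 23 * varY^2 + 76 * varY * varZ + 195 * varZ^2"

lemma eval_conic: "eval conic (a, b, c) = - 24 * a^2 - 23 * b^2 + 76 * b * c + 195 * c^2"
  by (simp add: conic_def)

lemma eval_dir_conic: "eval (dir (u1, u2, u3) conic) (a, b, c)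
    = - 48 * a * u1 + (76 * c - 46 * b) * u2 + (76 * b + 390 * c) * u3"
  by (simp add: conic_def algebra_simps)

lemma eval_lin: "eval (lin k l m) (a, b, c) = k * a + l * b + m * c"
  by (simp add: lin_def)

lemma eval_dir_lin: "eval (dir (u1, u2, u3) (lin k l m)) v = k * u1 + l * u2 + m * u3"
  by (simp add: lin_def)

lemma cst_uminus: "cst (- a) = - cst a"
  by (simp add: cst_def)

lemmas lin_poly = lin_def cst_uminus cst_numeral cst_0 cst_1

lemma lin_100: "lin 1 0 0 = varX"
  by (simp add: lin_poly)

lemmas is_form_var' = is_form_var[unfolded One_nat_def]

lemma is_form_lin: "is_form 1 (lin k l m)"
  unfolding lin_def by (intro is_form_add is_form_mult'[OF is_form_cst]) (auto simp: is_form_var')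

lemma is_form_conic: "is_form 2 conic"
  unfolding conic_def
  by (intro is_form_add is_form_diff is_form_uminus is_form_numeral_mult is_form_power' is_form_var
      is_form_mult'[OF is_form_numeral_mult[OF is_form_var(2)] is_form_var(3)]
      is_form_mult'[OF is_form_uminus[OF is_form_numeral] is_form_power'[OF is_form_var(1)]])
    (auto simp: is_form_var')

lemma smooth_lin: "(k, l, m) \<noteq> (0, 0, 0) \<Longrightarrow> \<not> singular_at (lin k l m) v"
proof
  assume nz: "(k, l, m) \<noteq> (0, 0, 0)" and sing: "singular_at (lin k l m) v"
  have "eval (der (cst a) (cst b) (cst c) (lin k l m)) v = k * a + l * b + m * c" for a b c
    by (simp add: lin_def)
  then have "k * a + l * b + m * c = 0" for a b c using sing by (auto simp: singular_at_der)
  from this[of 1 0 0] this[of 0 1 0] this[of 0 0 1] nz show False by simp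
qed

lemma smooth_conic: "\<not> singular_at conic v"
proof
  assume sing: "singular_at conic v"
  obtain a b c where v: "v = (a, b, c)" by (cases v)
  have "eval (der (cst k) (cst l) (cst m) conic) v = - 48 * a * k + (76 * c - 46 * b) * l + (76 * b + 390 * c) * m"
    for k l m by (simp add: conic_def v algebra_simps)
  then have 0: "- 48 * a * k + (76 * c - 46 * b) * l + (76 * b + 390 * c) * m = 0" for k l m
    using sing by (auto simp: singular_at_der)
  have "a = 0" using 0[of 1 0 0] by simp
  have bc: "76 * c - 46 * b = 0" "76 * b + 390 * c = 0" using 0[of 0 1 0] 0[of 0 0 1] by simp_all
  have "23716 * c = 76 * (76 * c - 46 * b) + 46 * (76 * b + 390 * c)" by (simp add: algebra_simps)
  then have "c = 0" using bc by simp
  then have "b = 0" using bc by simp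
  with \<open>a = 0\<close> \<open>c = 0\<close> sing show False by (simp add: v singular_at_def)
qed

text \<open>The line \<open>x + y + z = 0\<close> meets the conic where \<open>47 y\<^sup>2 = 28 y z + 171 z\<^sup>2\<close>, in two irrational
  points. The other components are lines with rational coefficients and avoid them.\<close>

definition root1 :: complex where "root1 = (14 + csqrt 8233) / 47"
definition root2 :: complex where "root2 = (14 - csqrt 8233) / 47"

lemma roots: "47 * root1^2 = 28 * root1 + 171" "47 * root2^2 = 28 * root2 + 171"
  "root1 + root2 = 28/47" "root1 * root2 = - (171/47)" "root1 \<noteq> root2"
proof -
  define w where "w = csqrt 8233"
  have w: "w * w = 8233" using power2_csqrt[of 8233] by (simp add: w_def power2_eq_square)
  have r: "root1 = (14 + w) / 47" "root2 = (14 - w) / 47" by (simp_all add: root1_def root2_def w_def)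
  show "47 * root1^2 = 28 * root1 + 171" "47 * root2^2 = 28 * root2 + 171"
    "root1 + root2 = 28/47" "root1 * root2 = - (171/47)"
    by (simp_all add: r power2_eq_square field_simps w)
  have "w \<noteq> 0" using w by auto
  then show "root1 \<noteq> root2" by (simp add: r)
qed

text \<open>At a zero of \<open>k + l y\<close> the quadratic equation becomes a homogeneous quadratic equation for \<open>k\<close>, \<open>l\<close>.\<close>

lemma root_irrational:
  assumes "47 * y^2 = 28 * y + (171 :: complex)" "47 * k^2 + 28 * k * l \<noteq> 171 * l^2"
  shows "k + l * y \<noteq> 0"
proof
  assume "k + l * y = 0"
  then have k: "k = - l * y" by (simp add: eq_neg_iff_add_eq_0)
  have "47 * k^2 + 28 * k * l - 171 * l^2 = l^2 * (47 * y^2 - (28 * y + 171))"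
    unfolding k by (simp add: power2_eq_square algebra_simps)
  then show False using assms by simp
qed

lemma root_neq:
  assumes "47 * k^2 \<noteq> 28 * k + (171 :: complex)"
  shows "root1 \<noteq> k" "k \<noteq> root1" "root2 \<noteq> k" "k \<noteq> root2"
  using assms roots(1,2) by auto

definition represented :: "(complex \<times> complex \<times> complex) set \<Rightarrow> complex \<times> complex \<times> complex \<Rightarrow> bool" where
  "represented A v \<longleftrightarrow> (\<exists>p\<in>A. \<exists>t. v = (t * fst p, t * fst (snd p), t * snd (snd p)))"

text \<open>The slope \<open>r\<close> distinguishes the two arrangements; \<open>s = 2 r - 1\<close> says that the lines of slopes \<open>\<plusminus> r\<close>
  pass through \<open>(\<mp>2 : -1 : 1)\<close>. The second points of the conic on them have the abscissas \<open>\<plusminus> e\<close>; the lines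
  meet \<open>y = 3 z\<close> at the abscissas \<open>\<plusminus> x4\<close>, and \<open>x + y + z = 0\<close> at \<open>x6\<close> and \<open>x6'\<close>.\<close>

lemma intersections_represented:
  fixes r s e x4 x6 x6' :: complex
  assumes qs: "qs = [conic, lin (- r) 1 (- s), lin r 1 (- s), lin 0 1 1, lin 0 1 (- 3), lin 1 0 0, lin 1 1 1]"
    and r: "r \<noteq> 0" "r + 1 \<noteq> 0" "r - 1 \<noteq> 0" "24 + 23 * r^2 \<noteq> 0" and s: "s = 2 * r - 1"
    and e: "(24 + 23 * r^2) * e = 48 + 122 * r - 46 * r^2"
    and x: "r * x4 = 3 - s" "(r + 1) * x6 = - 2 * r" "(r - 1) * x6' = 2 * r"
    and points: "{(0, s, 1), (- 2, - 1, 1), (2, - 1, 1), (x4, 3, 1), (- x4, 3, 1), (x6, - 1 - x6, 1),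
        (x6', - 1 - x6', 1), (e, r * e + s, 1), (- e, r * e + s, 1), (1, 0, 0), (0, - 1, 1), (0, 3, 1),
        (- 4, 3, 1), (3, 3, 1), (- 3, 3, 1), (0, 5, 1), (0, - 39/23, 1),
        (- 1 - root1, root1, 1), (- 1 - root2, root2, 1)} \<subseteq> A"
    and ij: "i < j" "j < length qs" "eval (qs ! i) (a, b, c) = 0" "eval (qs ! j) (a, b, c) = 0"
  shows "represented A (a, b, c)"
proof -
  let ?R = "represented A (a, b, c)"
  have pt: ?R if "a = u * c" "b = v * c" "(u, v, 1) \<in> A" for u v
    unfolding represented_def using that by (intro bexI[of _ "(u, v, 1)"] exI[of _ c]) (simp_all add: mult.commute)
  define K where "K \<longleftrightarrow> eval conic (a, b, c) = 0"
  define L where "L k l m \<longleftrightarrow> eval (lin k l m) (a, b, c) = 0" for k l m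
  have K: "- 24 * a^2 - 23 * b^2 + 76 * b * c + 195 * c^2 = 0" if K
    using that by (simp add: K_def eval_conic)
  have L1: "b = r * a + s * c" if "L (- r) 1 (- s)"
    using that by (simp add: L_def eval_lin algebra_simps)
  have L2: "b = s * c - r * a" if "L r 1 (- s)"
    using that by (simp add: L_def eval_lin algebra_simps)
  have L3: "b = - 1 * c" if "L 0 1 1"
    using that by (simp add: L_def eval_lin eq_neg_iff_add_eq_0)
  have L4: "b = 3 * c" if "L 0 1 (- 3)"
    using that by (simp add: L_def eval_lin)
  have L5: "a = 0" if "L 1 0 0"
    using that by (simp add: L_def eval_lin)
  have L6: "b = - 1 * c - a" if "L 1 1 1"
    using that by (simp add: L_def eval_lin algebra_simps eq_neg_iff_add_eq_0)
  have zero: "u = v" if "k * (u - v) = w - w" "k \<noteq> 0" for k u v w :: complex using that by simp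
  have split: "u = v \<or> u' = v'" if "k * ((u - v) * (u' - v')) = 0" "k \<noteq> 0" for k u u' v v' :: complex
    using that by simp
  have p12: ?R if "L (- r) 1 (- s)" "L r 1 (- s)"
  proof (rule pt[of 0 s])
    have "r * a + s * c = s * c - r * a" using L1[OF that(1)] L2[OF that(2)] by (rule subst)
    then have "2 * (r * a) = 0" by (simp add: algebra_simps)
    then show "a = 0 * c" using r(1) by simp
    then show "b = s * c" using L1[OF that(1)] by simp
  qed (use points in simp)
  have p13: ?R if "L (- r) 1 (- s)" "L 0 1 1"
  proof (rule pt[OF _ L3[OF that(2)]])
    have "r * (a - - 2 * c) = (r * a + s * c) - (- 1 * c)" by (simp add: s algebra_simps)
    also have "\<dots> = b - b" unfolding L1[OF that(1), symmetric] L3[OF that(2), symmetric] ..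
    finally show "a = - 2 * c" by (rule zero[OF _ r(1)])
  qed (use points in simp)
  have p23: ?R if "L r 1 (- s)" "L 0 1 1"
  proof (rule pt[OF _ L3[OF that(2)]])
    have "r * (a - 2 * c) = (- 1 * c) - (s * c - r * a)" by (simp add: s algebra_simps)
    also have "\<dots> = b - b" unfolding L2[OF that(1), symmetric] L3[OF that(2), symmetric] ..
    finally show "a = 2 * c" by (rule zero[OF _ r(1)])
  qed (use points in simp)
  have p14: ?R if "L (- r) 1 (- s)" "L 0 1 (- 3)"
  proof (rule pt[OF _ L4[OF that(2)]])
    have "r * (a - x4 * c) = r * a - (r * x4) * c" by (simp add: algebra_simps)
    also have "\<dots> = (r * a + s * c) - 3 * c" unfolding x by (simp add: algebra_simps)
    also have "\<dots> = b - b" unfolding L1[OF that(1), symmetric] L4[OF that(2), symmetric] ..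
    finally show "a = x4 * c" by (rule zero[OF _ r(1)])
  qed (use points in simp)
  have p24: ?R if "L r 1 (- s)" "L 0 1 (- 3)"
  proof (rule pt[OF _ L4[OF that(2)]])
    have "r * (a - - x4 * c) = r * a + (r * x4) * c" by (simp add: algebra_simps)
    also have "\<dots> = 3 * c - (s * c - r * a)" unfolding x by (simp add: algebra_simps)
    also have "\<dots> = b - b" unfolding L2[OF that(1), symmetric] L4[OF that(2), symmetric] ..
    finally show "a = - x4 * c" by (rule zero[OF _ r(1)])
  qed (use points in simp)
  have p16: ?R if "L (- r) 1 (- s)" "L 1 1 1"
  proof (rule pt[of x6 "- 1 - x6"])
    have "(r + 1) * (a - x6 * c) = (r + 1) * a - ((r + 1) * x6) * c" by (simp add: algebra_simps)
    also have "\<dots> = (r * a + s * c) - (- 1 * c - a)" unfolding x s by (simp add: algebra_simps)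
    also have "\<dots> = b - b" unfolding L1[OF that(1), symmetric] L6[OF that(2), symmetric] ..
    finally show a: "a = x6 * c" by (rule zero[OF _ r(2)])
    show "b = (- 1 - x6) * c" using L6[OF that(2)] a by (simp add: algebra_simps)
  qed (use points in simp)
  have p26: ?R if "L r 1 (- s)" "L 1 1 1"
  proof (rule pt[of x6' "- 1 - x6'"])
    have "(r - 1) * (a - x6' * c) = (r - 1) * a - ((r - 1) * x6') * c" by (simp add: algebra_simps)
    also have "\<dots> = (- 1 * c - a) - (s * c - r * a)" unfolding x s by (simp add: algebra_simps)
    also have "\<dots> = b - b" unfolding L2[OF that(1), symmetric] L6[OF that(2), symmetric] ..
    finally show a: "a = x6' * c" by (rule zero[OF _ r(3)])
    show "b = (- 1 - x6') * c" using L6[OF that(2)] a by (simp add: algebra_simps)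
  qed (use points in simp)
  have p5: ?R if "L 1 0 0" "b = v * c" "(0, v, 1) \<in> A" for v
    by (rule pt[of 0 v]) (use L5[OF that(1)] that in simp_all)
  have p15: ?R if "L (- r) 1 (- s)" "L 1 0 0"
    by (rule p5[OF that(2), of s]) (use L1[OF that(1)] L5[OF that(2)] points in simp_all)
  have p25: ?R if "L r 1 (- s)" "L 1 0 0"
    by (rule p5[OF that(2), of s]) (use L2[OF that(1)] L5[OF that(2)] points in simp_all)
  have p34: ?R if "L 0 1 1" "L 0 1 (- 3)"
  proof -
    have "- 1 * c = 3 * c" using L3[OF that(1)] L4[OF that(2)] by (rule subst)
    then have "c = 0" by (simp add: eq_neg_iff_add_eq_0)
    then have "(a, b, c) = (a, 0, 0)" using L4[OF that(2)] by simp
    then show ?R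
      unfolding represented_def using points by (intro bexI[of _ "(1, 0, 0)"] exI[of _ a]) simp_all
  qed
  have p35: ?R if "L 0 1 1" "L 1 0 0"
    by (rule p5[OF that(2) L3[OF that(1)]]) (use points in simp)
  have p45: ?R if "L 0 1 (- 3)" "L 1 0 0"
    by (rule p5[OF that(2) L4[OF that(1)]]) (use points in simp)
  have p56: ?R if "L 1 0 0" "L 1 1 1"
    by (rule p5[OF that(1), of "- 1"]) (use L5[OF that(1)] L6[OF that(2)] points in simp_all)
  have p36: ?R if "L 0 1 1" "L 1 1 1"
    by (rule pt[of 0 "- 1"]) (use L3[OF that(1)] L6[OF that(2)] points in simp_all)
  have p46: ?R if "L 0 1 (- 3)" "L 1 1 1"
  proof (rule pt[OF _ L4[OF that(1)]])
    have "3 * c = - 1 * c - a" using L4[OF that(1)] L6[OF that(2)] by (rule subst)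
    then show "a = - 4 * c" by (simp add: algebra_simps eq_neg_iff_add_eq_0)
  qed (use points in simp)
  \<comment> \<open>\<open>d\<close> is the sign of the slope, so that both lines are treated at once\<close>
  have conic_slope: "a = 2 * d * c \<or> a = - d * e * c" if K "b = s * c - d * (r * a)" "d * d = 1" for d
  proof -
    have "d = 1 \<or> d = - 1" using that(3) by (simp add: square_eq_1_iff)
    then have "(24 + 23 * r^2) * ((a - 2 * d * c) * (a - - d * e * c))
        = (24 + 23 * r^2) * a^2 - 2 * d * (24 + 23 * r^2) * (a * c)
          + (24 + 23 * r^2) * e * (d * a * c - 2 * c^2)"
      by (auto simp: algebra_simps power2_eq_square)
    also have "\<dots> = - (- 24 * a^2 - 23 * b^2 + 76 * b * c + 195 * c^2)"
      using \<open>d = 1 \<or> d = - 1\<close> unfolding e that(2) s by (auto simp: algebra_simps power2_eq_square)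
    also have "\<dots> = 0" unfolding K[OF that(1)] by simp
    finally show ?thesis using r(4) by (rule split)
  qed
  have p01: ?R if h: K "L (- r) 1 (- s)"
  proof -
    consider "a = - 2 * c" | "a = e * c"
      using conic_slope[OF h(1), of "- 1"] L1[OF h(2)] by auto
    then show ?R
    proof cases
      case 1
      then have "b = - 1 * c" using L1[OF h(2)] by (simp add: s algebra_simps)
      with 1 show ?R by (rule pt) (use points in simp)
    next
      case 2
      then have "b = (r * e + s) * c" using L1[OF h(2)] by (simp add: algebra_simps)
      with 2 show ?R by (rule pt) (use points in simp)
    qed
  qed
  have p02: ?R if h: K "L r 1 (- s)"
  proof -
    consider "a = 2 * c" | "a = - e * c"
      using conic_slope[OF h(1), of 1] L2[OF h(2)] by auto
    then show ?R
    proof cases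
      case 1
      then have "b = - 1 * c" using L2[OF h(2)] by (simp add: s algebra_simps)
      with 1 show ?R by (rule pt) (use points in simp)
    next
      case 2
      then have "b = (r * e + s) * c" using L2[OF h(2)] by (simp add: algebra_simps)
      with 2 show ?R by (rule pt) (use points in simp)
    qed
  qed
  have p03: ?R if K "L 0 1 1"
  proof -
    have "- 24 * ((a - 2 * c) * (a - - 2 * c)) = 0"
      using K[OF that(1)] unfolding L3[OF that(2)] by (simp add: algebra_simps power2_eq_square)
    from split[OF this] consider "a = 2 * c" | "a = - 2 * c" by auto
    then show ?R by cases (erule pt[OF _ L3[OF that(2)]], use points in simp)+
  qed
  have p04: ?R if K "L 0 1 (- 3)"
  proof -
    have "- 24 * ((a - 3 * c) * (a - - 3 * c)) = 0"
      using K[OF that(1)] unfolding L4[OF that(2)] by (simp add: algebra_simps power2_eq_square)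
    from split[OF this] consider "a = 3 * c" | "a = - 3 * c" by auto
    then show ?R by cases (erule pt[OF _ L4[OF that(2)]], use points in simp)+
  qed
  have p05: ?R if K "L 1 0 0"
  proof -
    define y :: complex where "y = - 39/23"
    have y: "23 * y = - 39" by (simp add: y_def)
    have "- 23 * ((b - 5 * c) * (b - y * c)) = - 23 * b^2 + 115 * b * c + (23 * y) * (b * c) - 5 * (23 * y) * c^2"
      by (simp add: algebra_simps power2_eq_square)
    also have "\<dots> = 0"
      using K[OF that(1)] unfolding y L5[OF that(2)] by (simp add: algebra_simps power2_eq_square)
    finally have "b = 5 * c \<or> b = y * c" by (rule split) simp
    then show ?R by (rule disjE) (erule p5[OF that(2)], use points in \<open>simp add: y_def\<close>)+
  qed
  have p06: ?R if K "L 1 1 1"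
  proof -
    have a: "a = - c - b" using L6[OF that(2)] by simp
    have "(b - root1 * c) * (b - root2 * c) = b^2 - (root1 + root2) * b * c + (root1 * root2) * c^2"
      by (simp add: power2_eq_square algebra_simps)
    also have "- 47 * \<dots> = 0" using K[OF that(1)] unfolding roots a
      by (simp add: power2_eq_square algebra_simps)
    finally consider "b = root1 * c" | "b = root2 * c" by auto
    then show ?R
    proof cases
      case 1 then show ?R by (intro pt[of "- 1 - root1" root1]) (use a points in \<open>simp_all add: algebra_simps\<close>)
    next
      case 2 then show ?R by (intro pt[of "- 1 - root2" root2]) (use a points in \<open>simp_all add: algebra_simps\<close>)
    qed
  qed
  have "\<forall>j < length qs. \<forall>i < j. eval (qs ! i) (a, b, c) = 0 \<longrightarrow> eval (qs ! j) (a, b, c) = 0 \<longrightarrow> ?R"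
    unfolding qs using p01 p02 p03 p04 p05 p06 p12 p13 p14 p15 p16 p23 p24 p25 p26 p34 p35 p36 p45 p46 p56
    by (simp add: All_less_Suc flip: K_def L_def)
  then show ?R using ij by blast
qed

lemma eval_lin_at_root:
  assumes "47 * y^2 = 28 * y + (171 :: complex)"
    and "47 * (m - k)^2 + 28 * (m - k) * (l - k) \<noteq> 171 * (l - k)^2"
  shows "eval (lin k l m) (- 1 - y, y, 1) \<noteq> 0"
  using root_irrational[OF assms] by (simp add: eval_lin algebra_simps)

context arrangement
begin

definition sing_point :: "singularity_type \<Rightarrow> complex \<times> complex \<times> complex \<Rightarrow> bool" where
  "sing_point T p \<longleftrightarrow> normalized p \<and> ordinary_of_type T (local_equation Q p) \<and>
     (\<exists>i j. i < j \<and> j < length qs \<and> eval (qs ! i) p = 0 \<and> eval (qs ! j) p = 0)"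

lemma node_germ_at:
  assumes ij: "i < j" "j < length qs" "eval (qs ! i) v = 0" "eval (qs ! j) v = 0"
    and others: "\<forall>k < length qs. k \<noteq> i \<longrightarrow> k \<noteq> j \<longrightarrow> eval (qs ! k) v \<noteq> 0"
    and det: "eval (dir u (qs ! i)) v * eval (dir w (qs ! j)) v \<noteq> eval (dir w (qs ! i)) v * eval (dir u (qs ! j)) v"
  shows "ordinary_of_type A1 (germ_at v u w Q)"
proof (rule node_germ[OF _ _ ij(3,4) det])
  let ?N = "\<Prod>k\<in>{..<length qs} - {i} - {j}. qs ! k"
  have "cofactor i = qs ! j * ?N"
    unfolding cofactor_def by (rule prod.remove) (use ij in auto)
  then show "Q = ?N * qs ! i * qs ! j"
    using Q_cofactor[of i] ij by (simp add: algebra_simps)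
  show "eval ?N v \<noteq> 0" using others by (auto simp: eval_prod)
qed

lemma sing_point_node:
  assumes "i < j" "j < length qs" "eval (qs ! i) (x, y, 1) = 0" "eval (qs ! j) (x, y, 1) = 0"
    and "\<forall>k < length qs. k \<noteq> i \<longrightarrow> k \<noteq> j \<longrightarrow> eval (qs ! k) (x, y, 1) \<noteq> 0"
    and "eval (dir (1, 0, 0) (qs ! i)) (x, y, 1) * eval (dir (0, 1, 0) (qs ! j)) (x, y, 1)
      \<noteq> eval (dir (0, 1, 0) (qs ! i)) (x, y, 1) * eval (dir (1, 0, 0) (qs ! j)) (x, y, 1)"
  shows "sing_point A1 (x, y, 1)"
  unfolding sing_point_def local_equation_affine using node_germ_at assms
  by (auto simp: normalized_def)

lemma sing_point_node_infinity:
  assumes "i < j" "j < length qs" "eval (qs ! i) (1, 0, 0) = 0" "eval (qs ! j) (1, 0, 0) = 0"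
    and "\<forall>k < length qs. k \<noteq> i \<longrightarrow> k \<noteq> j \<longrightarrow> eval (qs ! k) (1, 0, 0) \<noteq> 0"
    and "eval (dir (0, 1, 0) (qs ! i)) (1, 0, 0) * eval (dir (0, 0, 1) (qs ! j)) (1, 0, 0)
      \<noteq> eval (dir (0, 0, 1) (qs ! i)) (1, 0, 0) * eval (dir (0, 1, 0) (qs ! j)) (1, 0, 0)"
  shows "sing_point A1 (1, 0, 0)"
  unfolding sing_point_def local_equation_infinity using node_germ_at assms
  by (auto simp: normalized_def)

lemma sing_pointI:
  assumes "ordinary_of_type T (germ_at (x, y, 1) (1, 0, 0) (0, 1, 0) Q)"
    and "i < j" "j < length qs" "eval (qs ! i) (x, y, 1) = 0" "eval (qs ! j) (x, y, 1) = 0"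
  shows "sing_point T (x, y, 1)"
  unfolding sing_point_def local_equation_affine using assms by (auto simp: normalized_def)

lemma counts:
  assumes complete: "\<And>a b c i j. i < j \<Longrightarrow> j < length qs \<Longrightarrow> eval (qs ! i) (a, b, c) = 0 \<Longrightarrow>
      eval (qs ! j) (a, b, c) = 0 \<Longrightarrow> \<exists>p\<in>fst ` set ps. \<exists>t. (a, b, c) = (t * fst p, t * fst (snd p), t * snd (snd p))"
    and type: "\<forall>(p, T) \<in> set ps. sing_point T p"
    and dist: "distinct (map fst ps)"
  shows "card (singular_points Q (ordinary m)) = length (filter (\<lambda>(p, T). mult_of T = m) ps)"
    and "card (singular_points Q (has_type T)) = length (filter (\<lambda>(p, T'). T' = T) ps)"
    and "singular_at Q v \<Longrightarrow> \<exists>T. ordinary_of_type T (local_equation Q v)"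
proof -
  have sing: "singular_at Q v \<longleftrightarrow> (\<exists>p T t. (p, T) \<in> set ps \<and> t \<noteq> 0 \<and>
      v = (t * fst p, t * fst (snd p), t * snd (snd p)))" for v
  proof
    assume "singular_at Q v"
    then obtain i j where v: "v \<noteq> (0, 0, 0)" and ij: "i < j" "j < length qs"
        "eval (qs ! i) v = 0" "eval (qs ! j) v = 0"
      by (auto simp: singular_at_Q_iff)
    have "(fst v, fst (snd v), snd (snd v)) = v" by simp
    with complete[OF ij(1,2), of "fst v" "fst (snd v)" "snd (snd v)"] ij(3,4)
    obtain p t where p: "p \<in> fst ` set ps" and vt: "v = (t * fst p, t * fst (snd p), t * snd (snd p))"
      by metis
    from p obtain T where "(p, T) \<in> set ps" by auto
    moreover have "t \<noteq> 0" using v vt by auto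
    ultimately show "\<exists>p T t. (p, T) \<in> set ps \<and> t \<noteq> 0 \<and> v = (t * fst p, t * fst (snd p), t * snd (snd p))"
      using vt by blast
  next
    assume "\<exists>p T t. (p, T) \<in> set ps \<and> t \<noteq> 0 \<and> v = (t * fst p, t * fst (snd p), t * snd (snd p))"
    then obtain p T t where p: "(p, T) \<in> set ps" "t \<noteq> 0"
      and v: "v = (t * fst p, t * fst (snd p), t * snd (snd p))" by blast
    with type have "sing_point T p" by blast
    then obtain i j where ij: "i < j" "j < length qs" "eval (qs ! i) p = 0" "eval (qs ! j) p = 0"
      and "normalized p"
      by (auto simp: sing_point_def)
    have "eval (qs ! k) v = 0" if "k < length qs" "eval (qs ! k) p = 0" for k
      unfolding v using eval_form_scale[OF form[OF that(1)], of t "fst p" "fst (snd p)" "snd (snd p)"] that(2)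
      by simp
    moreover have "v \<noteq> (0, 0, 0)"
      using p(2) \<open>normalized p\<close> by (auto simp: v normalized_def)
    ultimately show "singular_at Q v" unfolding singular_at_Q_iff using ij less_trans by blast
  qed
  have "normalized p \<and> ordinary_of_type T (local_equation Q p)" if "(p, T) \<in> set ps" for p T
    using type that by (auto simp: sing_point_def)
  note counts = singular_points_card[OF sing this dist]
  show "card (singular_points Q (ordinary m)) = length (filter (\<lambda>(p, T). mult_of T = m) ps)"
    "card (singular_points Q (has_type T)) = length (filter (\<lambda>(p, T'). T' = T) ps)"
    by (rule counts; assumption)+
  show "singular_at Q v \<Longrightarrow> \<exists>T. ordinary_of_type T (local_equation Q v)"
    by (rule counts)
qed

end

definition qs1 :: "polyS list" where
  "qs1 = [conic, lin (- 3) 1 (- 5), lin 3 1 (- 5), lin 0 1 1, lin 0 1 (- 3), lin 1 0 0, lin 1 1 1]"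

definition qs2 :: "polyS list" where
  "qs2 = [conic, lin (- 2) 1 (- 3), lin 2 1 (- 3), lin 0 1 1, lin 0 1 (- 3), lin 1 0 0, lin 1 1 1]"

abbreviation "degrees \<equiv> [2, 1, 1, 1, 1, 1, 1 :: nat]"

lemma prod_list_qs1: "prod_list qs1 = Q1"
  by (simp add: qs1_def Q1_def conic_def lin_poly algebra_simps)

lemma prod_list_qs2: "prod_list qs2 = Q2"
  by (simp add: qs2_def Q2_def conic_def lin_poly algebra_simps)

lemma nth_less_7: "(\<forall>i < length [a0, a1, a2, a3, a4, a5, a6 :: polyS]. P i) \<longleftrightarrow>
    P 0 \<and> P 1 \<and> P 2 \<and> P 3 \<and> P 4 \<and> P 5 \<and> P 6"
  by (simp add: All_less_Suc numeral_eq_Suc) blast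

text \<open>The list \<open>w\<close> contains for each component a point that is on no other component. For the conic this will
  be \<open>(154 : -81 : -47)\<close>.\<close>

lemma arrangement_conic_lines:
  assumes qs: "qs = [conic, lin (- r) 1 (- s), lin r 1 (- s), lin 0 1 1, lin 0 1 (- 3), lin 1 0 0, lin 1 1 1]"
    and s: "s \<noteq> 0"
    and w: "\<forall>i < length qs. w ! i \<noteq> (0, 0, 0) \<and> eval (qs ! i) (w ! i) = 0 \<and>
      (\<forall>j < length qs. j \<noteq> i \<longrightarrow> eval (qs ! j) (w ! i) \<noteq> 0)"
  shows "arrangement qs degrees"
proof
  show "qs \<noteq> []" by (simp add: qs)
  have "\<forall>i < length qs. prime_elem (qs ! i)"
    unfolding qs nth_less_7 using prime_conic prime_varX s
    by (simp add: prime_lin conic_def lin_100)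
  then show "prime_elem (qs ! i)" if "i < length qs" for i using that by blast
  have "\<forall>i < length qs. is_form (degrees ! i) (qs ! i) \<and> degrees ! i > 0"
    unfolding qs nth_less_7 using is_form_conic is_form_lin by simp
  then show "is_form (degrees ! i) (qs ! i)" "degrees ! i > 0" if "i < length qs" for i
    using that by blast+
  have "\<forall>i < length qs. \<not> singular_at (qs ! i) v" for v
    unfolding qs nth_less_7 using smooth_conic smooth_lin by simp
  then show "\<not> singular_at (qs ! i) v" if "i < length qs" for i v using that by blast
  show "\<exists>v. v \<noteq> (0, 0, 0) \<and> eval (qs ! i) v = 0 \<and>
      (\<forall>j < length qs. j \<noteq> i \<longrightarrow> eval (qs ! j) v \<noteq> 0)" if "i < length qs" for i
    using that w by blast
qed

lemmas node_simps = All_less_Suc power2_eq_square eval_conic eval_lin eval_dir_conic eval_dir_lin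

interpretation arr1: arrangement qs1 degrees
  by (rule arrangement_conic_lines[OF qs1_def, where w = "[(154, - 81, - 47), (- 1, - 3, 0), (- 1, - 2, - 1),
        (- 1, - 1, 1), (- 1, - 3, - 1), (0, - 1, 0), (- 1, 0, 1)]"])
    (unfold qs1_def nth_less_7, simp_all add: eval_conic eval_lin)

lemma arr1_Q: "arr1.Q = Q1"
  by (simp add: arr1.Q_def prod_list_qs1)

interpretation arr2: arrangement qs2 degrees
  by (rule arrangement_conic_lines[OF qs2_def, where w = "[(154, - 81, - 47), (- 1, - 2, 0), (- 1, - 1, - 1),
        (- 1, - 1, 1), (- 1, - 3, - 1), (0, - 1, 0), (- 1, 0, 1)]"])
    (unfold qs2_def nth_less_7, simp_all add: eval_conic eval_lin)

lemma arr2_Q: "arr2.Q = Q2"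
  by (simp add: arr2.Q_def prod_list_qs2)

definition sing1 :: "((complex \<times> complex \<times> complex) \<times> singularity_type) list" where
  "sing1 = [((0, 5, 1), X9),
    ((- 2, - 1, 1), D4),
    ((2, - 1, 1), D4),
    ((0, - 1, 1), D4),
    ((1, 0, 0), A1),
    ((- 2/3, 3, 1), A1),
    ((- 3/2, 1/2, 1), A1),
    ((2/3, 3, 1), A1),
    ((3, - 4, 1), A1),
    ((0, 3, 1), A1),
    ((- 4, 3, 1), A1),
    ((3, 3, 1), A1),
    ((- 3, 3, 1), A1),
    ((0, - 39/23, 1), A1),
    ((- 1 - root1, root1, 1), A1), ((- 1 - root2, root2, 1), A1)]"

lemma arr1_infinity: "arr1.sing_point A1 (1, 0, 0)"
  by (rule arr1.sing_point_node_infinity[of 3 4])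
    (simp_all add: node_simps qs1_def)

lemma arr1_nodes:
  "arr1.sing_point A1 (- 2/3, 3, 1)"
  "arr1.sing_point A1 (- 3/2, 1/2, 1)"
  "arr1.sing_point A1 (2/3, 3, 1)"
  "arr1.sing_point A1 (3, - 4, 1)"
  "arr1.sing_point A1 (0, 3, 1)"
  "arr1.sing_point A1 (- 4, 3, 1)"
  "arr1.sing_point A1 (3, 3, 1)"
  "arr1.sing_point A1 (- 3, 3, 1)"
  "arr1.sing_point A1 (0, - 39/23, 1)"
  subgoal by (rule arr1.sing_point_node[of 1 4])
    (simp_all add: node_simps qs1_def)
  subgoal by (rule arr1.sing_point_node[of 1 6])
    (simp_all add: node_simps qs1_def)
  subgoal by (rule arr1.sing_point_node[of 2 4])
    (simp_all add: node_simps qs1_def)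
  subgoal by (rule arr1.sing_point_node[of 2 6])
    (simp_all add: node_simps qs1_def)
  subgoal by (rule arr1.sing_point_node[of 4 5])
    (simp_all add: node_simps qs1_def)
  subgoal by (rule arr1.sing_point_node[of 4 6])
    (simp_all add: node_simps qs1_def)
  subgoal by (rule arr1.sing_point_node[of 0 4])
    (simp_all add: node_simps qs1_def)
  subgoal by (rule arr1.sing_point_node[of 0 4])
    (simp_all add: node_simps qs1_def)
  subgoal by (rule arr1.sing_point_node[of 0 5])
    (simp_all add: node_simps qs1_def)
  done

lemma arr1_irrational_node:
  assumes y: "47 * y^2 = 28 * y + (171 :: complex)"
  shows "arr1.sing_point A1 (- 1 - y, y, 1)"
proof (rule arr1.sing_point_node[of 0 6])
  have "eval conic (- 1 - y, y, 1) = (28 * y + 171) - 47 * y^2"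
    by (simp add: eval_conic power2_eq_square algebra_simps)
  then show "eval (qs1 ! 0) (- 1 - y, y, 1) = 0" using y by (simp add: qs1_def)
  show "eval (qs1 ! 6) (- 1 - y, y, 1) = 0" by (simp add: qs1_def eval_lin)
  show "\<forall>k < length qs1. k \<noteq> 0 \<longrightarrow> k \<noteq> 6 \<longrightarrow> eval (qs1 ! k) (- 1 - y, y, 1) \<noteq> 0"
    unfolding qs1_def nth_less_7 by (simp add: eval_lin_at_root[OF y])
  have "28 + (- 94) * y \<noteq> 0" by (rule root_irrational[OF y]) simp
  then show "eval (dir (1, 0, 0) (qs1 ! 0)) (- 1 - y, y, 1) * eval (dir (0, 1, 0) (qs1 ! 6)) (- 1 - y, y, 1)
      \<noteq> eval (dir (0, 1, 0) (qs1 ! 0)) (- 1 - y, y, 1) * eval (dir (1, 0, 0) (qs1 ! 6)) (- 1 - y, y, 1)"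
    by (simp add: qs1_def eval_dir_conic eval_dir_lin algebra_simps)
qed (simp_all add: qs1_def)

text \<open>The line \<open>y + z = 0\<close> contains one intersection point of the conic with either line of slope \<open>\<plusminus> r\<close>. So
  the conic is in the pencil spanned by these two lines and by the pair of \<open>y + z = 0\<close> and the line
  through the other two intersection points, for \<open>r = 3\<close> the tangent \<open>y = 5 z\<close> at the quadruple point.
  This is the relation needed at the triple points on the conic.\<close>

lemma arr1_triple_013: "arr1.sing_point D4 (- 2, - 1, 1)"
proof -
  have "ordinary_of_type D4 (germ_at (- 2, - 1, 1) (1, 0, 0) (0, 1, 0) Q1)"
  proof (rule triple_germ)
    show "Q1 = (lin 3 1 (- 5) * lin 0 1 (- 3) * lin 1 0 0 * lin 1 1 1) * lin (- 3) 1 (- 5) * lin 0 1 1 * conic"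
      unfolding prod_list_qs1[symmetric] qs1_def by (simp add: ac_simps)
    show "- 8 * lin 3 1 (- 5) * lin (- 3) 1 (- 5) + 77 * lin 0 1 (- 5) * lin 0 1 1 = - 3 * conic"
      by (simp add: lin_poly conic_def power2_eq_square algebra_simps)
  qed (simp_all add: eval_conic eval_lin eval_dir_lin)
  then show ?thesis
    by (intro arr1.sing_pointI[where i = 1 and j = 3, unfolded arr1_Q])
      (simp_all add: qs1_def eval_lin)
qed

lemma arr1_triple_023: "arr1.sing_point D4 (2, - 1, 1)"
proof -
  have "ordinary_of_type D4 (germ_at (2, - 1, 1) (1, 0, 0) (0, 1, 0) Q1)"
  proof (rule triple_germ)
    show "Q1 = (lin (- 3) 1 (- 5) * lin 0 1 (- 3) * lin 1 0 0 * lin 1 1 1) * lin 3 1 (- 5) * lin 0 1 1 * conic"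
      unfolding prod_list_qs1[symmetric] qs1_def by (simp add: ac_simps)
    show "- 8 * lin (- 3) 1 (- 5) * lin 3 1 (- 5) + 77 * lin 0 1 (- 5) * lin 0 1 1 = - 3 * conic"
      by (simp add: lin_poly conic_def power2_eq_square algebra_simps)
  qed (simp_all add: eval_conic eval_lin eval_dir_lin)
  then show ?thesis
    by (intro arr1.sing_pointI[where i = 2 and j = 3, unfolded arr1_Q])
      (simp_all add: qs1_def eval_lin)
qed

lemma arr1_triple_356: "arr1.sing_point D4 (0, - 1, 1)"
proof -
  have "ordinary_of_type D4 (germ_at (0, - 1, 1) (1, 0, 0) (0, 1, 0) Q1)"
  proof (rule triple_germ)
    show "Q1 = (conic * lin (- 3) 1 (- 5) * lin 3 1 (- 5) * lin 0 1 (- 3)) * lin 1 0 0 * lin 0 1 1 * lin 1 1 1"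
      unfolding prod_list_qs1[symmetric] qs1_def by (simp add: ac_simps)
    show "1 * lin 1 0 0 + 1 * lin 0 1 1 = 1 * lin 1 1 1"
      by (simp add: lin_poly conic_def power2_eq_square algebra_simps)
  qed (simp_all add: eval_conic eval_lin eval_dir_lin)
  then show ?thesis
    by (intro arr1.sing_pointI[where i = 5 and j = 6, unfolded arr1_Q])
      (simp_all add: qs1_def eval_lin)
qed

text \<open>The sum and the difference of suitable multiples of \<open>x\<close> and of the equation of the conic are divisible
  by the forms of the other two branches.\<close>

lemma arr1_quadruple: "arr1.sing_point X9 (0, 5, 1)"
proof -
  have "ordinary_of_type X9 (germ_at (0, 5, 1) (1, 0, 0) (0, 1, 0) Q1)"
  proof (rule harmonic_quadruple_germ)
    show "Q1 = (lin 0 1 1 * lin 0 1 (- 3) * lin 1 1 1) * lin 1 0 0 * conic * lin (- 3) 1 (- 5) * lin 3 1 (- 5)"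
      unfolding prod_list_qs1[symmetric] qs1_def by (simp add: ac_simps)
    show "231 * lin 0 1 1 * lin 1 0 0 - - 3 * conic = - (lin (- 24) 69 117) * lin (- 3) 1 (- 5)" "231 * lin 0 1 1 * lin 1 0 0 + - 3 * conic = lin 24 69 117 * lin 3 1 (- 5)"
      by (simp_all add: lin_poly conic_def power2_eq_square algebra_simps)
  qed (simp_all add: eval_conic eval_lin eval_dir_lin eval_dir_conic)
  then show ?thesis
    by (intro arr1.sing_pointI[where i = 1 and j = 2, unfolded arr1_Q])
      (simp_all add: qs1_def eval_lin)
qed

lemma sing1_complete:
  assumes "i < j" "j < length qs1" "eval (qs1 ! i) (a, b, c) = 0" "eval (qs1 ! j) (a, b, c) = 0"
  shows "represented (fst ` set sing1) (a, b, c)"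
  by (rule intersections_represented[of _ 3 5 0 "- 2/3" "- 3/2" 3, OF qs1_def _ _ _ _ _ _ _ _ _ _ assms])
    (simp_all add: sing1_def)

lemma sing1_types: "\<forall>(p, T) \<in> set sing1. arr1.sing_point T p"
  unfolding sing1_def
  using arr1_quadruple arr1_triple_013 arr1_triple_023 arr1_triple_356 arr1_infinity arr1_nodes
    arr1_irrational_node[OF roots(1)] arr1_irrational_node[OF roots(2)] by simp

lemma sing1_distinct: "distinct (map fst sing1)"
proof -
  have r: "root1 \<noteq> 1/2" "root2 \<noteq> 1/2"
    by (rule root_neq; simp add: power2_eq_square field_simps)+
  have q: "- (39 / 23) \<noteq> (5 :: complex)" "- (39 / 23) \<noteq> (3 :: complex)" "- (2 / 3) \<noteq> (3 :: complex)"
    by (simp_all add: complex_eq_iff)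
  show ?thesis using roots(5) r q by (simp add: sing1_def root_neq)
qed

lemmas arr1_counts = arr1.counts[OF sing1_complete[unfolded represented_def] sing1_types sing1_distinct, unfolded arr1_Q]

definition sing2 :: "((complex \<times> complex \<times> complex) \<times> singularity_type) list" where
  "sing2 = [((0, 3, 1), X9),
    ((- 2, - 1, 1), D4),
    ((2, - 1, 1), D4),
    ((0, - 1, 1), D4),
    ((1, 0, 0), A1),
    ((- 4/3, 1/3, 1), A1),
    ((4, - 5, 1), A1),
    ((- 4, 3, 1), A1),
    ((27/29, 141/29, 1), A1),
    ((- 27/29, 141/29, 1), A1),
    ((3, 3, 1), A1),
    ((- 3, 3, 1), A1),
    ((0, - 39/23, 1), A1),
    ((0, 5, 1), A1),
    ((- 1 - root1, root1, 1), A1), ((- 1 - root2, root2, 1), A1)]"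

lemma arr2_infinity: "arr2.sing_point A1 (1, 0, 0)"
  by (rule arr2.sing_point_node_infinity[of 3 4])
    (simp_all add: node_simps qs2_def)

lemma arr2_nodes:
  "arr2.sing_point A1 (- 4/3, 1/3, 1)"
  "arr2.sing_point A1 (4, - 5, 1)"
  "arr2.sing_point A1 (- 4, 3, 1)"
  "arr2.sing_point A1 (27/29, 141/29, 1)"
  "arr2.sing_point A1 (- 27/29, 141/29, 1)"
  "arr2.sing_point A1 (3, 3, 1)"
  "arr2.sing_point A1 (- 3, 3, 1)"
  "arr2.sing_point A1 (0, - 39/23, 1)"
  "arr2.sing_point A1 (0, 5, 1)"
  subgoal by (rule arr2.sing_point_node[of 1 6])
    (simp_all add: node_simps qs2_def)
  subgoal by (rule arr2.sing_point_node[of 2 6])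
    (simp_all add: node_simps qs2_def)
  subgoal by (rule arr2.sing_point_node[of 4 6])
    (simp_all add: node_simps qs2_def)
  subgoal by (rule arr2.sing_point_node[of 0 1])
    (simp_all add: node_simps qs2_def)
  subgoal by (rule arr2.sing_point_node[of 0 2])
    (simp_all add: node_simps qs2_def)
  subgoal by (rule arr2.sing_point_node[of 0 4])
    (simp_all add: node_simps qs2_def)
  subgoal by (rule arr2.sing_point_node[of 0 4])
    (simp_all add: node_simps qs2_def)
  subgoal by (rule arr2.sing_point_node[of 0 5])
    (simp_all add: node_simps qs2_def)
  subgoal by (rule arr2.sing_point_node[of 0 5])
    (simp_all add: node_simps qs2_def)
  done

lemma arr2_irrational_node:
  assumes y: "47 * y^2 = 28 * y + (171 :: complex)"
  shows "arr2.sing_point A1 (- 1 - y, y, 1)"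
proof (rule arr2.sing_point_node[of 0 6])
  have "eval conic (- 1 - y, y, 1) = (28 * y + 171) - 47 * y^2"
    by (simp add: eval_conic power2_eq_square algebra_simps)
  then show "eval (qs2 ! 0) (- 1 - y, y, 1) = 0" using y by (simp add: qs2_def)
  show "eval (qs2 ! 6) (- 1 - y, y, 1) = 0" by (simp add: qs2_def eval_lin)
  show "\<forall>k < length qs2. k \<noteq> 0 \<longrightarrow> k \<noteq> 6 \<longrightarrow> eval (qs2 ! k) (- 1 - y, y, 1) \<noteq> 0"
    unfolding qs2_def nth_less_7 by (simp add: eval_lin_at_root[OF y])
  have "28 + (- 94) * y \<noteq> 0" by (rule root_irrational[OF y]) simp
  then show "eval (dir (1, 0, 0) (qs2 ! 0)) (- 1 - y, y, 1) * eval (dir (0, 1, 0) (qs2 ! 6)) (- 1 - y, y, 1)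
      \<noteq> eval (dir (0, 1, 0) (qs2 ! 0)) (- 1 - y, y, 1) * eval (dir (1, 0, 0) (qs2 ! 6)) (- 1 - y, y, 1)"
    by (simp add: qs2_def eval_dir_conic eval_dir_lin algebra_simps)
qed (simp_all add: qs2_def)

lemma arr2_triple_013: "arr2.sing_point D4 (- 2, - 1, 1)"
proof -
  have "ordinary_of_type D4 (germ_at (- 2, - 1, 1) (1, 0, 0) (0, 1, 0) Q2)"
  proof (rule triple_germ)
    show "Q2 = (lin 2 1 (- 3) * lin 0 1 (- 3) * lin 1 0 0 * lin 1 1 1) * lin (- 2) 1 (- 3) * lin 0 1 1 * conic"
      unfolding prod_list_qs2[symmetric] qs2_def by (simp add: ac_simps)
    show "- 12 * lin 2 1 (- 3) * lin (- 2) 1 (- 3) + lin 0 58 (- 282) * lin 0 1 1 = - 2 * conic"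
      by (simp add: lin_poly conic_def power2_eq_square algebra_simps)
  qed (simp_all add: eval_conic eval_lin eval_dir_lin)
  then show ?thesis
    by (intro arr2.sing_pointI[where i = 1 and j = 3, unfolded arr2_Q])
      (simp_all add: qs2_def eval_lin)
qed

lemma arr2_triple_023: "arr2.sing_point D4 (2, - 1, 1)"
proof -
  have "ordinary_of_type D4 (germ_at (2, - 1, 1) (1, 0, 0) (0, 1, 0) Q2)"
  proof (rule triple_germ)
    show "Q2 = (lin (- 2) 1 (- 3) * lin 0 1 (- 3) * lin 1 0 0 * lin 1 1 1) * lin 2 1 (- 3) * lin 0 1 1 * conic"
      unfolding prod_list_qs2[symmetric] qs2_def by (simp add: ac_simps)
    show "- 12 * lin (- 2) 1 (- 3) * lin 2 1 (- 3) + lin 0 58 (- 282) * lin 0 1 1 = - 2 * conic"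
      by (simp add: lin_poly conic_def power2_eq_square algebra_simps)
  qed (simp_all add: eval_conic eval_lin eval_dir_lin)
  then show ?thesis
    by (intro arr2.sing_pointI[where i = 2 and j = 3, unfolded arr2_Q])
      (simp_all add: qs2_def eval_lin)
qed

lemma arr2_triple_356: "arr2.sing_point D4 (0, - 1, 1)"
proof -
  have "ordinary_of_type D4 (germ_at (0, - 1, 1) (1, 0, 0) (0, 1, 0) Q2)"
  proof (rule triple_germ)
    show "Q2 = (conic * lin (- 2) 1 (- 3) * lin 2 1 (- 3) * lin 0 1 (- 3)) * lin 1 0 0 * lin 0 1 1 * lin 1 1 1"
      unfolding prod_list_qs2[symmetric] qs2_def by (simp add: ac_simps)
    show "1 * lin 1 0 0 + 1 * lin 0 1 1 = 1 * lin 1 1 1"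
      by (simp add: lin_poly conic_def power2_eq_square algebra_simps)
  qed (simp_all add: eval_conic eval_lin eval_dir_lin)
  then show ?thesis
    by (intro arr2.sing_pointI[where i = 5 and j = 6, unfolded arr2_Q])
      (simp_all add: qs2_def eval_lin)
qed

lemma arr2_quadruple: "arr2.sing_point X9 (0, 3, 1)"
proof -
  have "ordinary_of_type X9 (germ_at (0, 3, 1) (1, 0, 0) (0, 1, 0) Q2)"
  proof (rule harmonic_quadruple_germ)
    show "Q2 = (conic * lin 0 1 1 * lin 1 1 1) * lin 1 0 0 * lin 0 1 (- 3) * lin (- 2) 1 (- 3) * lin 2 1 (- 3)"
      unfolding prod_list_qs2[symmetric] qs2_def by (simp add: ac_simps)
    show "2 * lin 1 0 0 - 1 * lin 0 1 (- 3) = - 1 * lin (- 2) 1 (- 3)" "2 * lin 1 0 0 + 1 * lin 0 1 (- 3) = 1 * lin 2 1 (- 3)"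
      by (simp_all add: lin_poly conic_def power2_eq_square algebra_simps)
  qed (simp_all add: eval_conic eval_lin eval_dir_lin eval_dir_conic)
  then show ?thesis
    by (intro arr2.sing_pointI[where i = 1 and j = 2, unfolded arr2_Q])
      (simp_all add: qs2_def eval_lin)
qed

lemma sing2_complete:
  assumes "i < j" "j < length qs2" "eval (qs2 ! i) (a, b, c) = 0" "eval (qs2 ! j) (a, b, c) = 0"
  shows "represented (fst ` set sing2) (a, b, c)"
  by (rule intersections_represented[of _ 2 3 "27/29" 0 "- 4/3" 4, OF qs2_def _ _ _ _ _ _ _ _ _ _ assms])
    (simp_all add: sing2_def)

lemma sing2_types: "\<forall>(p, T) \<in> set sing2. arr2.sing_point T p"
  unfolding sing2_def
  using arr2_quadruple arr2_triple_013 arr2_triple_023 arr2_triple_356 arr2_infinity arr2_nodes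
    arr2_irrational_node[OF roots(1)] arr2_irrational_node[OF roots(2)] by simp

lemma sing2_distinct: "distinct (map fst sing2)"
proof -
  have r: "root1 \<noteq> 1/3" "root2 \<noteq> 1/3" "root1 \<noteq> 141/29" "root2 \<noteq> 141/29"
    by (rule root_neq; simp add: power2_eq_square field_simps)+
  have q: "- (39 / 23) \<noteq> (5 :: complex)" "- (39 / 23) \<noteq> (3 :: complex)"
    by (simp_all add: complex_eq_iff)
  show ?thesis using roots(5) r q by (simp add: sing2_def root_neq)
qed

lemmas arr2_counts = arr2.counts[OF sing2_complete[unfolded represented_def] sing2_types sing2_distinct, unfolded arr2_Q]

section \<open>Graded resolutions of length one\<close>

text \<open>The matrix \<open>A\<close> is a list of rows.\<close>

definition lin_map :: "polyS list list \<Rightarrow> polyS vec \<Rightarrow> polyS vec" where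
  "lin_map A v = vec (length A) (\<lambda>i. \<Sum>j<dim_vec v. A ! i ! j * v $ j)"

lemma lin_map_index: "i < length A \<Longrightarrow> lin_map A v $ i = (\<Sum>j<dim_vec v. A ! i ! j * v $ j)"
  by (simp add: lin_map_def)

lemma lin_map_carrier [simp]: "lin_map A v \<in> carrier_vec (length A)"
  by (simp add: lin_map_def)

lemma lin_map_dim [simp]: "dim_vec (lin_map A v) = length A"
  by (simp add: lin_map_def)

lemma lin_map_add:
  "u \<in> carrier_vec n \<Longrightarrow> v \<in> carrier_vec n \<Longrightarrow> lin_map A (u + v) = lin_map A u + lin_map A v"
  by (rule eq_vecI) (auto simp: lin_map_index algebra_simps sum.distrib)

lemma lin_map_smult: "lin_map A (p \<cdot>\<^sub>v v) = p \<cdot>\<^sub>v lin_map A v"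
  by (rule eq_vecI) (auto simp: lin_map_index algebra_simps sum_distrib_left)

lemma eval_sum: "eval (sum f A) v = (\<Sum>a\<in>A. eval (f a) v)"
  by (induction A rule: infinite_finite_induct) auto

text \<open>Zero entries are exempt from the condition on the shifts: they may stand where the degree of a nonzero
  entry would be negative.\<close>

definition homogeneous_matrix :: "nat list \<Rightarrow> nat list \<Rightarrow> polyS list list \<Rightarrow> bool" where
  "homogeneous_matrix as bs A \<longleftrightarrow> length A = length bs \<and> (\<forall>i < length bs. \<forall>j < length as.
     A ! i ! j = 0 \<or> (bs ! i \<le> as ! j \<and> is_form (as ! j - bs ! i) (A ! i ! j)))"

lemma graded_hom_lin_map:
  assumes "homogeneous_matrix as bs A"
  shows "graded_hom as bs (lin_map A)"
  unfolding graded_hom_def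
proof (intro conjI allI ballI)
  have len: "length A = length bs" using assms by (simp add: homogeneous_matrix_def)
  then show "lin_map A \<in> free_module as \<rightarrow> free_module bs" using lin_map_carrier[of A] by simp
  show "lin_map A (u + v) = lin_map A u + lin_map A v" if "u \<in> free_module as" "v \<in> free_module as" for u v
    using lin_map_add that by blast
  show "lin_map A (p \<cdot>\<^sub>v v) = p \<cdot>\<^sub>v lin_map A v" for p v by (rule lin_map_smult)
  fix r
  show "lin_map A ` free_part as r \<subseteq> free_part bs r"
  proof
    fix w assume "w \<in> lin_map A ` free_part as r"
    then obtain v where w: "w = lin_map A v" and v: "v \<in> carrier_vec (length as)"
      and part: "\<And>j. j < length as \<Longrightarrow> if as ! j \<le> r then is_form (r - as ! j) (v $ j) else v $ j = 0"
      by (auto simp: free_part_def)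
    have entry: "if bs ! i \<le> r then is_form (r - bs ! i) (A ! i ! j * v $ j) else A ! i ! j * v $ j = 0"
      if i: "i < length bs" and j: "j < length as" for i j
    proof (cases "A ! i ! j = 0 \<or> v $ j = 0")
      case False
      then have "bs ! i \<le> as ! j" "is_form (as ! j - bs ! i) (A ! i ! j)"
        using assms i j by (auto simp: homogeneous_matrix_def)
      moreover have "as ! j \<le> r" "is_form (r - as ! j) (v $ j)"
        using part[OF j] False by (auto split: if_splits)
      ultimately show ?thesis by (auto intro!: is_form_mult')
    qed auto
    have "if bs ! i \<le> r then is_form (r - bs ! i) (w $ i) else w $ i = 0" if "i < length bs" for i
    proof -
      have w_i: "w $ i = (\<Sum>j<length as. A ! i ! j * v $ j)"
        using that v len by (simp add: w lin_map_index)
      show ?thesis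
      proof (cases "bs ! i \<le> r")
        case True
        then have "is_form (r - bs ! i) (w $ i)"
          unfolding w_i by (intro is_form_sum) (use entry[OF that] in auto)
        with True show ?thesis by simp
      next
        case False
        then have "w $ i = 0"
          unfolding w_i by (intro sum.neutral) (use entry[OF that] in auto)
        with False show ?thesis by simp
      qed
    qed
    moreover have "w \<in> carrier_vec (length bs)" using w len lin_map_carrier by metis
    ultimately show "w \<in> free_part bs r" by (simp add: free_part_def)
  qed
qed

lemma min_graded_free_resI:
  assumes "homogeneous_matrix F0 [0, 0, 0] A" "homogeneous_matrix F1 F0 B"
    and image: "lin_map A ` free_module F0 = M"
    and exact: "lin_map B ` free_module F1 = {v \<in> free_module F0. lin_map A v = 0\<^sub>v 3}"
    and minimal: "\<And>i j. i < length F0 \<Longrightarrow> j < length F1 \<Longrightarrow> mono_coeff (B ! i ! j) 0 0 0 = 0"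
    and inj: "\<And>w. w \<in> free_module F1 \<Longrightarrow> lin_map B w = 0\<^sub>v (length F0) \<Longrightarrow> w = 0\<^sub>v (length F1)"
  shows "min_graded_free_res M [F0, F1]"
proof -
  let ?\<phi> = "\<lambda>i :: nat. if i = 0 then lin_map A else lin_map B"
  have hom: "graded_hom F0 [0, 0, 0] (lin_map A)" "graded_hom F1 F0 (lin_map B)"
    using assms graded_hom_lin_map by blast+
  have len: "length B = length F0" using assms by (simp add: homogeneous_matrix_def)
  have "lin_map B ` free_module F1 \<subseteq> irrelevant_part F0"
  proof
    fix v assume "v \<in> lin_map B ` free_module F1"
    then obtain w where w: "v = lin_map B w" "w \<in> carrier_vec (length F1)" by blast
    have "mono_coeff (v $ i) 0 0 0 = 0" if "i < length F0" for i
    proof -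
      have "v $ i = (\<Sum>j<length F1. B ! i ! j * w $ j)"
        using w that len by (simp add: lin_map_index)
      also have "eval \<dots> (0, 0, 0) = 0"
        using minimal[OF that] by (simp add: eval_sum mono_coeff_000)
      finally show ?thesis by (simp add: mono_coeff_000)
    qed
    moreover have "v \<in> carrier_vec (length F0)" using w len lin_map_carrier by metis
    ultimately show "v \<in> irrelevant_part F0" by (simp add: irrelevant_part_def)
  qed
  moreover have "inj_on (lin_map B) (free_module F1)"
  proof (rule inj_onI)
    fix u v assume uv: "u \<in> free_module F1" "v \<in> free_module F1" "lin_map B u = lin_map B v"
    have "lin_map B (u + (- 1) \<cdot>\<^sub>v v) = lin_map B u + (- 1) \<cdot>\<^sub>v lin_map B v"
      using uv lin_map_add[of u "length F1" "(- 1) \<cdot>\<^sub>v v" B] by (simp add: lin_map_smult)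
    also have "\<dots> = 0\<^sub>v (length F0)"
      unfolding uv(3) using len by (auto simp: Matrix.vec_eq_iff)
    finally have "u + (- 1) \<cdot>\<^sub>v v = 0\<^sub>v (length F1)" using inj uv by simp
    then have "(u + (- 1) \<cdot>\<^sub>v v) $ i = 0" if "i < length F1" for i using that by simp
    then show "u = v"
      using uv by (intro eq_vecI) auto
  qed
  ultimately show ?thesis
    unfolding min_graded_free_res_def Let_def
    using hom image exact
    by (intro conjI exI[of _ ?\<phi>]) (auto simp: less_Suc_eq numeral_2_eq_2 numeral_3_eq_3)
qed

text \<open>The identity of \<open>\<complex>\<^sup>n\<close> does not factor through a space of smaller dimension: padded with zeros to
  square matrices, a factorization would express \<open>1\<close> as a product of two determinants, one of which
  is \<open>0\<close>.\<close>

lemma no_complex_identity_factorization: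
  fixes c d :: "nat \<Rightarrow> nat \<Rightarrow> complex"
  assumes id: "\<And>i k. i < n \<Longrightarrow> k < n \<Longrightarrow> (\<Sum>j<m. c i j * d j k) = (if i = k then 1 else 0)"
  shows "n \<le> m"
proof (rule ccontr)
  assume "\<not> n \<le> m"
  then have m: "m < n" by simp
  define C where "C = mat n n (\<lambda>(i, j). if j < m then c i j else 0)"
  define D where "D = mat n n (\<lambda>(j, k). if j < m then d j k else 0)"
  have CD: "C \<in> carrier_mat n n" "D \<in> carrier_mat n n" by (simp_all add: C_def D_def)
  have "C * D = 1\<^sub>m n"
  proof (rule eq_matI)
    fix i k assume ik: "i < dim_row (1\<^sub>m n :: complex mat)" "k < dim_col (1\<^sub>m n :: complex mat)"
    then have "(C * D) $$ (i, k) = (\<Sum>j = 0..<n. (if j < m then c i j else 0) * (if j < m then d j k else 0))"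
      by (simp add: C_def D_def scalar_prod_def)
    also have "\<dots> = (\<Sum>j = 0..<m. c i j * d j k)"
      by (rule sum.mono_neutral_cong_right) (use m in auto)
    also have "\<dots> = (if i = k then 1 else 0)"
      using id ik by (simp add: atLeast0LessThan)
    finally show "(C * D) $$ (i, k) = 1\<^sub>m n $$ (i, k)" using ik by simp
  qed (simp_all add: C_def D_def)
  then have "Determinant.det C * Determinant.det D = 1" using Determinant.det_mult[OF CD] Determinant.det_one[of n] by metis
  moreover have "Determinant.det C = 0"
  proof -
    have "C *\<^sub>v unit_vec n m = 0\<^sub>v n"
      by (rule eq_vecI) (use m in \<open>auto simp: C_def scalar_prod_right_unit\<close>)
    moreover have "unit_vec n m \<noteq> (0\<^sub>v n :: complex vec)" using m by simp
    ultimately show ?thesis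
      using det_0_iff_vec_prod_zero_field[OF CD(1)] unit_vec_carrier by blast
  qed
  ultimately show False by simp
qed

lemma hom_linear_combination:
  fixes m :: nat and c :: "nat \<Rightarrow> polyS"
  assumes add: "\<And>u v. u \<in> carrier_vec n \<Longrightarrow> v \<in> carrier_vec n \<Longrightarrow> \<phi> (u + v) = \<phi> u + \<phi> v"
    and smult: "\<And>p v. v \<in> carrier_vec n \<Longrightarrow> \<phi> (p \<cdot>\<^sub>v v) = p \<cdot>\<^sub>v \<phi> v"
    and carrier: "\<And>v. v \<in> carrier_vec n \<Longrightarrow> \<phi> v \<in> carrier_vec l"
    and w: "\<And>j. j < m \<Longrightarrow> w j \<in> carrier_vec n"
  shows "\<phi> (vec n (\<lambda>k. \<Sum>j<m. c j * w j $ k)) = vec l (\<lambda>i. \<Sum>j<m. c j * \<phi> (w j) $ i)"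
  using w
proof (induction m)
  case 0
  have "\<phi> (0 \<cdot>\<^sub>v 0\<^sub>v n) = 0 \<cdot>\<^sub>v \<phi> (0\<^sub>v n)" by (rule smult) simp
  moreover have "0 \<cdot>\<^sub>v 0\<^sub>v n = (0\<^sub>v n :: polyS vec)" by auto
  moreover have "\<phi> (0\<^sub>v n) \<in> carrier_vec l" by (rule carrier) simp
  ultimately have "\<phi> (0\<^sub>v n) = 0\<^sub>v l" by (auto simp: Matrix.vec_eq_iff)
  moreover have "vec k (\<lambda>_. 0) = (0\<^sub>v k :: polyS vec)" for k by auto
  ultimately show ?case by (simp only: lessThan_0 sum.empty)
next
  case (Suc m)
  have "vec n (\<lambda>k. \<Sum>j<Suc m. c j * w j $ k) = vec n (\<lambda>k. \<Sum>j<m. c j * w j $ k) + c m \<cdot>\<^sub>v w m"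
    using Suc.prems[of m] by (auto simp: Matrix.vec_eq_iff)
  then have "\<phi> (vec n (\<lambda>k. \<Sum>j<Suc m. c j * w j $ k))
      = vec l (\<lambda>i. \<Sum>j<m. c j * \<phi> (w j) $ i) + c m \<cdot>\<^sub>v \<phi> (w m)"
    using Suc add smult by simp
  also have "\<dots> = vec l (\<lambda>i. \<Sum>j<Suc m. c j * \<phi> (w j) $ i)"
    using carrier[of "w m"] Suc.prems[of m] by (auto simp: Matrix.vec_eq_iff)
  finally show ?case .
qed

definition generated_by :: "polyS vec set \<Rightarrow> nat \<Rightarrow> (nat \<Rightarrow> polyS vec) \<Rightarrow> bool" where
  "generated_by M m g \<longleftrightarrow> (\<forall>j<m. g j \<in> M) \<and> (\<forall>v\<in>M. \<exists>c. v = vec 3 (\<lambda>i. \<Sum>j<m. c j * g j $ i))"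

text \<open>The kernel of the augmentation is in \<open>\<mm> F\<^sub>0\<close> because the resolution is minimal or, if it has length
  \<open>0\<close>, because the augmentation is injective.\<close>

lemma min_graded_free_res_augmentation:
  assumes "min_graded_free_res M Fs"
  obtains \<phi> where "graded_hom (Fs ! 0) [0, 0, 0] \<phi>" "\<phi> ` free_module (Fs ! 0) = M"
    "\<And>v. v \<in> free_module (Fs ! 0) \<Longrightarrow> \<phi> v = 0\<^sub>v 3 \<Longrightarrow> v \<in> irrelevant_part (Fs ! 0)"
proof -
  let ?G = "[0, 0, 0] # Fs"
  from assms obtain \<phi> where ne: "Fs \<noteq> []"
    and hom: "\<And>i. i < length Fs \<Longrightarrow> graded_hom (?G ! Suc i) (?G ! i) (\<phi> i)"
    and img: "\<phi> 0 ` free_module (?G ! 1) = M"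
    and ex: "\<And>i. Suc i < length Fs \<Longrightarrow>
           \<phi> (Suc i) ` free_module (?G ! Suc (Suc i)) =
             {v \<in> free_module (?G ! Suc i). \<phi> i v = 0\<^sub>v (length (?G ! i))} \<and>
           \<phi> (Suc i) ` free_module (?G ! Suc (Suc i)) \<subseteq> irrelevant_part (?G ! Suc i)"
    and inj: "inj_on (\<phi> (length Fs - 1)) (free_module (?G ! length Fs))"
    unfolding min_graded_free_res_def Let_def by blast
  have hom0: "graded_hom (Fs ! 0) [0, 0, 0] (\<phi> 0)" using hom[of 0] ne by simp
  have ker: "v \<in> irrelevant_part (Fs ! 0)" if v: "v \<in> free_module (Fs ! 0)" "\<phi> 0 v = 0\<^sub>v 3" for v
  proof (cases "length Fs = 1")
    case True
    have "\<phi> 0 (0 \<cdot>\<^sub>v v) = 0 \<cdot>\<^sub>v \<phi> 0 v" using hom0 v(1) unfolding graded_hom_def by blast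
    then have "\<phi> 0 (0 \<cdot>\<^sub>v v) = \<phi> 0 v" using v(2) by (auto simp: Matrix.vec_eq_iff)
    then have "0 \<cdot>\<^sub>v v = v" using inj v(1) True by (auto dest: inj_onD)
    then have "v $ i = 0" if "i < length (Fs ! 0)" for i
      using v(1) that by (metis carrier_vecD index_smult_vec(1) mult_zero_left)
    then show ?thesis using v(1) by (simp add: irrelevant_part_def mono_coeff_def)
  next
    case False
    then have "Suc 0 < length Fs" using ne by (cases Fs) auto
    from ex[OF this] v show ?thesis by (auto simp: numeral_3_eq_3)
  qed
  show thesis by (rule that[OF hom0 _ ker]) (use img in simp_all)
qed

lemma min_graded_free_res_generators:
  assumes "min_graded_free_res M Fs"
  obtains g where "generated_by M (length (Fs ! 0)) g"
proof -
  obtain \<phi> where hom: "graded_hom (Fs ! 0) [0, 0, 0] \<phi>" and img: "\<phi> ` free_module (Fs ! 0) = M"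
    using min_graded_free_res_augmentation[OF assms] by blast
  let ?n = "length (Fs ! 0)"
  have lin: "\<And>u v. u \<in> carrier_vec ?n \<Longrightarrow> v \<in> carrier_vec ?n \<Longrightarrow> \<phi> (u + v) = \<phi> u + \<phi> v"
    "\<And>p v. v \<in> carrier_vec ?n \<Longrightarrow> \<phi> (p \<cdot>\<^sub>v v) = p \<cdot>\<^sub>v \<phi> v"
    "\<And>v. v \<in> carrier_vec ?n \<Longrightarrow> \<phi> v \<in> carrier_vec 3"
    using hom by (auto simp: graded_hom_def numeral_3_eq_3)
  have "generated_by M ?n (\<lambda>j. \<phi> (unit_vec ?n j))"
    unfolding generated_by_def
  proof (intro conjI allI impI ballI)
    show "\<phi> (unit_vec ?n j) \<in> M" for j using img by auto
    fix v assume "v \<in> M"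
    then obtain u where u: "u \<in> carrier_vec ?n" "v = \<phi> u" using img by auto
    have "u = vec ?n (\<lambda>k. \<Sum>j<?n. u $ j * unit_vec ?n j $ k)"
    proof (rule eq_vecI)
      fix k assume k: "k < dim_vec (vec ?n (\<lambda>k. \<Sum>j<?n. u $ j * unit_vec ?n j $ k))"
      have "(\<Sum>j<?n. u $ j * unit_vec ?n j $ k) = (\<Sum>j<?n. if j = k then u $ k else 0)"
        by (rule sum.cong) (use k in auto)
      then show "u $ k = vec ?n (\<lambda>k. \<Sum>j<?n. u $ j * unit_vec ?n j $ k) $ k"
        using k by simp
    qed (use u in simp)
    then have "\<phi> u = \<phi> (vec ?n (\<lambda>k. \<Sum>j<?n. u $ j * unit_vec ?n j $ k))"
      by (rule arg_cong)
    also have "\<dots> = vec 3 (\<lambda>i. \<Sum>j<?n. u $ j * \<phi> (unit_vec ?n j) $ i)"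
      by (rule hom_linear_combination[where n = ?n]) (use lin in auto)
    finally have "v = vec 3 (\<lambda>i. \<Sum>j<?n. u $ j * \<phi> (unit_vec ?n j) $ i)" using u(2) by simp
    then show "\<exists>c. v = vec 3 (\<lambda>i. \<Sum>j<?n. c j * \<phi> (unit_vec ?n j) $ i)" by blast
  qed
  then show thesis by (rule that)
qed

text \<open>Minimal generators are independent modulo \<open>\<mm>\<close>: writing them in terms of any other generators and these
  back in terms of the minimal ones gives the identity modulo \<open>\<mm>\<close>.\<close>

lemma min_graded_free_res_generators_le:
  assumes res: "min_graded_free_res M Fs" and gen: "generated_by M m g"
  shows "length (Fs ! 0) \<le> m"
proof -
  obtain \<phi> where hom: "graded_hom (Fs ! 0) [0, 0, 0] \<phi>" and img: "\<phi> ` free_module (Fs ! 0) = M"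
    and ker: "\<And>v. v \<in> free_module (Fs ! 0) \<Longrightarrow> \<phi> v = 0\<^sub>v 3 \<Longrightarrow> v \<in> irrelevant_part (Fs ! 0)"
    using min_graded_free_res_augmentation[OF res] by blast
  let ?n = "length (Fs ! 0)"
  have lin: "\<And>u v. u \<in> carrier_vec ?n \<Longrightarrow> v \<in> carrier_vec ?n \<Longrightarrow> \<phi> (u + v) = \<phi> u + \<phi> v"
    "\<And>p v. v \<in> carrier_vec ?n \<Longrightarrow> \<phi> (p \<cdot>\<^sub>v v) = p \<cdot>\<^sub>v \<phi> v"
    "\<And>v. v \<in> carrier_vec ?n \<Longrightarrow> \<phi> v \<in> carrier_vec 3"
    using hom by (auto simp: graded_hom_def numeral_3_eq_3)
  have "\<forall>j<m. \<exists>u \<in> carrier_vec ?n. g j = \<phi> u"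
    using gen img by (auto simp: generated_by_def)
  then obtain w where w: "\<And>j. j < m \<Longrightarrow> w j \<in> carrier_vec ?n" "\<And>j. j < m \<Longrightarrow> g j = \<phi> (w j)"
    by metis
  have "\<forall>i<?n. \<exists>c. \<phi> (unit_vec ?n i) = vec 3 (\<lambda>l. \<Sum>j<m. c j * g j $ l)"
    using gen img by (auto simp: generated_by_def)
  then have "\<exists>c. \<forall>i<?n. \<phi> (unit_vec ?n i) = vec 3 (\<lambda>l. \<Sum>j<m. c i j * g j $ l)"
    by (simp only: choice_iff')
  then obtain c where c: "\<And>i. i < ?n \<Longrightarrow> \<phi> (unit_vec ?n i) = vec 3 (\<lambda>l. \<Sum>j<m. c i j * g j $ l)"
    by blast
  show ?thesis
  proof (rule no_complex_identity_factorization)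
    fix i k assume ik: "i < ?n" "k < ?n"
    define u where "u = vec ?n (\<lambda>k. \<Sum>j<m. c i j * w j $ k)"
    have u: "u \<in> carrier_vec ?n" by (simp add: u_def)
    have "\<phi> u = vec 3 (\<lambda>l. \<Sum>j<m. c i j * \<phi> (w j) $ l)"
      unfolding u_def by (rule hom_linear_combination[OF lin w(1)])
    also have "\<dots> = \<phi> (unit_vec ?n i)" unfolding c[OF ik(1)] using w(2) by simp
    finally have \<phi>u: "\<phi> u = \<phi> (unit_vec ?n i)" .
    have "\<phi> (unit_vec ?n i + (- 1) \<cdot>\<^sub>v u) = \<phi> (unit_vec ?n i) + (- 1) \<cdot>\<^sub>v \<phi> u"
      using lin(1)[of "unit_vec ?n i" "(- 1) \<cdot>\<^sub>v u"] lin(2)[OF u] u by simp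
    also have "\<dots> = 0\<^sub>v 3" unfolding \<phi>u using lin(3)[of "unit_vec ?n i"] by (auto simp: Matrix.vec_eq_iff)
    finally have "unit_vec ?n i + (- 1) \<cdot>\<^sub>v u \<in> irrelevant_part (Fs ! 0)" using ker u by simp
    then have "eval ((unit_vec ?n i + (- 1) \<cdot>\<^sub>v u) $ k) (0, 0, 0) = 0"
      using ik by (simp add: irrelevant_part_def mono_coeff_000)
    then show "(\<Sum>j<m. eval (c i j) (0, 0, 0) * eval (w j $ k) (0, 0, 0)) = (if i = k then 1 else 0)"
      using ik u by (simp add: u_def eval_sum split: if_splits)
  qed
qed

lemma min_graded_free_res_rank_unique:
  assumes "min_graded_free_res M Fs" "min_graded_free_res M Gs"
  shows "length (Fs ! 0) = length (Gs ! 0)"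
proof (rule le_antisym)
  obtain f where "generated_by M (length (Fs ! 0)) f" by (rule min_graded_free_res_generators[OF assms(1)])
  then show "length (Gs ! 0) \<le> length (Fs ! 0)" by (rule min_graded_free_res_generators_le[OF assms(2)])
  obtain g where "generated_by M (length (Gs ! 0)) g" by (rule min_graded_free_res_generators[OF assms(2)])
  then show "length (Fs ! 0) \<le> length (Gs ! 0)" by (rule min_graded_free_res_generators_le[OF assms(1)])
qed

text \<open>The row \<open>\<beta> 0\<close> determines the number of minimal generators.\<close>

lemma graded_betti_numbers_differ:
  assumes F: "min_graded_free_res M Fs" and G: "min_graded_free_res N Gs"
    and len: "length (Fs ! 0) \<noteq> length (Gs ! 0)"
    and "has_graded_betti_numbers M \<beta>" "has_graded_betti_numbers N \<gamma>"
  shows "\<beta> \<noteq> \<gamma>"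
proof
  assume eq: "\<beta> = \<gamma>"
  obtain Fs' where F': "min_graded_free_res M Fs'" "\<beta> = (\<lambda>i j. if i < length Fs' then count_list (Fs' ! i) j else 0)"
    using assms(4) by (auto simp: has_graded_betti_numbers_def)
  obtain Gs' where G': "min_graded_free_res N Gs'" "\<gamma> = (\<lambda>i j. if i < length Gs' then count_list (Gs' ! i) j else 0)"
    using assms(5) by (auto simp: has_graded_betti_numbers_def)
  have "0 < length Fs'" "0 < length Gs'"
    using F'(1) G'(1) by (auto simp: min_graded_free_res_def)
  then have "count_list (Fs' ! 0) j = count_list (Gs' ! 0) j" for j
    using fun_cong[OF fun_cong[OF eq, of 0], of j] F'(2) G'(2) by simp
  then have "mset (Fs' ! 0) = mset (Gs' ! 0)"
    by (intro multiset_eqI) (simp add: count_mset)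
  then have "length (Fs' ! 0) = length (Gs' ! 0)" by (metis size_mset)
  then show False using len min_graded_free_res_rank_unique F G F'(1) G'(1) by metis
qed

section \<open>From logarithmic derivations to Jacobian syzygies\<close>

text \<open>A derivation preserving the ideal of the arrangement is the sum of a multiple of the Euler derivation
  and one that kills \<open>y + z\<close>. The latter is \<open>(s P, R, - R)\<close>, with a numerical factor \<open>s\<close> that keeps
  coefficients integral: it maps the coordinate \<open>y - (s - 1) z\<close> to \<open>s R\<close>. Subtracting from such a basis the multiples of the Euler derivation that
  make them kill \<open>f\<close> gives generators of \<open>AR f\<close> with the same syzygies. The number \<open>8\<close> is the degree
  of \<open>f\<close>.\<close>

locale log_basis =
  fixes f :: polyS and s :: polyS and n :: nat and P R \<kappa> :: "nat \<Rightarrow> polyS"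
  assumes nonzero: "f \<noteq> 0" and unit: "s dvd 1"
    and euler: "der varX varY varZ f = 8 * f"
    and line: "\<And>a b c. f dvd der a b c f \<Longrightarrow> varY + varZ dvd b + c"
    and basis: "\<And>j. j < n \<Longrightarrow> der (s * P j) (R j) (- R j) f = s * \<kappa> j * f"
    and generate: "\<And>p r. f dvd der (s * p) r (- r) f \<Longrightarrow>
      \<exists>h. p = (\<Sum>j<n. h j * P j) \<and> r = (\<Sum>j<n. h j * R j)"
begin

definition gens :: "polyS list list" where
  "gens = [map (\<lambda>j. 8 * (s * P j) - s * \<kappa> j * varX) [0..<n],
     map (\<lambda>j. 8 * R j - s * \<kappa> j * varY) [0..<n], map (\<lambda>j. - 8 * R j - s * \<kappa> j * varZ) [0..<n]]"

lemma length_gens [simp]: "length gens = 3"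
  by (simp add: gens_def)

lemma lin_map_gens:
  assumes "v \<in> carrier_vec n"
  defines "p \<equiv> \<Sum>j<n. v $ j * P j" and "r \<equiv> \<Sum>j<n. v $ j * R j" and "k \<equiv> \<Sum>j<n. v $ j * \<kappa> j"
  shows "lin_map gens v $ 0 = 8 * (s * p) - s * k * varX"
    "lin_map gens v $ 1 = 8 * r - s * k * varY" "lin_map gens v $ 2 = - 8 * r - s * k * varZ"
proof -
  have "lin_map gens v $ 0 = (\<Sum>j<n. (8 * (s * P j) - s * \<kappa> j * varX) * v $ j)"
    "lin_map gens v $ 1 = (\<Sum>j<n. (8 * R j - s * \<kappa> j * varY) * v $ j)"
    "lin_map gens v $ 2 = (\<Sum>j<n. (- 8 * R j - s * \<kappa> j * varZ) * v $ j)"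
    using assms(1) by (simp_all add: lin_map_index) (simp_all add: gens_def)
  then show "lin_map gens v $ 0 = 8 * (s * p) - s * k * varX"
    "lin_map gens v $ 1 = 8 * r - s * k * varY" "lin_map gens v $ 2 = - 8 * r - s * k * varZ"
    unfolding p_def r_def k_def sum_distrib_left sum_distrib_right
      sum_subtractf[symmetric] sum_negf[symmetric]
    by (simp_all add: algebra_simps)
qed

lemma der_sum_basis:
  "der (s * (\<Sum>j<n. h j * P j)) (\<Sum>j<n. h j * R j) (- (\<Sum>j<n. h j * R j)) f = s * (\<Sum>j<n. h j * \<kappa> j) * f"
proof -
  have "der (s * (\<Sum>j<n. h j * P j)) (\<Sum>j<n. h j * R j) (- (\<Sum>j<n. h j * R j)) f
      = (\<Sum>j<n. h j * der (s * P j) (R j) (- R j) f)"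
    unfolding der_def sum_distrib_left sum_distrib_right sum_negf[symmetric] sum.distrib[symmetric]
    by (rule sum.cong) (simp_all add: algebra_simps)
  also have "\<dots> = (\<Sum>j<n. h j * (s * \<kappa> j * f))" using basis by simp
  finally show ?thesis
    by (simp add: sum_distrib_left sum_distrib_right algebra_simps)
qed

lemma der_combination:
  "der (8 * (s * p) - k * varX) (8 * r - k * varY) (- 8 * r - k * varZ) f
    = 8 * der (s * p) r (- r) f - 8 * k * f"
proof -
  have "der (8 * (s * p) - k * varX) (8 * r - k * varY) (- 8 * r - k * varZ) f
      = 8 * der (s * p) r (- r) f - k * der varX varY varZ f"
    by (simp add: der_def algebra_simps)
  then show ?thesis by (simp add: euler)
qed

lemma AR_image: "lin_map gens ` carrier_vec n = AR f"
proof (intro equalityI subsetI)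
  fix w assume "w \<in> lin_map gens ` carrier_vec n"
  then obtain v where v: "v \<in> carrier_vec n" and w: "w = lin_map gens v" by blast
  have "der (w $ 0) (w $ 1) (w $ 2) f = 0"
    unfolding w lin_map_gens[OF v] der_combination der_sum_basis by (simp add: algebra_simps)
  moreover have "w \<in> carrier_vec 3" using lin_map_carrier[of gens v] by (simp add: w)
  ultimately show "w \<in> AR f" by (simp add: AR_def der_def)
next
  fix w assume "w \<in> AR f"
  then have w3: "w \<in> carrier_vec 3" and w0: "der (w $ 0) (w $ 1) (w $ 2) f = 0"
    by (simp_all add: AR_def der_def)
  have "varY + varZ dvd w $ 1 + w $ 2" by (rule line[of "w $ 0"], unfold w0) simp
  then obtain e where e: "w $ 1 + w $ 2 = (varY + varZ) * e" by (elim dvdE)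
  obtain s' where s': "1 = s * s'" using unit by (elim dvdE)
  define p where "p = s' * (w $ 0 - e * varX)"
  define r where "r = w $ 1 - e * varY"
  have "s * p = (s * s') * (w $ 0 - e * varX)" by (simp add: p_def)
  then have sp: "s * p = w $ 0 - e * varX" using s' by simp
  have r': "- r = w $ 2 - e * varZ"
    using e by (simp add: r_def algebra_simps)
  have "der (s * p) r (- r) f = der (w $ 0) (w $ 1) (w $ 2) f - e * der varX varY varZ f"
    unfolding sp r' by (simp add: r_def der_def algebra_simps)
  then have dpr: "der (s * p) r (- r) f = - 8 * e * f" unfolding w0 euler by (simp add: algebra_simps)
  then have "f dvd der (s * p) r (- r) f" by simp
  then obtain h where h: "p = (\<Sum>j<n. h j * P j)" "r = (\<Sum>j<n. h j * R j)" using generate by blast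
  define k where "k = (\<Sum>j<n. h j * \<kappa> j)"
  have "der (s * p) r (- r) f = s * k * f" unfolding h k_def by (rule der_sum_basis)
  with dpr have skf: "s * k * f = - 8 * e * f" by simp
  have "(s * k + 8 * e) * f = s * k * f + 8 * e * f" by (simp add: distrib_right)
  also have "\<dots> = 0" unfolding skf by simp
  finally have "(s * k + 8 * e) * f = 0" .
  then have sk: "s * k = - 8 * e" using nonzero by (simp add: eq_neg_iff_add_eq_0)
  define v where "v = vec n (\<lambda>j. cst (1/8) * h j)"
  have v: "v \<in> carrier_vec n" by (simp add: v_def)
  have pull: "(\<Sum>j<n. v $ j * g j) = cst (1/8) * (\<Sum>j<n. h j * g j)" for g
    by (simp add: v_def sum_distrib_left algebra_simps)
  have c8: "cst (1/8) * (8 * q) = q" for q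
    using cst_mult[of "1/8" 8] by (simp add: cst_numeral cst_1 flip: mult.assoc)
  have e8: "cst (1/8) * (s * k) = - e"
    using c8[of e] unfolding sk by simp
  have "lin_map gens v = w"
  proof (rule eq_vecI)
    fix i assume "i < dim_vec w"
    then have "i < 3" using w3 by simp
    then consider "i = 0" | "i = 1" | "i = 2" by linarith
    then show "lin_map gens v $ i = w $ i"
    proof cases
      case 1
      have "lin_map gens v $ 0 = cst (1/8) * (8 * (s * p)) - cst (1/8) * (s * k) * varX"
        unfolding lin_map_gens(1)[OF v] pull h(1) k_def by (simp add: algebra_simps)
      then show ?thesis unfolding 1 c8 e8 sp by simp
    next
      case 2
      have "lin_map gens v $ 1 = cst (1/8) * (8 * r) - cst (1/8) * (s * k) * varY"
        unfolding lin_map_gens(2)[OF v] pull h(2) k_def by (simp add: algebra_simps)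
      then show ?thesis unfolding 2 c8 e8 r_def by simp
    next
      case 3
      have "lin_map gens v $ 2 = - (cst (1/8) * (8 * r)) - cst (1/8) * (s * k) * varZ"
        unfolding lin_map_gens(3)[OF v] pull h(2) k_def by (simp add: algebra_simps)
      then show ?thesis unfolding 3 c8 e8 r' by simp
    qed
  qed (use w3 in simp)
  with v show "w \<in> lin_map gens ` carrier_vec n" by blast
qed

lemma gens_kernel_iff:
  assumes v: "v \<in> carrier_vec n"
  shows "lin_map gens v = 0\<^sub>v 3 \<longleftrightarrow> (\<Sum>j<n. v $ j * P j) = 0 \<and> (\<Sum>j<n. v $ j * R j) = 0"
    (is "_ \<longleftrightarrow> ?p = 0 \<and> ?r = 0")
proof
  let ?k = "\<Sum>j<n. v $ j * \<kappa> j"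
  have s0: "s \<noteq> 0" using unit by auto
  {
    assume "lin_map gens v = 0\<^sub>v 3"
    then have 0: "8 * (s * ?p) - s * ?k * varX = 0" "8 * ?r - s * ?k * varY = 0" "- 8 * ?r - s * ?k * varZ = 0"
      using lin_map_gens[OF v] by simp_all
    have "s * ?k * (varY + varZ) = - ((8 * ?r - s * ?k * varY) + (- 8 * ?r - s * ?k * varZ))"
      by (simp add: algebra_simps)
    also have "\<dots> = 0" unfolding 0 by simp
    finally have "s * ?k * (varY + varZ) = 0" .
    moreover have "varY + varZ \<noteq> 0" by (simp add: varY_def varZ_def)
    ultimately have "?k = 0" using s0 by simp
    with 0 s0 show "?p = 0 \<and> ?r = 0" by simp
  }
  assume pr: "?p = 0 \<and> ?r = 0"
  have "s * ?k * f = der (s * ?p) ?r (- ?r) f" by (rule der_sum_basis[symmetric])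
  also have "\<dots> = 0" using pr by (simp add: der_def)
  finally have "?k = 0" using s0 nonzero by simp
  with pr show "lin_map gens v = 0\<^sub>v 3"
    using lin_map_gens[OF v] by (auto simp: Matrix.vec_eq_iff less_Suc_eq numeral_3_eq_3 numeral_2_eq_2)
qed

lemma homogeneous_gens:
  assumes "length ds = n" and s: "is_form 0 s"
    and forms: "\<And>j. j < n \<Longrightarrow> ds ! j > 0 \<and> is_form (ds ! j) (P j) \<and> is_form (ds ! j) (R j) \<and> is_form (ds ! j - 1) (\<kappa> j)"
  shows "homogeneous_matrix ds [0, 0, 0] gens"
proof -
  have 1: "is_form (ds ! j) (8 * (s * P j))" "is_form (ds ! j) (8 * R j)" "is_form (ds ! j) (- 8 * R j)" if "j < n" for j
    using forms[OF that] s by (auto intro!: is_form_numeral_mult is_form_mult'[OF s] is_form_uminus)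
  have 2: "is_form (ds ! j) (s * \<kappa> j * q)" if "j < n" "is_form 1 q" for j q
    using forms[OF that(1)] that(2)
    by (auto intro!: is_form_mult'[OF is_form_mult'[OF s] that(2)])
  show ?thesis
    unfolding homogeneous_matrix_def using assms(1)
    by (auto simp: gens_def less_Suc_eq intro!: is_form_diff 1 2 is_form_var)
qed

end

section \<open>Coordinates and divisibility\<close>

text \<open>The point \<open>pX = pW = 0\<close> is the quadruple point of the first arrangement, the point \<open>pX = pZ = 0\<close> that
  of the second one. In both cases the two lines of slopes \<open>\<plusminus> r\<close> are \<open>pW \<plusminus> 3 pX\<close> and \<open>pZ \<plusminus> 2 pX\<close>. The
  form \<open>pU\<close> is \<open>3 pZ\<close>, scaled so that \<open>pU = pV + 2 pW\<close>.\<close>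

definition pX :: polyS where "pX = lin 1 0 0"
definition pV :: polyS where "pV = lin 0 1 1"
definition pW :: polyS where "pW = lin 0 1 (- 5)"
definition pU :: polyS where "pU = lin 0 3 (- 9)"
definition pZ :: polyS where "pZ = lin 0 1 (- 3)"

lemmas coordinate_defs = pX_def pV_def pW_def pU_def pZ_def

text \<open>The conic, up to a numerical factor, in the coordinates for either arrangement.\<close>

definition conic1 :: polyS where "conic1 = 72 * pX^2 + 77 * pV * pW - 8 * pW^2"
definition conic2 :: polyS where "conic2 = 48 * pX^2 + 85 * pV * pZ - 12 * pZ^2 - 27 * pV^2"

lemma pU_eq: "pU = pV + 2 * pW"
  by (simp add: coordinate_defs lin_poly)

lemma conic1_eq: "conic1 = - 3 * conic"
  by (simp add: conic1_def conic_def coordinate_defs lin_poly power2_eq_square algebra_simps)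

lemma conic2_eq: "conic2 = - 2 * conic"
  by (simp add: conic2_def conic_def coordinate_defs lin_poly power2_eq_square algebra_simps)

lemma eval_coordinates [simp]:
  "eval pX (a, b, c) = a" "eval pV (a, b, c) = b + c" "eval pW (a, b, c) = b - 5 * c"
  "eval pU (a, b, c) = 3 * b - 9 * c" "eval pZ (a, b, c) = b - 3 * c"
  by (simp_all add: coordinate_defs eval_lin)

lemma der_coordinates [simp]:
  "der a b c pX = a" "der a b c pV = b + c" "der a b c pW = b - 5 * c"
  "der a b c pU = 3 * b - 9 * c" "der a b c pZ = b - 3 * c"
  by (simp_all add: coordinate_defs lin_poly)

lemma is_form_coordinates: "is_form 1 pX" "is_form 1 pV" "is_form 1 pW" "is_form 1 pU" "is_form 1 pZ"
  unfolding coordinate_defs by (rule is_form_lin)+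

lemma prime_coordinates: "prime_elem pX" "prime_elem pV" "prime_elem pU" "prime_elem pZ"
  "prime_elem (pX + pV)"
proof -
  have "pX + pV = lin 1 1 1" by (simp add: coordinate_defs lin_poly)
  then show "prime_elem (pX + pV)" by (simp add: prime_lin)
qed (simp_all add: coordinate_defs prime_lin lin_100 prime_varX)

lemma prime_conic_multiples: "prime_elem conic1" "prime_elem conic2"
proof -
  have "prime_elem conic" using prime_conic by (simp add: conic_def)
  then have prime: "prime_elem (cst k * conic)" if "k \<noteq> 0" for k
    using that by (simp add: prime_elem_mult_unit_left is_unit_cst)
  show "prime_elem conic1"
    using prime[of "- 3"] by (simp add: conic1_eq cst_uminus cst_numeral)
  show "prime_elem conic2"
    using prime[of "- 2"] by (simp add: conic2_eq cst_uminus cst_numeral)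
qed

lemma cancel_2: "2 * f = 2 * g \<Longrightarrow> f = (g :: polyS)"
  by simp

lemma not_dvd_by_point: "eval p v = 0 \<Longrightarrow> eval q v \<noteq> 0 \<Longrightarrow> \<not> p dvd q"
  using eval_zero_if_dvd by blast

lemma prime_dvd_cancel_left:
  fixes p :: polyS
  assumes "prime_elem p" "p dvd q * f" "eval p v = 0" "eval q v \<noteq> 0"
  shows "p dvd f"
  using assms not_dvd_by_point prime_elem_dvd_mult_iff by blast

text \<open>On the line \<open>L\<close> the form \<open>M\<close> vanishes at one point. If \<open>c\<close> does not vanish there, then \<open>M\<close> can be
  cancelled in a relation modulo \<open>c\<close> and \<open>L\<close>.\<close>

lemma cancel_on_line:
  assumes L: "L = lin a1 b1 c1" and M: "M = lin a2 b2 c2" and D: "b1 * c2 - b2 * c1 \<noteq> 0"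
    and p: "eval c (b1 * c2 - b2 * c1, c1 * a2 - c2 * a1, a1 * b2 - a2 * b1) \<noteq> 0"
    and prime: "prime_elem L" "\<not> L dvd M"
    and eq: "M * f = c * h + L * k"
  shows "\<exists>h k. f = c * h + L * k"
proof -
  have "c * h = L * (- k) + M * f" using eq by simp
  from cancel_mod_two_lines[OF L M D p this]
  obtain q r where h: "h = L * q + M * r" by blast
  have "M * (f - c * r) = L * (c * q + k)" using eq unfolding h by (simp add: algebra_simps)
  then have "L dvd M * (f - c * r)" by simp
  then have "L dvd f - c * r" using prime prime_elem_dvd_mult_iff by blast
  then obtain k' where "f - c * r = L * k'" by (elim dvdE)
  then have "f = c * r + L * k'" by (simp add: algebra_simps)
  then show ?thesis by blast
qed

lemma der_log_mult:
  "der a b c p = k * p \<Longrightarrow> der a b c q = l * q \<Longrightarrow> der a b c (p * q) = (k + l) * (p * q)"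
  by (simp add: algebra_simps)

lemmas form_intros = is_form_mult' is_form_power' is_form_add is_form_diff is_form_uminus
  is_form_coordinates is_form_numeral is_form_var is_form_0

section \<open>The logarithmic derivations of the first arrangement\<close>

lemma Q1_factored:
  "9 * Q1 = - (conic1 * (pW - 3 * pX) * (pW + 3 * pX) * pV * pU * pX * (pX + pV))"
proof -
  have l: "pW - 3 * pX = lin (- 3) 1 (- 5)" "pW + 3 * pX = lin 3 1 (- 5)" "pX + pV = lin 1 1 1"
    "pU = 3 * lin 0 1 (- 3)"
    by (simp_all add: coordinate_defs lin_poly)
  show ?thesis
    unfolding conic1_eq l unfolding pX_def pV_def prod_list_qs1[symmetric] qs1_def
    by (simp add: algebra_simps)
qed

text \<open>The hypotheses are the conditions for the components one by one: the logarithmic derivative of a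
  product is a sum. The component \<open>pV\<close> is killed.\<close>

lemma der_Q1:
  assumes "P = k1 * pX" "R - 3 * P = k2 * (pW - 3 * pX)" "R + 3 * P = k3 * (pW + 3 * pX)"
    "144 * pX * P + (77 * pV - 16 * pW) * R = k4 * conic1" "P = k5 * (pX + pV)" "2 * R = k6 * pU"
  shows "der (6 * P) R (- R) Q1 = 6 * (k1 + k2 + k3 + k4 + k5 + k6) * Q1"
proof -
  let ?D = "der (6 * P) R (- R)"
  have "?D conic1 = 6 * (144 * pX * P + (77 * pV - 16 * pW) * R)"
    by (simp add: conic1_def algebra_simps)
  then have c: "?D conic1 = 6 * k4 * conic1" unfolding assms(4) by (simp add: mult.assoc)
  have "?D (pW - 3 * pX) = 6 * (R - 3 * P)" by (simp add: algebra_simps)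
  then have l1: "?D (pW - 3 * pX) = 6 * k2 * (pW - 3 * pX)" using assms(2) by (simp add: mult.assoc)
  have "?D (pW + 3 * pX) = 6 * (R + 3 * P)" by (simp add: algebra_simps)
  then have l2: "?D (pW + 3 * pX) = 6 * k3 * (pW + 3 * pX)" using assms(3) by (simp add: mult.assoc)
  have v: "?D pV = 0 * pV" by simp
  have "?D pU = 6 * (2 * R)" by simp
  then have u: "?D pU = 6 * k6 * pU" using assms(6) by (simp add: mult.assoc)
  have x: "?D pX = 6 * k1 * pX" using assms(1) by simp
  have "?D (pX + pV) = 6 * P" by simp
  then have w: "?D (pX + pV) = 6 * k5 * (pX + pV)" using assms(5) by simp
  have "?D (9 * Q1) = - ?D (conic1 * (pW - 3 * pX) * (pW + 3 * pX) * pV * pU * pX * (pX + pV))"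
    unfolding Q1_factored by (rule der_uminus)
  also have "\<dots> = (6 * k4 + 6 * k2 + 6 * k3 + 0 + 6 * k6 + 6 * k1 + 6 * k5) * (9 * Q1)"
    unfolding Q1_factored
      der_log_mult[OF der_log_mult[OF der_log_mult[OF der_log_mult[OF der_log_mult[OF der_log_mult[OF c l1] l2] v] u] x] w]
    by (simp add: algebra_simps)
  finally have "9 * ?D Q1 = 9 * (6 * (k1 + k2 + k3 + k4 + k5 + k6) * Q1)"
    by (simp add: algebra_simps)
  then show ?thesis by simp
qed

text \<open>The forms \<open>qM\<close>, \<open>qN\<close> come from the solution \<open>48 p = pX (conic1 u + qM t)\<close>,
  \<open>48 r = pW conic1 u + qN t\<close> of the divisibility conditions for the components through the quadruple point
  (see \<open>generate1\<close>), and \<open>qP\<close> from the generator of highest degree.\<close>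

definition qP :: polyS where "qP = 36 * pX^4 + 77 * pX^2 * pV * pW + 69 * pX^2 * pW^2 + 9 * pW^4"
definition qM :: polyS where "qM = 16 * pW - 77 * pV"
definition qN :: polyS where "qN = 72 * pX^2 + 8 * pW^2 - 77 * pV * pW"

text \<open>Up to numerical factors these are the solutions with coordinates \<open>(u, t)\<close> equal to
  \<open>(pX + pV) (- (4 pX\<^sup>2 + 9 pW\<^sup>2), pW (4 pX\<^sup>2 - 9 pW\<^sup>2))\<close>, \<open>pU (pX + pV) (1, 0)\<close>,
  \<open>pU (qM, - conic1)\<close> and \<open>pU (pX + pV) (0, 1)\<close>.\<close>

definition P1 :: "polyS list" where
  "P1 = [(pX + pV) * pX * qP, pU * (pX + pV) * conic1 * pX, 0, pU * (pX + pV) * pX * qM]"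

definition R1 :: "polyS list" where
  "R1 = [77 * (pX + pV) * pX^2 * pW^2 * pU, pU * (pX + pV) * conic1 * pW,
     pU * conic1 * (pW^2 - 9 * pX^2), pU * (pX + pV) * qN]"

text \<open>The six summands of each entry are the multipliers of the six components that are not killed.\<close>

definition \<kappa>1 :: "polyS list" where
  "\<kappa>1 = [(pX + pV) * qP
       + (pX + pV) * pX * (77 * pX * pV * pW - 27 * pW^3 + 73 * pX * pW^2 + 12 * pX^2 * pW + 36 * pX^3)
       + (pX + pV) * pX * (77 * pX * pV * pW + 27 * pW^3 + 73 * pX * pW^2 - 12 * pX^2 * pW + 36 * pX^3)
       + (pX + pV) * pX^2 * (72 * pX^2 + 77 * pV * pW + 146 * pW^2) + pX * qP
       + 154 * (pX + pV) * pX^2 * pW^2,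
     pU * (pX + pV) * conic1 + pU * (pX + pV) * conic1 + pU * (pX + pV) * conic1
       + pU * (pX + pV) * (144 * pX^2 + 77 * pV * pW - 16 * pW^2)
       + pU * conic1 * pX + 2 * (pX + pV) * conic1 * pW,
     0 + pU * conic1 * (pW + 3 * pX) + pU * conic1 * (pW - 3 * pX)
       + (77 * pV - 16 * pW) * pU * (pW^2 - 9 * pX^2) + 0 + 2 * conic1 * (pW^2 - 9 * pX^2),
     pU * (pX + pV) * qM + pU * (pX + pV) * (8 * pW - 24 * pX - 77 * pV)
       + pU * (pX + pV) * (8 * pW + 24 * pX - 77 * pV)
       + pU * (pX + pV) * qM + pU * pX * qM + 2 * (pX + pV) * qN]"

lemma less_4_iff: "j < 4 \<longleftrightarrow> j = 0 \<or> j = 1 \<or> j = 2 \<or> j = (3 :: nat)"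
  by auto

lemmas nth_simps = nth_Cons_0 nth_Cons_Suc One_nat_def numeral_2_eq_2 numeral_3_eq_3

lemma basis1: "j < 4 \<Longrightarrow> der (6 * P1 ! j) (R1 ! j) (- (R1 ! j)) Q1 = 6 * \<kappa>1 ! j * Q1"
  unfolding less_4_iff
proof (elim disjE)
  note defs = P1_def R1_def \<kappa>1_def qP_def qM_def qN_def conic1_def pU_eq
  note ring = algebra_simps power2_eq_square power3_eq_cube power4_eq_xxxx
  show ?thesis if "j = 0"
    unfolding that by (simp only: \<kappa>1_def nth_simps, rule der_Q1) (simp_all add: defs ring)
  show ?thesis if "j = 1"
    unfolding that by (simp only: \<kappa>1_def nth_simps, rule der_Q1) (simp_all add: defs ring)
  show ?thesis if "j = 2"
    unfolding that by (simp only: \<kappa>1_def nth_simps, rule der_Q1) (simp_all add: defs ring)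
  show ?thesis if "j = 3"
    unfolding that by (simp only: \<kappa>1_def nth_simps, rule der_Q1) (simp_all add: defs ring)
qed

lemma forms1: "j < 4 \<Longrightarrow> is_form ([6, 5, 5, 4] ! j) (P1 ! j) \<and> is_form ([6, 5, 5, 4] ! j) (R1 ! j) \<and>
    is_form ([6, 5, 5, 4] ! j - 1) (\<kappa>1 ! j)"
proof -
  have q1: "is_form 4 qP" unfolding qP_def by (rule form_intros | rule refl | simp)+
  have q2: "is_form 1 qM" unfolding qM_def by (rule form_intros | rule refl | simp)+
  have q3: "is_form 2 qN" unfolding qN_def by (rule form_intros | rule refl | simp)+
  have q4: "is_form 2 conic1" unfolding conic1_def by (rule form_intros | rule refl | simp)+
  note q = q1 q2 q3 q4
  show "j < 4 \<Longrightarrow> ?thesis"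
    unfolding less_4_iff P1_def R1_def \<kappa>1_def
    by (elim disjE; simp only: nth_simps; intro conjI; (rule form_intros q | rule refl | simp)+)
qed

text \<open>The conditions for the four components through the quadruple point have a free module of solutions,
  with coordinates \<open>u\<close>, \<open>t\<close>. The other two lines impose a congruence each: \<open>conic1 u + qM t\<close> is
  divisible by \<open>pX + pV\<close>, and \<open>pW conic1 u + qN t\<close> by \<open>pU\<close>. The first one is solved by
  \<open>(qM, - conic1)\<close> and \<open>(pX + pV) (u1, t1)\<close>, because the line \<open>qM\<close> meets \<open>pX + pV\<close> off the conic. On the
  line \<open>pU\<close> the second one becomes a relation between forms in \<open>pX\<close> and \<open>pW\<close> only, with coefficients that
  have no common zero there.\<close>

lemma generate1:
  assumes X: "pX dvd p" and XV: "pX + pV dvd p"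
    and l1: "pW - 3 * pX dvd r - 3 * p" and l2: "pW + 3 * pX dvd r + 3 * p"
    and C: "conic1 dvd 144 * pX * p + (77 * pV - 16 * pW) * r" and U: "pU dvd r"
  shows "\<exists>h. p = (\<Sum>j<4. h j * P1 ! j) \<and> r = (\<Sum>j<4. h j * R1 ! j)"
proof -
  note ring = algebra_simps power2_eq_square
  obtain a where a: "r - 3 * p = (pW - 3 * pX) * a" using l1 by (elim dvdE)
  obtain b where b: "r + 3 * p = (pW + 3 * pX) * b" using l2 by (elim dvdE)
  have "pW * (b - a) = 6 * p - 3 * pX * (a + b)"
  proof -
    have "6 * p = (r + 3 * p) - (r - 3 * p)" by simp
    also have "\<dots> = (pW + 3 * pX) * b - (pW - 3 * pX) * a" unfolding a b ..
    finally show ?thesis by (simp add: ring)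
  qed
  moreover have "pX dvd 6 * p - 3 * pX * (a + b)" using X by (intro dvd_diff) auto
  ultimately have "pX dvd pW * (b - a)" by simp
  then have "pX dvd b - a"
    by (rule prime_dvd_cancel_left[OF prime_coordinates(1), of _ _ "(0, 1, 0)"]) simp_all
  then obtain t where "b - a = pX * t" by (elim dvdE)
  then have bt: "b = a + pX * t" by (simp add: algebra_simps)
  have r2: "2 * r = 2 * pW * a + (pW + 3 * pX) * pX * t"
  proof -
    have "2 * r = (r + 3 * p) + (r - 3 * p)" by simp
    then show ?thesis unfolding a b bt by (simp add: ring)
  qed
  have p6: "6 * p = pX * (pW * t + 6 * a + 3 * pX * t)"
  proof -
    have "6 * p = (r + 3 * p) - (r - 3 * p)" by simp
    then show ?thesis unfolding a b bt by (simp add: ring)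
  qed
  let ?y = "2 * pW * a + pX * (pW - 3 * pX) * t"
  have "2 * (144 * pX * p + (77 * pV - 16 * pW) * r) = 48 * pX * (6 * p) + (77 * pV - 16 * pW) * (2 * r)"
    by (simp add: ring)
  also have "\<dots> = conic1 * (4 * a + 2 * t * pX) - 77 * (pV * ?y)"
    unfolding p6 r2 conic1_def by (simp add: ring)
  finally have "77 * (pV * ?y) = conic1 * (4 * a + 2 * t * pX) - 2 * (144 * pX * p + (77 * pV - 16 * pW) * r)"
    by simp
  moreover have "conic1 dvd conic1 * (4 * a + 2 * t * pX) - 2 * (144 * pX * p + (77 * pV - 16 * pW) * r)"
    by (intro dvd_diff dvd_triv_left dvd_mult C)
  ultimately have "conic1 dvd 77 * (pV * ?y)" by simp
  then have "conic1 dvd pV * ?y" by simp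
  then have Cy: "conic1 dvd ?y"
    by (rule prime_dvd_cancel_left[OF prime_conic_multiples(1), of _ _ "(154, - 81, - 47)"])
      (simp_all add: conic1_def)
  let ?z = "48 * a + (24 * pX - 8 * pW + 77 * pV) * t"
  have "pW * ?z = 24 * ?y + conic1 * t"
    unfolding conic1_def by (simp add: ring)
  moreover have "conic1 dvd 24 * ?y + conic1 * t"
    by (intro dvd_add dvd_triv_left dvd_mult Cy)
  ultimately have "conic1 dvd pW * ?z" by simp
  then have "conic1 dvd ?z"
    by (rule prime_dvd_cancel_left[OF prime_conic_multiples(1), of _ _ "(154, - 81, - 47)"])
      (simp_all add: conic1_def)
  then obtain u where "?z = conic1 * u" by (elim dvdE)
  then have a48: "48 * a = conic1 * u - (24 * pX - 8 * pW + 77 * pV) * t" by (simp add: algebra_simps)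
  have p48: "48 * p = pX * (conic1 * u + qM * t)"
  proof -
    have "48 * p = 8 * (6 * p)" by simp
    also have "\<dots> = pX * (8 * pW * t + 48 * a + 24 * pX * t)" unfolding p6 by (simp add: ring)
    also have "\<dots> = pX * (conic1 * u + qM * t)" unfolding a48 qM_def by (simp add: ring)
    finally show ?thesis .
  qed
  have r48: "48 * r = pW * conic1 * u + qN * t"
  proof -
    have "2 * (48 * r) = 48 * (2 * r)" by simp
    also have "\<dots> = 2 * pW * (48 * a) + 48 * (pW + 3 * pX) * pX * t" unfolding r2 by (simp add: ring)
    also have "\<dots> = 2 * (pW * conic1 * u + qN * t)" unfolding a48 qN_def conic1_def by (simp add: ring)
    finally show ?thesis by (rule cancel_2)
  qed

  \<comment> \<open>the congruence on the line \<open>pX + pV\<close>\<close>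
  have "pX + pV dvd pX * (conic1 * u + qM * t)" unfolding p48[symmetric] using XV by simp
  then have "pX + pV dvd conic1 * u + qM * t"
    by (rule prime_dvd_cancel_left[OF prime_coordinates(5), of _ _ "(1, - 1, 0)"]) simp_all
  then obtain y1 where y1: "conic1 * u + qM * t = (pX + pV) * y1" by (elim dvdE)
  then have "qM * t = conic1 * (- u) + (pX + pV) * y1" by (simp add: algebra_simps)
  then have "\<exists>h k. t = conic1 * h + (pX + pV) * k"
  proof (rule cancel_on_line[rotated 6])
    show "pX + pV = lin 1 1 1" "qM = lin 0 (- 61) (- 157)"
      by (simp_all add: coordinate_defs qM_def lin_poly)
    show "\<not> pX + pV dvd qM" by (rule not_dvd_by_point[of _ "(1, - 1, 0)"]) (simp_all add: qM_def)
  qed (simp_all add: prime_coordinates conic1_def)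
  then obtain h1 t1 where t: "t = conic1 * h1 + (pX + pV) * t1" by blast
  have "conic1 * (u + qM * h1) = (pX + pV) * (y1 - qM * t1)"
    using y1 unfolding t by (simp add: algebra_simps)
  then have "pX + pV dvd conic1 * (u + qM * h1)" by simp
  then have "pX + pV dvd u + qM * h1"
    by (rule prime_dvd_cancel_left[OF prime_coordinates(5), of _ _ "(1, - 1, 0)"]) (simp_all add: conic1_def)
  then obtain u1 where "u + qM * h1 = (pX + pV) * u1" by (elim dvdE)
  then have u: "u = (pX + pV) * u1 - qM * h1" by (simp add: algebra_simps)
  define k where "k = - h1"
  have u: "u = qM * k + (pX + pV) * u1" and t: "t = (pX + pV) * t1 - conic1 * k"
    by (simp_all add: u t k_def)

  \<comment> \<open>the congruence on the line \<open>pU\<close>\<close>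
  have "pU dvd 48 * r" using U by simp
  then obtain y2 where y2: "pW * conic1 * u + qN * t = pU * y2" unfolding r48 by (elim dvdE)
  have "8 * conic1 * (pW^2 - 9 * pX^2) * k = (pX + pV) * (- (pW * conic1 * u1 + qN * t1)) + pU * y2"
    unfolding y2[symmetric] u t qM_def qN_def by (simp add: ring)
  then have "\<exists>q r. k = (pX + pV) * q + pU * r"
  proof (rule cancel_mod_two_lines[rotated 4])
    show "pX + pV = lin 1 1 1" by (simp add: coordinate_defs lin_poly)
    show "pU = lin 0 3 (- 9)" by (rule pU_def)
  qed (simp_all add: conic1_def)
  then obtain k1 k2 where k: "k = (pX + pV) * k1 + pU * k2" by blast
  \<comment> \<open>on the line \<open>pU\<close> one has \<open>pV = - 2 pW\<close>, which turns \<open>conic1\<close> and \<open>qN\<close> into \<open>18 ?c\<close> and \<open>18 ?s\<close>\<close>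
  let ?g = "8 * (pW^2 - 9 * pX^2) * k1 + pW * u1"
  let ?c = "4 * pX^2 - 9 * pW^2" and ?s = "4 * pX^2 + 9 * pW^2"
  have "(pX + pV) * (conic1 * ?g + qN * t1) = pU * (y2 - 8 * conic1 * (pW^2 - 9 * pX^2) * k2)"
    using y2 unfolding u t k qM_def qN_def by (simp add: ring)
  then have "pU dvd (pX + pV) * (conic1 * ?g + qN * t1)" by simp
  then have "pU dvd conic1 * ?g + qN * t1"
    by (rule prime_dvd_cancel_left[OF prime_coordinates(3), of _ _ "(1, 0, 0)"]) simp_all
  moreover have "conic1 * ?g + qN * t1 = 18 * (?c * ?g + ?s * t1) + pU * (77 * pW * (?g - t1))"
    unfolding conic1_def qN_def pU_eq by (simp add: ring)
  ultimately have "pU dvd 18 * (?c * ?g + ?s * t1)" by (simp add: dvd_add_left_iff)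
  then have "pU dvd ?c * ?g + ?s * t1" by (simp only: dvd_numeral_mult_iff)
  then obtain y3 where y3: "?c * ?g + ?s * t1 = pU * y3" by (elim dvdE)
  have l: "2 * pX - 3 * pW = lin 2 (- 3) 15" "2 * pX + 3 * pW = lin 2 3 (- 15)"
    by (simp_all add: coordinate_defs lin_poly)
  have "(2 * pX - 3 * pW) * ((2 * pX + 3 * pW) * ?g) = ?s * (- t1) + pU * y3"
    unfolding y3[symmetric] by (simp add: ring)
  then have "\<exists>h k. (2 * pX + 3 * pW) * ?g = ?s * h + pU * k"
  proof (rule cancel_on_line[rotated 6])
    show "pU = lin 0 3 (- 9)" "2 * pX - 3 * pW = lin 2 (- 3) 15" by (rule pU_def l)+
    show "\<not> pU dvd 2 * pX - 3 * pW" by (rule not_dvd_by_point[of _ "(1, 0, 0)"]) simp_all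
  qed (simp_all add: prime_coordinates)
  then obtain h2 k3 where "(2 * pX + 3 * pW) * ?g = ?s * h2 + pU * k3" by blast
  then have "\<exists>h k. ?g = ?s * h + pU * k"
  proof (rule cancel_on_line[rotated 6])
    show "pU = lin 0 3 (- 9)" "2 * pX + 3 * pW = lin 2 3 (- 15)" by (rule pU_def l)+
    show "\<not> pU dvd 2 * pX + 3 * pW" by (rule not_dvd_by_point[of _ "(1, 0, 0)"]) simp_all
  qed (simp_all add: prime_coordinates)
  then obtain h3 k4 where g: "?g = ?s * h3 + pU * k4" by blast
  have "?s * (?c * h3 + t1) = pU * (y3 - ?c * k4)"
    using y3 unfolding g by (simp add: algebra_simps)
  then have "pU dvd ?s * (?c * h3 + t1)" by simp
  then have "pU dvd ?c * h3 + t1"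
    by (rule prime_dvd_cancel_left[OF prime_coordinates(3), of _ _ "(1, 0, 0)"]) simp_all
  then obtain t2 where "?c * h3 + t1 = pU * t2" by (elim dvdE)
  then have t1: "t1 = pU * t2 - ?c * h3" by (simp add: algebra_simps)
  have "(4 * pX^2) * (- 18 * k1 - h3) = ?g - (8 * pW^2 * k1 + pW * u1) - 4 * pX^2 * h3"
    by (simp add: ring)
  then have "(4 * pX^2) * (- 18 * k1 - h3) = pW * (9 * pW * h3 - 8 * pW * k1 - u1) + pU * k4"
    unfolding g by (simp add: ring)
  then have "\<exists>q r. - 18 * k1 - h3 = pW * q + pU * r"
    by (rule cancel_mod_two_lines[OF pW_def pU_def, rotated 2]) simp_all
  then obtain q w where "- 18 * k1 - h3 = pW * q + pU * w" by blast
  then have h3: "h3 = - 18 * k1 - pW * q - pU * w" by (simp add: algebra_simps)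
  have "?g - 8 * pW^2 * k1 + 72 * pX^2 * k1 = pW * u1" by (simp add: ring)
  then have "pW * (u1 + 170 * pW * k1 + ?s * q) = pU * (k4 - ?s * w)"
    unfolding g h3 by (simp add: ring)
  then have "pU dvd pW * (u1 + 170 * pW * k1 + ?s * q)" by simp
  then have "pU dvd u1 + 170 * pW * k1 + ?s * q"
    by (rule prime_dvd_cancel_left[OF prime_coordinates(3), of _ _ "(0, 3, 1)"]) simp_all
  then obtain u3 where "u1 + 170 * pW * k1 + ?s * q = pU * u3" by (elim dvdE)
  then have u1: "u1 = pU * u3 - 170 * pW * k1 - ?s * q" by (simp add: algebra_simps)

  define A where "A = u3 - 77 * k1"
  define B where "B = t2 + ?c * w - 77 * pW * k1"
  have u': "u = pU * (pX + pV) * A - (pX + pV) * ?s * q + pU * qM * k2"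
    unfolding u k u1 A_def qM_def pU_eq by (simp add: ring)
  have t': "t = pU * (pX + pV) * B + (pX + pV) * ?c * pW * q - pU * conic1 * k2"
    unfolding t k t1 h3 B_def conic1_def pU_eq by (simp add: ring)
  have id1: "qM * (?c * pW) - conic1 * ?s = - 8 * qP"
    unfolding qM_def conic1_def qP_def by (simp add: ring power4_eq_xxxx)
  have id2: "qN * (?c * pW) - pW * conic1 * ?s = - 616 * pX^2 * pW^2 * pU"
    unfolding qN_def conic1_def pU_eq by (simp add: ring)
  have id3: "pW * conic1 * qM - qN * conic1 = 8 * conic1 * (pW^2 - 9 * pX^2)"
    unfolding qM_def qN_def by (simp add: ring)
  have cu: "conic1 * u + qM * t = pU * (pX + pV) * (conic1 * A + qM * B)
      + (pX + pV) * q * (qM * (?c * pW) - conic1 * ?s)"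
    unfolding u' t' by (simp add: algebra_simps)
  have p': "48 * p = (- 8 * q) * P1 ! 0 + A * P1 ! 1 + 8 * k2 * P1 ! 2 + B * P1 ! 3"
    unfolding p48 cu id1 by (simp add: P1_def algebra_simps)
  have wu: "pW * conic1 * u + qN * t = pU * (pX + pV) * (pW * conic1 * A + qN * B)
      + (pX + pV) * q * (qN * (?c * pW) - pW * conic1 * ?s) + pU * k2 * (pW * conic1 * qM - qN * conic1)"
    unfolding u' t' by (simp add: algebra_simps)
  have r': "48 * r = (- 8 * q) * R1 ! 0 + A * R1 ! 1 + 8 * k2 * R1 ! 2 + B * R1 ! 3"
    unfolding r48 wu id2 id3 by (simp add: R1_def algebra_simps)
  define h where "h j = cst (1/48) * [- 8 * q, A, 8 * k2, B] ! j" for j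
  have c48: "f = cst (1/48) * (48 * f)" for f
    using cst_mult[of "1/48" 48] by (simp add: cst_numeral cst_1 flip: mult.assoc)
  have "p = (\<Sum>j<4. h j * P1 ! j)"
    by (subst c48, unfold p') (simp add: h_def numeral_eq_Suc algebra_simps)
  moreover have "r = (\<Sum>j<4. h j * R1 ! j)"
    by (subst c48, unfold r') (simp add: h_def numeral_eq_Suc algebra_simps)
  ultimately show ?thesis by blast
qed

lemma sum_less_4: "(\<Sum>j<4. g j) = g 0 + g 1 + g 2 + g (3 :: nat)"
  by (simp add: numeral_eq_Suc)

lemma sum_less_3: "(\<Sum>j<3. g j) = g 0 + g 1 + g (2 :: nat)"
  by (simp add: numeral_eq_Suc)

lemma sum_less_2: "(\<Sum>j<2. g j) = g 0 + g (1 :: nat)"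
  by (simp add: numeral_eq_Suc)

lemma der_lin: "der a b c (lin k l m) = cst k * a + cst l * b + cst m * c"
  by (simp add: lin_def)

lemma euler_lin: "der varX varY varZ (lin k l m) = 1 * lin k l m"
  by (simp add: der_lin) (simp add: lin_def)

lemma euler_conic: "der varX varY varZ conic = 2 * conic"
  by (simp add: conic_def power2_eq_square algebra_simps)

lemma der_1_log: "der a b c 1 = 0 * 1"
  by simp

lemma euler_Q1: "der varX varY varZ Q1 = 8 * Q1"
proof -
  have "der varX varY varZ Q1 = (2 + (1 + (1 + (1 + (1 + (1 + (1 + 0))))))) * Q1"
    unfolding prod_list_qs1[symmetric] qs1_def prod_list.Cons prod_list.Nil
    by (intro der_log_mult euler_lin euler_conic der_1_log)
  then show ?thesis by simp
qed

lemma euler_Q2: "der varX varY varZ Q2 = 8 * Q2"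
proof -
  have "der varX varY varZ Q2 = (2 + (1 + (1 + (1 + (1 + (1 + (1 + 0))))))) * Q2"
    unfolding prod_list_qs2[symmetric] qs2_def prod_list.Cons prod_list.Nil
    by (intro der_log_mult euler_lin euler_conic der_1_log)
  then show ?thesis by simp
qed

lemma conic1_dvd_iff: "conic1 dvd f \<longleftrightarrow> conic dvd f"
proof -
  have eq: "conic1 = cst (- 3) * conic" by (simp add: conic1_eq cst_uminus cst_numeral)
  show ?thesis unfolding eq by (rule mult_unit_dvd_iff') (simp add: is_unit_cst)
qed

lemma conic2_dvd_iff: "conic2 dvd f \<longleftrightarrow> conic dvd f"
proof -
  have eq: "conic2 = cst (- 2) * conic" by (simp add: conic2_eq cst_uminus cst_numeral)
  show ?thesis unfolding eq by (rule mult_unit_dvd_iff') (simp add: is_unit_cst)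
qed

lemma pU_dvd_iff: "pU dvd f \<longleftrightarrow> lin 0 1 (- 3) dvd f"
proof -
  have eq: "pU = 3 * lin 0 1 (- 3)" by (simp add: coordinate_defs lin_poly)
  show ?thesis unfolding eq by (rule mult_unit_dvd_iff'[OF numeral_unit])
qed

lemma dvd_factor1:
  assumes "Q1 dvd der (6 * p) r (- r) Q1"
  shows "pX dvd p" "pX + pV dvd p" "pW - 3 * pX dvd r - 3 * p" "pW + 3 * pX dvd r + 3 * p"
    "conic1 dvd 144 * pX * p + (77 * pV - 16 * pW) * r" "pU dvd r"
proof -
  have dvd: "qs1 ! i dvd der (6 * p) r (- r) (qs1 ! i)" if "i < 7" for i
    using arr1.factor_dvd_der[unfolded arr1_Q, OF assms, of i] that by (simp add: qs1_def)
  have "lin 1 0 0 dvd 6 * p" using dvd[of 5] by (simp add: qs1_def der_lin lin_poly)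
  then show "pX dvd p" by (simp add: pX_def)
  have "pX + pV = lin 1 1 1" by (simp add: coordinate_defs lin_poly)
  moreover have "lin 1 1 1 dvd 6 * p" using dvd[of 6] by (simp add: qs1_def der_lin lin_poly)
  ultimately show "pX + pV dvd p" by simp
  have "pW - 3 * pX = lin (- 3) 1 (- 5)" by (simp add: coordinate_defs lin_poly)
  moreover have "lin (- 3) 1 (- 5) dvd 6 * (r - 3 * p)"
    using dvd[of 1] by (simp add: qs1_def der_lin cst_uminus cst_numeral cst_1 algebra_simps)
  ultimately show "pW - 3 * pX dvd r - 3 * p" by (simp only: dvd_numeral_mult_iff)
  have "pW + 3 * pX = lin 3 1 (- 5)" by (simp add: coordinate_defs lin_poly)
  moreover have "lin 3 1 (- 5) dvd 6 * (r + 3 * p)"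
    using dvd[of 2] by (simp add: qs1_def der_lin cst_uminus cst_numeral cst_1 algebra_simps)
  ultimately show "pW + 3 * pX dvd r + 3 * p" by (simp only: dvd_numeral_mult_iff)
  have "lin 0 1 (- 3) dvd 4 * r"
    using dvd[of 4] by (simp add: qs1_def der_lin cst_uminus cst_numeral cst_1 cst_0)
  then show "pU dvd r" by (simp add: pU_dvd_iff)
  have "conic dvd der (6 * p) r (- r) conic" using dvd[of 0] by (simp add: qs1_def)
  then have "conic dvd der (6 * p) r (- r) conic1" unfolding conic1_eq by simp
  also have "der (6 * p) r (- r) conic1 = 6 * (144 * pX * p + (77 * pV - 16 * pW) * r)"
    by (simp add: conic1_def algebra_simps)
  finally show "conic1 dvd 144 * pX * p + (77 * pV - 16 * pW) * r"
    by (simp only: conic1_dvd_iff dvd_numeral_mult_iff)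
qed

interpretation log1: log_basis Q1 6 4 "\<lambda>j. P1 ! j" "\<lambda>j. R1 ! j" "\<lambda>j. \<kappa>1 ! j"
proof
  show "Q1 \<noteq> 0" using arr1.Q_nonzero by (simp add: arr1_Q)
  show "(6 :: polyS) dvd 1" by (rule numeral_unit)
  show "der varX varY varZ Q1 = 8 * Q1" by (rule euler_Q1)
  show "varY + varZ dvd b + c" if "Q1 dvd der a b c Q1" for a b c
  proof -
    have "qs1 ! 3 dvd der a b c (qs1 ! 3)"
      using arr1.factor_dvd_der[unfolded arr1_Q, OF that, of 3] by (simp add: qs1_def)
    then show ?thesis by (simp add: qs1_def der_lin lin_poly)
  qed
  show "der (6 * P1 ! j) (R1 ! j) (- R1 ! j) Q1 = 6 * \<kappa>1 ! j * Q1" if "j < 4" for j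
    by (rule basis1[OF that])
  show "\<exists>h. p = (\<Sum>j<4. h j * P1 ! j) \<and> r = (\<Sum>j<4. h j * R1 ! j)"
    if "Q1 dvd der (6 * p) r (- r) Q1" for p r
    by (rule generate1[OF dvd_factor1[OF that]])
qed

text \<open>In the coordinates \<open>(u, t)\<close> the second and the fourth generator are multiples of the unit vectors. A
  multiple of the first one by \<open>pU\<close>, and of the third one by \<open>pX + pV\<close>, is a combination of these two.\<close>

definition syz1 :: "polyS list list" where
  "syz1 = [[8 * pU, 0], [- (4 * pX^2 + 9 * pW^2), qM], [0, - 8 * (pX + pV)],
     [pW * (4 * pX^2 - 9 * pW^2), - conic1]]"

lemma lin_map_syz1:
  assumes "w \<in> carrier_vec 2"
  shows "lin_map syz1 w $ 0 = 8 * pU * w $ 0"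
    "lin_map syz1 w $ 1 = - (4 * pX^2 + 9 * pW^2) * w $ 0 + qM * w $ 1"
    "lin_map syz1 w $ 2 = - 8 * (pX + pV) * w $ 1"
    "lin_map syz1 w $ 3 = pW * (4 * pX^2 - 9 * pW^2) * w $ 0 - conic1 * w $ 1"
proof -
  have "lin_map syz1 w $ i = syz1 ! i ! 0 * w $ 0 + syz1 ! i ! 1 * w $ 1" if "i < 4" for i
  proof -
    have "i < length syz1" using that by (simp add: syz1_def)
    then show ?thesis using assms by (simp only: lin_map_index carrier_vecD sum_less_2)
  qed
  note row = this
  show "lin_map syz1 w $ 0 = 8 * pU * w $ 0" using row[of 0] by (simp add: syz1_def)
  show "lin_map syz1 w $ 1 = - (4 * pX^2 + 9 * pW^2) * w $ 0 + qM * w $ 1"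
    using row[of 1] by (simp add: syz1_def)
  show "lin_map syz1 w $ 2 = - 8 * (pX + pV) * w $ 1" using row[of 2] by (simp add: syz1_def)
  show "lin_map syz1 w $ 3 = pW * (4 * pX^2 - 9 * pW^2) * w $ 0 - conic1 * w $ 1"
    using row[of 3] by (simp add: syz1_def)
qed

lemma nonzero_by_point: "eval p v \<noteq> 0 \<Longrightarrow> p \<noteq> 0"
  by auto

lemma syzygy_identities:
  "qM * (pW * (4 * pX^2 - 9 * pW^2)) - conic1 * (4 * pX^2 + 9 * pW^2) = - 8 * qP"
  "qN * (pW * (4 * pX^2 - 9 * pW^2)) - pW * conic1 * (4 * pX^2 + 9 * pW^2) = - 616 * pX^2 * pW^2 * pU"
  "pW * qM - qN = 8 * (pW^2 - 9 * pX^2)"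
  by (simp_all add: qM_def qN_def qP_def conic1_def pU_eq algebra_simps power2_eq_square power4_eq_xxxx)

text \<open>A relation forces \<open>pU\<close> to divide the first coefficient and \<open>pX + pV\<close> the third one. After subtraction of
  the corresponding multiples of the two columns, a relation between the two generators along the unit
  vectors remains, and it is trivial because \<open>pW qM - qN\<close> is not \<open>0\<close>.\<close>

lemma exact1: "lin_map syz1 ` free_module [7, 6] = {v \<in> free_module [6, 5, 5, 4]. lin_map log1.gens v = 0\<^sub>v 3}"
proof (intro equalityI subsetI)
  let ?s = "4 * pX^2 + 9 * pW^2" and ?c = "pW * (4 * pX^2 - 9 * pW^2)"
  fix v assume "v \<in> lin_map syz1 ` free_module [7, 6]"
  then obtain w where w: "w \<in> carrier_vec 2" and vw: "v = lin_map syz1 w"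
    by (auto simp: numeral_2_eq_2)
  have v: "v \<in> carrier_vec 4" using lin_map_carrier[of syz1 w] by (simp add: vw syz1_def numeral_eq_Suc)
  note v_i = lin_map_syz1[OF w, folded vw]
  have "(\<Sum>j<4. v $ j * P1 ! j) = pU * (pX + pV) * pX *
      (w $ 0 * (8 * qP + (qM * ?c - conic1 * ?s)) + w $ 1 * (conic1 * qM - qM * conic1))"
    unfolding sum_less_4 v_i by (simp add: P1_def algebra_simps)
  also have "\<dots> = 0" unfolding syzygy_identities by simp
  finally have P: "(\<Sum>j<4. v $ j * P1 ! j) = 0" .
  have "(\<Sum>j<4. v $ j * R1 ! j) = pU * (pX + pV) *
      (w $ 0 * (616 * pX^2 * pW^2 * pU + (qN * ?c - pW * conic1 * ?s))
        + w $ 1 * conic1 * ((pW * qM - qN) - 8 * (pW^2 - 9 * pX^2)))"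
    unfolding sum_less_4 v_i by (simp add: R1_def algebra_simps)
  also have "\<dots> = 0" unfolding syzygy_identities by simp
  finally have "(\<Sum>j<4. v $ j * R1 ! j) = 0" .
  with P v show "v \<in> {v \<in> free_module [6, 5, 5, 4]. lin_map log1.gens v = 0\<^sub>v 3}"
    using log1.gens_kernel_iff[OF v] by (simp add: numeral_eq_Suc)
next
  let ?s = "4 * pX^2 + 9 * pW^2" and ?c = "pW * (4 * pX^2 - 9 * pW^2)"
  fix v assume "v \<in> {v \<in> free_module [6, 5, 5, 4]. lin_map log1.gens v = 0\<^sub>v 3}"
  then have v: "v \<in> carrier_vec 4" and "lin_map log1.gens v = 0\<^sub>v 3" by (simp_all add: numeral_eq_Suc)
  then have PR: "(\<Sum>j<4. v $ j * P1 ! j) = 0" "(\<Sum>j<4. v $ j * R1 ! j) = 0"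
    using log1.gens_kernel_iff[OF v] by simp_all
  define h0 h1 h2 h3 where h: "h0 = v $ 0" "h1 = v $ 1" "h2 = v $ 2" "h3 = v $ 3"
  have nz: "pX \<noteq> 0" "pU \<noteq> 0" "pX + pV \<noteq> 0" "conic1 \<noteq> 0"
    using prime_coordinates prime_conic_multiples by (auto simp: prime_elem_def)
  have "(pX + pV) * pX * (h0 * qP + pU * (conic1 * h1 + qM * h3)) = 0"
    using PR(1) unfolding sum_less_4 by (simp add: P1_def h algebra_simps)
  then have i: "h0 * qP + pU * (conic1 * h1 + qM * h3) = 0" using nz by simp
  have "pU * ((pX + pV) * (77 * pX^2 * pW^2 * h0 + conic1 * pW * h1 + qN * h3)
      + conic1 * (pW^2 - 9 * pX^2) * h2) = 0"
    using PR(2) unfolding sum_less_4 by (simp add: R1_def h algebra_simps)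
  then have ii: "(pX + pV) * (77 * pX^2 * pW^2 * h0 + conic1 * pW * h1 + qN * h3)
      + conic1 * (pW^2 - 9 * pX^2) * h2 = 0" using nz by simp
  have "qP * h0 = pU * (- (conic1 * h1 + qM * h3))" using i by (simp add: algebra_simps eq_neg_iff_add_eq_0)
  then have "pU dvd qP * h0" by simp
  then have "pU dvd h0"
    by (rule prime_dvd_cancel_left[OF prime_coordinates(3), of _ _ "(1, 0, 0)"]) (simp_all add: qP_def)
  then obtain l where l: "h0 = pU * l" by (elim dvdE)
  have "conic1 * (pW^2 - 9 * pX^2) * h2 = (pX + pV) * (- (77 * pX^2 * pW^2 * h0 + conic1 * pW * h1 + qN * h3))"
    using ii by (simp add: algebra_simps eq_neg_iff_add_eq_0)
  then have "pX + pV dvd conic1 * (pW^2 - 9 * pX^2) * h2" by simp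
  then have "pX + pV dvd h2"
    by (rule prime_dvd_cancel_left[OF prime_coordinates(5), of _ _ "(1, - 1, 0)"]) (simp_all add: conic1_def)
  then obtain e where e: "h2 = (pX + pV) * e" by (elim dvdE)
  have "pU * (l * qP + (conic1 * h1 + qM * h3)) = 0" using i unfolding l by (simp add: algebra_simps)
  then have i': "l * qP + conic1 * h1 + qM * h3 = 0" using nz by (simp add: add.assoc)
  have "(pX + pV) * (77 * pX^2 * pW^2 * h0 + conic1 * pW * h1 + qN * h3 + conic1 * (pW^2 - 9 * pX^2) * e) = 0"
    using ii unfolding e by (simp add: algebra_simps)
  then have ii': "77 * pX^2 * pW^2 * h0 + conic1 * pW * h1 + qN * h3 + conic1 * (pW^2 - 9 * pX^2) * e = 0"
    using nz by simp
  have c8: "8 * (cst (1/8) * q) = q" for q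
    using cst_mult[of 8 "1/8"] by (simp add: cst_numeral cst_1 flip: mult.assoc)
  define a where "a = cst (1/8) * l"
  define k where "k = cst (- 1/8) * e"
  have la: "l = 8 * a" by (simp add: a_def c8)
  have ek: "e = - 8 * k" using c8[of e] by (simp add: k_def cst_uminus)
  define x where "x = h1 + ?s * a - qM * k"
  define y where "y = h3 - ?c * a + conic1 * k"
  have "conic1 * x + qM * y = (l * qP + conic1 * h1 + qM * h3) - a * (8 * qP + (qM * ?c - conic1 * ?s))"
    unfolding x_def y_def la by (simp add: algebra_simps)
  then have xy1: "conic1 * x + qM * y = 0" unfolding i' syzygy_identities by simp
  have "pW * conic1 * x + qN * y = (77 * pX^2 * pW^2 * h0 + conic1 * pW * h1 + qN * h3 + conic1 * (pW^2 - 9 * pX^2) * e)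
      - a * (616 * pX^2 * pW^2 * pU + (qN * ?c - pW * conic1 * ?s))
      - k * conic1 * ((pW * qM - qN) - 8 * (pW^2 - 9 * pX^2))"
    unfolding x_def y_def l la ek by (simp add: algebra_simps)
  then have xy2: "pW * conic1 * x + qN * y = 0" unfolding ii' syzygy_identities by simp
  have "(pW * qM - qN) * y = pW * (conic1 * x + qM * y) - (pW * conic1 * x + qN * y)"
    by (simp add: algebra_simps)
  then have "8 * (pW^2 - 9 * pX^2) * y = 0" unfolding xy1 xy2 syzygy_identities by simp
  moreover have "pW^2 - 9 * pX^2 \<noteq> 0" by (rule nonzero_by_point[of _ "(1, 0, 0)"]) simp
  ultimately have y: "y = 0" by simp
  then have x: "x = 0" using xy1 nz by simp
  have h1: "h1 = - ?s * a + qM * k" using x unfolding x_def by (simp add: algebra_simps)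
  have h3: "h3 = ?c * a - conic1 * k" using y unfolding y_def by (simp add: algebra_simps)
  define w where "w = vec 2 (\<lambda>i. if i = 0 then a else k)"
  have w: "w \<in> carrier_vec 2" "w $ 0 = a" "w $ 1 = k" by (simp_all add: w_def)
  have "lin_map syz1 w = v"
  proof (rule eq_vecI)
    fix i assume "i < dim_vec v"
    then have "i < 4" using v by simp
    then consider "i = 0" | "i = 1" | "i = 2" | "i = 3" by linarith
    then show "lin_map syz1 w $ i = v $ i"
    proof cases
      case 1 then show ?thesis using lin_map_syz1(1)[OF w(1)] h l la w by (simp add: algebra_simps)
    next
      case 2 then show ?thesis using lin_map_syz1(2)[OF w(1)] h1 by (simp only: w h)
    next
      case 3 then show ?thesis using lin_map_syz1(3)[OF w(1)] h e ek w by (simp add: algebra_simps)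
    next
      case 4 then show ?thesis using lin_map_syz1(4)[OF w(1)] h3 by (simp only: w h)
    qed
  qed (use v in \<open>simp add: syz1_def\<close>)
  then show "v \<in> lin_map syz1 ` free_module [7, 6]" using w(1) by (auto simp: numeral_2_eq_2)
qed

lemma resolution1: "min_graded_free_res (AR Q1) [[6, 5, 5, 4], [7, 6]]"
proof (rule min_graded_free_resI)
  show "homogeneous_matrix [6, 5, 5, 4] [0, 0, 0] log1.gens"
    by (rule log1.homogeneous_gens[OF _ is_form_numeral]) (use forms1 in \<open>auto simp: less_4_iff\<close>)
  have 1: "is_form 1 (8 * pU)" by (rule form_intros | rule refl | simp)+
  have 2: "is_form 2 (- (4 * pX^2 + 9 * pW^2))" by (rule form_intros | rule refl | simp)+
  have 3: "is_form 1 qM" unfolding qM_def by (rule form_intros | rule refl | simp)+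
  have 4: "is_form 1 (- 8 * (pX + pV))" by (rule form_intros | rule refl | simp)+
  have 5: "is_form 3 (pW * (4 * pX^2 - 9 * pW^2))" by (rule form_intros | rule refl | simp)+
  have 6: "is_form 2 (- conic1)" unfolding conic1_def by (rule form_intros | rule refl | simp)+
  from 1 2 3 4 5 6 show "homogeneous_matrix [7, 6] [6, 5, 5, 4] syz1"
    by (simp add: homogeneous_matrix_def All_less_Suc syz1_def)
  show "lin_map log1.gens ` free_module [6, 5, 5, 4] = AR Q1"
    using log1.AR_image by (simp add: numeral_eq_Suc)
  show "lin_map syz1 ` free_module [7, 6] = {v \<in> free_module [6, 5, 5, 4]. lin_map log1.gens v = 0\<^sub>v 3}"
    by (rule exact1)
  have "\<forall>i < length [6, 5, 5, 4 :: nat]. \<forall>j < length [7, 6 :: nat]. mono_coeff (syz1 ! i ! j) 0 0 0 = 0"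
    by (simp add: All_less_Suc syz1_def mono_coeff_000 qM_def conic1_def)
  then show "mono_coeff (syz1 ! i ! j) 0 0 0 = 0"
    if "i < length [6, 5, 5, 4 :: nat]" "j < length [7, 6 :: nat]" for i j using that by blast
  fix w :: "polyS vec"
  assume "w \<in> free_module [7, 6]" and 0: "lin_map syz1 w = 0\<^sub>v (length [6, 5, 5, 4 :: nat])"
  then have w: "w \<in> carrier_vec 2" by (simp add: numeral_2_eq_2)
  have "8 * pU * w $ 0 = 0" "- 8 * (pX + pV) * w $ 1 = 0"
    unfolding lin_map_syz1[OF w, symmetric] 0 by simp_all
  moreover have "pU \<noteq> 0" "pX + pV \<noteq> 0" using prime_coordinates by (auto simp: prime_elem_def)
  moreover from this have "- pX \<noteq> pV" by (simp add: neg_eq_iff_add_eq_0)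
  ultimately have "w $ 0 = 0" "w $ 1 = 0" by simp_all
  then show "w = 0\<^sub>v (length [7, 6 :: nat])"
    using w by (auto simp: Matrix.vec_eq_iff less_Suc_eq numeral_2_eq_2)
qed

section \<open>The logarithmic derivations of the second arrangement\<close>

lemma Q2_factored:
  "2 * Q2 = - (conic2 * (pZ - 2 * pX) * (pZ + 2 * pX) * pV * pZ * pX * (pX + pV))"
proof -
  have l: "pZ - 2 * pX = lin (- 2) 1 (- 3)" "pZ + 2 * pX = lin 2 1 (- 3)" "pX + pV = lin 1 1 1"
    by (simp_all add: coordinate_defs lin_poly)
  show ?thesis
    unfolding conic2_eq l unfolding pX_def pV_def pZ_def prod_list_qs2[symmetric] qs2_def
    by (simp add: algebra_simps)
qed

lemma der_Q2:
  assumes "P = k1 * pX" "R - 2 * P = k2 * (pZ - 2 * pX)" "R + 2 * P = k3 * (pZ + 2 * pX)"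
    "96 * pX * P + (85 * pV - 24 * pZ) * R = k4 * conic2" "P = k5 * (pX + pV)" "R = k6 * pZ"
  shows "der (4 * P) R (- R) Q2 = 4 * (k1 + k2 + k3 + k4 + k5 + k6) * Q2"
proof -
  let ?D = "der (4 * P) R (- R)"
  have "?D conic2 = 4 * (96 * pX * P + (85 * pV - 24 * pZ) * R)"
    by (simp add: conic2_def algebra_simps)
  then have c: "?D conic2 = 4 * k4 * conic2" unfolding assms(4) by (simp add: mult.assoc)
  have "?D (pZ - 2 * pX) = 4 * (R - 2 * P)" by (simp add: algebra_simps)
  then have l1: "?D (pZ - 2 * pX) = 4 * k2 * (pZ - 2 * pX)" using assms(2) by (simp add: mult.assoc)
  have "?D (pZ + 2 * pX) = 4 * (R + 2 * P)" by (simp add: algebra_simps)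
  then have l2: "?D (pZ + 2 * pX) = 4 * k3 * (pZ + 2 * pX)" using assms(3) by (simp add: mult.assoc)
  have v: "?D pV = 0 * pV" by simp
  have z: "?D pZ = 4 * k6 * pZ" using assms(6) by simp
  have x: "?D pX = 4 * k1 * pX" using assms(1) by simp
  have "?D (pX + pV) = 4 * P" by simp
  then have w: "?D (pX + pV) = 4 * k5 * (pX + pV)" using assms(5) by simp
  have "?D (2 * Q2) = - ?D (conic2 * (pZ - 2 * pX) * (pZ + 2 * pX) * pV * pZ * pX * (pX + pV))"
    unfolding Q2_factored by (rule der_uminus)
  also have "\<dots> = (4 * k4 + 4 * k2 + 4 * k3 + 0 + 4 * k6 + 4 * k1 + 4 * k5) * (2 * Q2)"
    unfolding Q2_factored
      der_log_mult[OF der_log_mult[OF der_log_mult[OF der_log_mult[OF der_log_mult[OF der_log_mult[OF c l1] l2] v] z] x] w]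
    by (simp add: algebra_simps)
  finally have "2 * ?D Q2 = 2 * (4 * (k1 + k2 + k3 + k4 + k5 + k6) * Q2)"
    by (simp add: algebra_simps)
  then show ?thesis by simp
qed

text \<open>The forms in the congruence \<open>12 (pX + pV) qL e + qB g = 0\<close> modulo the conic, see \<open>generate2\<close>.\<close>

definition qL :: polyS where "qL = 54 * pV - 85 * pZ"
definition qB :: polyS where "qB = pZ * ((85 * pZ - 27 * pV) * (85 * pV - 24 * pZ))"

text \<open>The coordinates \<open>(e, g)\<close> of these solutions are \<open>(qB, - 12 (pX + pV) qL)\<close>, \<open>(0, conic2)\<close> and
  \<open>(conic2, 0)\<close>.\<close>

definition P2 :: "polyS list" where
  "P2 = [pX * (pX + pV) * qB, 0, pX * (pX + pV) * conic2]"

definition R2 :: "polyS list" where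
  "R2 = [pZ * (pX + pV) * (qB - 12 * (pZ^2 - 4 * pX^2) * qL),
     pZ * (pZ^2 - 4 * pX^2) * conic2, pZ * (pX + pV) * conic2]"

definition \<kappa>2 :: "polyS list" where
  "\<kappa>2 = [(pX + pV) * qB + (pX + pV) * (qB - 12 * pZ * (pZ + 2 * pX) * qL)
       + (pX + pV) * (qB - 12 * pZ * (pZ - 2 * pX) * qL)
       + (pX + pV) * (2 * qB + pZ * (85 * pV - 24 * pZ) * qL) + pX * qB
       + (pX + pV) * (qB - 12 * (pZ^2 - 4 * pX^2) * qL),
     0 + pZ * (pZ + 2 * pX) * conic2 + pZ * (pZ - 2 * pX) * conic2
       + (85 * pV - 24 * pZ) * pZ * (pZ^2 - 4 * pX^2) + 0 + (pZ^2 - 4 * pX^2) * conic2,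
     (pX + pV) * conic2 + (pX + pV) * conic2 + (pX + pV) * conic2
       + (pX + pV) * (96 * pX^2 + 85 * pV * pZ - 24 * pZ^2) + pX * conic2 + (pX + pV) * conic2]"

lemma less_3_iff: "j < 3 \<longleftrightarrow> j = 0 \<or> j = 1 \<or> j = (2 :: nat)"
  by auto

lemma basis2: "j < 3 \<Longrightarrow> der (4 * P2 ! j) (R2 ! j) (- (R2 ! j)) Q2 = 4 * \<kappa>2 ! j * Q2"
  unfolding less_3_iff
proof (elim disjE)
  note defs = P2_def R2_def \<kappa>2_def qL_def qB_def conic2_def
  note ring = algebra_simps power2_eq_square
  show ?thesis if "j = 0"
    unfolding that by (simp only: \<kappa>2_def nth_simps, rule der_Q2) (simp_all add: defs ring)
  show ?thesis if "j = 1"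
    unfolding that by (simp only: \<kappa>2_def nth_simps, rule der_Q2) (simp_all add: defs ring)
  show ?thesis if "j = 2"
    unfolding that by (simp only: \<kappa>2_def nth_simps, rule der_Q2) (simp_all add: defs ring)
qed

lemma forms2: "j < 3 \<Longrightarrow> is_form ([5, 5, 4] ! j) (P2 ! j) \<and> is_form ([5, 5, 4] ! j) (R2 ! j) \<and>
    is_form ([5, 5, 4] ! j - 1) (\<kappa>2 ! j)"
proof -
  have q1: "is_form 1 qL" unfolding qL_def by (rule form_intros | rule refl | simp)+
  have q2: "is_form 3 qB" unfolding qB_def by (rule form_intros | rule refl | simp)+
  have q3: "is_form 2 conic2" unfolding conic2_def by (rule form_intros | rule refl | simp)+
  note q = q1 q2 q3
  show "j < 3 \<Longrightarrow> ?thesis"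
    unfolding less_3_iff P2_def R2_def \<kappa>2_def
    by (elim disjE; simp only: nth_simps; intro conjI; (rule form_intros q | rule refl | simp)+)
qed

text \<open>The three points at which \<open>conic2\<close> is evaluated are the intersections of \<open>L\<close> with the linear factors
  of \<open>qB\<close>.\<close>

lemma cancel_qB:
  assumes L: "L = lin a1 b1 c1" and prime: "prime_elem L"
    and D: "b1 * (- 3) - c1 \<noteq> 0" "b1 * (- 282) - 58 * c1 \<noteq> 0" "b1 * 157 - 61 * c1 \<noteq> 0"
    and p: "eval conic2 (b1 * (- 3) - c1, 3 * a1, a1) \<noteq> 0"
      "eval conic2 (b1 * (- 282) - 58 * c1, 282 * a1, 58 * a1) \<noteq> 0"
      "eval conic2 (b1 * 157 - 61 * c1, - 157 * a1, 61 * a1) \<noteq> 0"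
    and v: "eval L v = 0" "eval qB v \<noteq> 0"
    and eq: "qB * f = conic2 * h + L * k"
  shows "\<exists>h k. f = conic2 * h + L * k"
proof -
  have lins: "pZ = lin 0 1 (- 3)" "85 * pZ - 27 * pV = lin 0 58 (- 282)" "85 * pV - 24 * pZ = lin 0 61 157"
    by (simp_all add: coordinate_defs lin_poly)
  have nd: "\<not> L dvd pZ" "\<not> L dvd 85 * pZ - 27 * pV" "\<not> L dvd 85 * pV - 24 * pZ"
    by (rule not_dvd_by_point[OF v(1)]; use v(2) in \<open>auto simp: qB_def\<close>)+
  have 1: "pZ * ((85 * pZ - 27 * pV) * ((85 * pV - 24 * pZ) * f)) = conic2 * h + L * k"
    using eq by (simp add: qB_def mult.assoc)
  have "\<exists>h k. (85 * pZ - 27 * pV) * ((85 * pV - 24 * pZ) * f) = conic2 * h + L * k"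
    by (rule cancel_on_line[OF L lins(1) _ _ prime nd(1) 1]) (use D p in simp_all)
  then obtain h k where 2: "(85 * pZ - 27 * pV) * ((85 * pV - 24 * pZ) * f) = conic2 * h + L * k" by blast
  have "\<exists>h k. (85 * pV - 24 * pZ) * f = conic2 * h + L * k"
    by (rule cancel_on_line[OF L lins(2) _ _ prime nd(2) 2]) (use D p in \<open>simp_all add: mult.commute\<close>)
  then obtain h k where 3: "(85 * pV - 24 * pZ) * f = conic2 * h + L * k" by blast
  show ?thesis
    by (rule cancel_on_line[OF L lins(3) _ _ prime nd(3) 3]) (use D p in \<open>simp_all add: mult.commute\<close>)
qed

text \<open>The six lines alone form a free arrangement, with coordinates \<open>e\<close>, \<open>g\<close> for its derivations. The conic
  imposes the congruence \<open>12 (pX + pV) qL e + qB g = 0\<close> modulo its equation. Its coefficients are products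
  of linear forms without common zeros on the conic, so it has only the solutions generated by the obvious
  ones.\<close>

lemma generate2:
  assumes X: "pX dvd p" and XV: "pX + pV dvd p"
    and l1: "pZ - 2 * pX dvd r - 2 * p" and l2: "pZ + 2 * pX dvd r + 2 * p"
    and C: "conic2 dvd 96 * pX * p + (85 * pV - 24 * pZ) * r" and Z: "pZ dvd r"
  shows "\<exists>h. p = (\<Sum>j<3. h j * P2 ! j) \<and> r = (\<Sum>j<3. h j * R2 ! j)"
proof -
  note ring = algebra_simps power2_eq_square
  obtain p1 where p1: "p = pX * p1" using X by (elim dvdE)
  have "pX + pV dvd p1"
    using XV unfolding p1
    by (rule prime_dvd_cancel_left[OF prime_coordinates(5), of _ _ "(1, - 1, 0)"]) simp_all
  then obtain e where "p1 = (pX + pV) * e" by (elim dvdE)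
  then have p: "p = pX * (pX + pV) * e" by (simp add: p1 mult.assoc)
  obtain c where c: "r = pZ * c" using Z by (elim dvdE)
  have lins: "pZ - 2 * pX = lin (- 2) 1 (- 3)" "pZ + 2 * pX = lin 2 1 (- 3)"
    by (simp_all add: coordinate_defs lin_poly)
  have primes: "prime_elem (pZ - 2 * pX)" "prime_elem (pZ + 2 * pX)"
    unfolding lins by (simp_all add: prime_lin)
  have "pZ * (c - (pX + pV) * e) = (r - 2 * p) - (pZ - 2 * pX) * ((pX + pV) * e)"
    unfolding c p by (simp add: ring)
  moreover have "pZ - 2 * pX dvd (r - 2 * p) - (pZ - 2 * pX) * ((pX + pV) * e)"
    by (intro dvd_diff dvd_triv_left l1)
  ultimately have "pZ - 2 * pX dvd pZ * (c - (pX + pV) * e)" by simp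
  then have "pZ - 2 * pX dvd c - (pX + pV) * e"
    by (rule prime_dvd_cancel_left[OF primes(1), of _ _ "(1, 2, 0)"]) simp_all
  then obtain d where d: "c - (pX + pV) * e = (pZ - 2 * pX) * d" by (elim dvdE)
  have "(pZ * (pZ - 2 * pX)) * d = (r + 2 * p) - (pZ + 2 * pX) * ((pX + pV) * e)"
    unfolding mult.assoc d[symmetric] c p by (simp add: ring)
  moreover have "pZ + 2 * pX dvd (r + 2 * p) - (pZ + 2 * pX) * ((pX + pV) * e)"
    by (intro dvd_diff dvd_triv_left l2)
  ultimately have "pZ + 2 * pX dvd (pZ * (pZ - 2 * pX)) * d" by simp
  then have "pZ + 2 * pX dvd d"
    by (rule prime_dvd_cancel_left[OF primes(2), of _ _ "(- 1, 2, 0)"]) simp_all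
  then obtain g where "d = (pZ + 2 * pX) * g" by (elim dvdE)
  then have cc: "c = (pX + pV) * e + (pZ - 2 * pX) * ((pZ + 2 * pX) * g)"
    using d by (simp add: algebra_simps)
  have r: "r = pZ * ((pX + pV) * e + (pZ^2 - 4 * pX^2) * g)"
    unfolding c cc by (simp add: ring)

  \<comment> \<open>the congruence imposed by the conic\<close>
  let ?y = "12 * (pX + pV) * qL * e + qB * g"
  have "pV * ?y = 12 * (96 * pX * p + (85 * pV - 24 * pZ) * r)
      - conic2 * (24 * (pX + pV) * e - pZ * (85 * pV - 24 * pZ) * g)"
    unfolding p r qL_def qB_def conic2_def by (simp add: ring)
  moreover have "conic2 dvd 12 * (96 * pX * p + (85 * pV - 24 * pZ) * r)
      - conic2 * (24 * (pX + pV) * e - pZ * (85 * pV - 24 * pZ) * g)"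
    by (intro dvd_diff dvd_triv_left dvd_mult C)
  ultimately have "conic2 dvd pV * ?y" by simp
  then have "conic2 dvd ?y"
    by (rule prime_dvd_cancel_left[OF prime_conic_multiples(2), of _ _ "(154, - 81, - 47)"])
      (simp_all add: conic2_def)
  then obtain h where h: "?y = conic2 * h" by (elim dvdE)
  have qL: "qL = lin 0 (- 31) 309" by (simp add: qL_def coordinate_defs lin_poly)
  have prime_qL: "prime_elem qL" unfolding qL by (simp add: prime_lin)
  have "qB * g = conic2 * h + qL * (- (12 * (pX + pV) * e))" using h by (simp add: algebra_simps)
  from cancel_qB[OF qL prime_qL _ _ _ _ _ _ _ _ this, of "(0, 309, 31)"]
  have "\<exists>h k. g = conic2 * h + qL * k"
    by (simp add: conic2_def qB_def qL eval_lin)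
  then obtain h1 g1 where g: "g = conic2 * h1 + qL * g1" by blast
  have "qL * (12 * (pX + pV) * e + qB * g1) = conic2 * (h - qB * h1)"
    using h unfolding g by (simp add: algebra_simps)
  then have "conic2 dvd qL * (12 * (pX + pV) * e + qB * g1)" by simp
  then have "conic2 dvd 12 * (pX + pV) * e + qB * g1"
    by (rule prime_dvd_cancel_left[OF prime_conic_multiples(2), of _ _ "(154, - 81, - 47)"])
      (simp_all add: conic2_def qL_def)
  then obtain h2 where h2: "12 * (pX + pV) * e + qB * g1 = conic2 * h2" by (elim dvdE)
  have XV_lin: "pX + pV = lin 1 1 1" by (simp add: coordinate_defs lin_poly)
  have "qB * g1 = conic2 * h2 + (pX + pV) * (- (12 * e))" using h2 by (simp add: algebra_simps)
  from cancel_qB[OF XV_lin prime_coordinates(5) _ _ _ _ _ _ _ _ this, of "(1, - 1, 0)"]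
  have "\<exists>h k. g1 = conic2 * h + (pX + pV) * k"
    by (simp add: conic2_def qB_def)
  then obtain h3 g2 where g1: "g1 = conic2 * h3 + (pX + pV) * g2" by blast
  have "(pX + pV) * (12 * e + qB * g2) = conic2 * (h2 - qB * h3)"
    using h2 unfolding g1 by (simp add: algebra_simps)
  then have "conic2 dvd (pX + pV) * (12 * e + qB * g2)" by simp
  then have "conic2 dvd 12 * e + qB * g2"
    by (rule prime_dvd_cancel_left[OF prime_conic_multiples(2), of _ _ "(154, - 81, - 47)"])
      (simp_all add: conic2_def)
  then obtain h4 where "12 * e + qB * g2 = conic2 * h4" by (elim dvdE)
  then have e12: "12 * e = conic2 * h4 - qB * g2" by (simp add: algebra_simps)

  have "12 * p = pX * (pX + pV) * (12 * e)" unfolding p by (simp add: algebra_simps)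
  then have p': "12 * p = (- g2) * P2 ! 0 + 12 * (h1 + qL * h3) * P2 ! 1 + h4 * P2 ! 2"
    unfolding e12 by (simp add: P2_def algebra_simps)
  have "12 * r = pZ * ((pX + pV) * (12 * e) + 12 * (pZ^2 - 4 * pX^2) * g)"
    unfolding r by (simp add: algebra_simps)
  then have r': "12 * r = (- g2) * R2 ! 0 + 12 * (h1 + qL * h3) * R2 ! 1 + h4 * R2 ! 2"
    unfolding e12 g g1 by (simp add: R2_def algebra_simps)
  define h where "h j = cst (1/12) * [- g2, 12 * (h1 + qL * h3), h4] ! j" for j
  have c12: "f = cst (1/12) * (12 * f)" for f
    using cst_mult[of "1/12" 12] by (simp add: cst_numeral cst_1 flip: mult.assoc)
  have "p = (\<Sum>j<3. h j * P2 ! j)"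
    by (subst c12, unfold p') (simp add: h_def numeral_eq_Suc algebra_simps)
  moreover have "r = (\<Sum>j<3. h j * R2 ! j)"
    by (subst c12, unfold r') (simp add: h_def numeral_eq_Suc algebra_simps)
  ultimately show ?thesis by blast
qed

lemma dvd_factor2:
  assumes "Q2 dvd der (4 * p) r (- r) Q2"
  shows "pX dvd p" "pX + pV dvd p" "pZ - 2 * pX dvd r - 2 * p" "pZ + 2 * pX dvd r + 2 * p"
    "conic2 dvd 96 * pX * p + (85 * pV - 24 * pZ) * r" "pZ dvd r"
proof -
  have dvd: "qs2 ! i dvd der (4 * p) r (- r) (qs2 ! i)" if "i < 7" for i
    using arr2.factor_dvd_der[unfolded arr2_Q, OF assms, of i] that by (simp add: qs2_def)
  have "lin 1 0 0 dvd 4 * p" using dvd[of 5] by (simp add: qs2_def der_lin lin_poly)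
  then show "pX dvd p" by (simp add: pX_def)
  have "pX + pV = lin 1 1 1" by (simp add: coordinate_defs lin_poly)
  moreover have "lin 1 1 1 dvd 4 * p" using dvd[of 6] by (simp add: qs2_def der_lin lin_poly)
  ultimately show "pX + pV dvd p" by simp
  have "pZ - 2 * pX = lin (- 2) 1 (- 3)" by (simp add: coordinate_defs lin_poly)
  moreover have "lin (- 2) 1 (- 3) dvd 4 * (r - 2 * p)"
    using dvd[of 1] by (simp add: qs2_def der_lin cst_uminus cst_numeral cst_1 algebra_simps)
  ultimately show "pZ - 2 * pX dvd r - 2 * p" by (simp only: dvd_numeral_mult_iff)
  have "pZ + 2 * pX = lin 2 1 (- 3)" by (simp add: coordinate_defs lin_poly)
  moreover have "lin 2 1 (- 3) dvd 4 * (r + 2 * p)"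
    using dvd[of 2] by (simp add: qs2_def der_lin cst_uminus cst_numeral cst_1 algebra_simps)
  ultimately show "pZ + 2 * pX dvd r + 2 * p" by (simp only: dvd_numeral_mult_iff)
  have "lin 0 1 (- 3) dvd 4 * r"
    using dvd[of 4] by (simp add: qs2_def der_lin cst_uminus cst_numeral cst_1 cst_0)
  then show "pZ dvd r" by (simp add: pZ_def)
  have "conic dvd der (4 * p) r (- r) conic" using dvd[of 0] by (simp add: qs2_def)
  then have "conic dvd der (4 * p) r (- r) conic2" unfolding conic2_eq by simp
  also have "der (4 * p) r (- r) conic2 = 4 * (96 * pX * p + (85 * pV - 24 * pZ) * r)"
    by (simp add: conic2_def algebra_simps)
  finally show "conic2 dvd 96 * pX * p + (85 * pV - 24 * pZ) * r"
    by (simp only: conic2_dvd_iff dvd_numeral_mult_iff)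
qed

interpretation log2: log_basis Q2 4 3 "\<lambda>j. P2 ! j" "\<lambda>j. R2 ! j" "\<lambda>j. \<kappa>2 ! j"
proof
  show "Q2 \<noteq> 0" using arr2.Q_nonzero by (simp add: arr2_Q)
  show "(4 :: polyS) dvd 1" by (rule numeral_unit)
  show "der varX varY varZ Q2 = 8 * Q2" by (rule euler_Q2)
  show "varY + varZ dvd b + c" if "Q2 dvd der a b c Q2" for a b c
  proof -
    have "qs2 ! 3 dvd der a b c (qs2 ! 3)"
      using arr2.factor_dvd_der[unfolded arr2_Q, OF that, of 3] by (simp add: qs2_def)
    then show ?thesis by (simp add: qs2_def der_lin lin_poly)
  qed
  show "der (4 * P2 ! j) (R2 ! j) (- R2 ! j) Q2 = 4 * \<kappa>2 ! j * Q2" if "j < 3" for j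
    by (rule basis2[OF that])
  show "\<exists>h. p = (\<Sum>j<3. h j * P2 ! j) \<and> r = (\<Sum>j<3. h j * R2 ! j)"
    if "Q2 dvd der (4 * p) r (- r) Q2" for p r
    by (rule generate2[OF dvd_factor2[OF that]])
qed

definition syz2 :: "polyS list list" where
  "syz2 = [[conic2], [12 * (pX + pV) * qL], [- qB]]"

lemma lin_map_syz2:
  assumes "w \<in> carrier_vec 1"
  shows "lin_map syz2 w $ 0 = conic2 * w $ 0" "lin_map syz2 w $ 1 = 12 * (pX + pV) * qL * w $ 0"
    "lin_map syz2 w $ 2 = - qB * w $ 0"
  using assms by (simp_all add: lin_map_index syz2_def)

lemma exact2: "lin_map syz2 ` free_module [7] = {v \<in> free_module [5, 5, 4]. lin_map log2.gens v = 0\<^sub>v 3}"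
proof (intro equalityI subsetI)
  fix v assume "v \<in> lin_map syz2 ` free_module [7]"
  then obtain w where w: "w \<in> carrier_vec 1" and vw: "v = lin_map syz2 w" by auto
  have v: "v \<in> carrier_vec 3" using lin_map_carrier[of syz2 w] by (simp add: vw syz2_def numeral_eq_Suc)
  note v_i = lin_map_syz2[OF w, folded vw]
  have "(\<Sum>j<3. v $ j * P2 ! j) = 0" "(\<Sum>j<3. v $ j * R2 ! j) = 0"
    unfolding sum_less_3 v_i by (simp_all add: P2_def R2_def algebra_simps)
  with v show "v \<in> {v \<in> free_module [5, 5, 4]. lin_map log2.gens v = 0\<^sub>v 3}"
    using log2.gens_kernel_iff[OF v] by (simp add: numeral_eq_Suc)
next
  fix v assume "v \<in> {v \<in> free_module [5, 5, 4]. lin_map log2.gens v = 0\<^sub>v 3}"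
  then have v: "v \<in> carrier_vec 3" and "lin_map log2.gens v = 0\<^sub>v 3" by (simp_all add: numeral_eq_Suc)
  then have PR: "(\<Sum>j<3. v $ j * P2 ! j) = 0" "(\<Sum>j<3. v $ j * R2 ! j) = 0"
    using log2.gens_kernel_iff[OF v] by simp_all
  define h0 h1 h2 where h: "h0 = v $ 0" "h1 = v $ 1" "h2 = v $ 2"
  have nz: "pX \<noteq> 0" "pZ \<noteq> 0" "pX + pV \<noteq> 0" "conic2 \<noteq> 0" "pZ^2 - 4 * pX^2 \<noteq> 0"
    using prime_coordinates prime_conic_multiples nonzero_by_point[of "pZ^2 - 4 * pX^2" "(1, 0, 0)"]
    by (auto simp: prime_elem_def)
  have "pX * (pX + pV) * (h0 * qB + h2 * conic2) = 0"
    using PR(1) unfolding sum_less_3 by (simp add: P2_def h algebra_simps)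
  then have i: "h0 * qB + h2 * conic2 = 0" using nz by simp
  have "pZ * ((pX + pV) * (h0 * qB + h2 * conic2) + (pZ^2 - 4 * pX^2) * (conic2 * h1 - 12 * (pX + pV) * qL * h0)) = 0"
    using PR(2) unfolding sum_less_3 by (simp add: R2_def h algebra_simps)
  then have ii: "conic2 * h1 = 12 * (pX + pV) * qL * h0" unfolding i using nz by simp
  have "qB * h0 = conic2 * (- h2)" using i by (simp add: algebra_simps eq_neg_iff_add_eq_0)
  then have "conic2 dvd qB * h0" by simp
  then have "conic2 dvd h0"
    by (rule prime_dvd_cancel_left[OF prime_conic_multiples(2), of _ _ "(154, - 81, - 47)"])
      (simp_all add: conic2_def qB_def)
  then obtain l where l: "h0 = conic2 * l" by (elim dvdE)
  have "conic2 * (h1 - 12 * (pX + pV) * qL * l) = 0" using ii unfolding l by (simp add: algebra_simps)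
  then have h1: "h1 = 12 * (pX + pV) * qL * l" using nz by simp
  have "conic2 * (h2 + qB * l) = 0" using i unfolding l by (simp add: algebra_simps)
  then have h2: "h2 = - qB * l" using nz by (simp add: eq_neg_iff_add_eq_0)
  define w where "w = vec 1 (\<lambda>i. l)"
  have w: "w \<in> carrier_vec 1" "w $ 0 = l" by (simp_all add: w_def)
  have "lin_map syz2 w = v"
  proof (rule eq_vecI)
    fix i assume "i < dim_vec v"
    then have "i < 3" using v by simp
    then consider "i = 0" | "i = 1" | "i = 2" by linarith
    then show "lin_map syz2 w $ i = v $ i"
    proof cases
      case 1 then show ?thesis using lin_map_syz2(1)[OF w(1)] h l w by simp
    next
      case 2 then show ?thesis using lin_map_syz2(2)[OF w(1)] h h1 w by simp
    next
      case 3 then show ?thesis using lin_map_syz2(3)[OF w(1)] h h2 w by simp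
    qed
  qed (use v in \<open>simp add: syz2_def\<close>)
  then show "v \<in> lin_map syz2 ` free_module [7]" using w(1) by auto
qed

lemma resolution2: "min_graded_free_res (AR Q2) [[5, 5, 4], [7]]"
proof (rule min_graded_free_resI)
  show "homogeneous_matrix [5, 5, 4] [0, 0, 0] log2.gens"
    by (rule log2.homogeneous_gens[OF _ is_form_numeral]) (use forms2 in \<open>auto simp: less_3_iff\<close>)
  have 1: "is_form 2 conic2" unfolding conic2_def by (rule form_intros | rule refl | simp)+
  have 2: "is_form 2 (12 * (pX + pV) * qL)" unfolding qL_def by (rule form_intros | rule refl | simp)+
  have 3: "is_form 3 (- qB)" unfolding qB_def by (rule form_intros | rule refl | simp)+
  from 1 2 3 show "homogeneous_matrix [7] [5, 5, 4] syz2"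
    by (simp add: homogeneous_matrix_def All_less_Suc syz2_def)
  show "lin_map log2.gens ` free_module [5, 5, 4] = AR Q2"
    using log2.AR_image by (simp add: numeral_eq_Suc)
  show "lin_map syz2 ` free_module [7] = {v \<in> free_module [5, 5, 4]. lin_map log2.gens v = 0\<^sub>v 3}"
    by (rule exact2)
  have "\<forall>i < length [5, 5, 4 :: nat]. \<forall>j < length [7 :: nat]. mono_coeff (syz2 ! i ! j) 0 0 0 = 0"
    by (simp add: All_less_Suc syz2_def mono_coeff_000 qB_def qL_def conic2_def)
  then show "mono_coeff (syz2 ! i ! j) 0 0 0 = 0"
    if "i < length [5, 5, 4 :: nat]" "j < length [7 :: nat]" for i j using that by blast
  fix w :: "polyS vec"
  assume "w \<in> free_module [7]" and 0: "lin_map syz2 w = 0\<^sub>v (length [5, 5, 4 :: nat])"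
  then have w: "w \<in> carrier_vec 1" by simp
  have "conic2 * w $ 0 = 0" unfolding lin_map_syz2[OF w, symmetric] 0 by simp
  moreover have "conic2 \<noteq> 0" using prime_conic_multiples by (auto simp: prime_elem_def)
  ultimately have "w $ 0 = 0" by simp
  then show "w = 0\<^sub>v (length [7 :: nat])"
    using w by (auto simp: Matrix.vec_eq_iff)
qed

section \<open>The weak Ziegler pair\<close>

lemma degrees_eq_sets:
  "{i. i < (7 :: nat) \<and> degrees ! i = 1} = {1, 2, 3, 4, 5, 6}"
  "{i. i < (7 :: nat) \<and> degrees ! i = 2} = {0}"
  "d \<noteq> 1 \<Longrightarrow> d \<noteq> 2 \<Longrightarrow> {i. i < (7 :: nat) \<and> degrees ! i = d} = {}"
proof -
  have "i < 7 \<longleftrightarrow> i = 0 \<or> i = 1 \<or> i = 2 \<or> i = 3 \<or> i = 4 \<or> i = 5 \<or> i = 6" for i :: nat by auto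
  note less_7 = this
  show "{i. i < (7 :: nat) \<and> degrees ! i = 1} = {1, 2, 3, 4, 5, 6}"
    "{i. i < (7 :: nat) \<and> degrees ! i = 2} = {0}"
    by (auto simp: less_7)
  have "degrees ! i = 1 \<or> degrees ! i = 2" if "i < 7" for i
    using that by (auto simp: less_7)
  then show "d \<noteq> 1 \<Longrightarrow> d \<noteq> 2 \<Longrightarrow> {i. i < (7 :: nat) \<and> degrees ! i = d} = {}"
    by blast
qed

lemma length_qs: "length qs1 = 7" "length qs2 = 7"
  by (simp_all add: qs1_def qs2_def)

lemma (in arrangement) conic_line_Q:
  assumes "ds = degrees" and len: "length qs = 7"
  shows "conic_line_arrangement 1 6 Q"
proof -
  have card: "card (components_of_degree Q d) = card {i. i < 7 \<and> degrees ! i = d}" for d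
    using card_components_Q[of d] unfolding assms .
  have "components_of_degree Q d = {}" if "d \<notin> {1, 2}" for d
    using components_Q[of d] degrees_eq_sets(3)[of d] that unfolding assms by simp
  then show ?thesis
    unfolding conic_line_arrangement_def card degrees_eq_sets(1,2)
    using reduced_Q smooth_Q by simp
qed

lemmas conic_line1 = arr1.conic_line_Q[OF refl length_qs(1), unfolded arr1_Q]
  and conic_line2 = arr2.conic_line_Q[OF refl length_qs(2), unfolded arr2_Q]

lemma singularity1:
  "singular_at Q1 v \<Longrightarrow> \<exists>T. ordinary_of_type T (local_equation Q1 v)"
  "card (singular_points Q1 (ordinary 2)) = 12" "card (singular_points Q1 (ordinary 3)) = 3"
  "card (singular_points Q1 (ordinary 4)) = 1" "card (singular_points Q1 (has_type A1)) = 12"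
  "card (singular_points Q1 (has_type D4)) = 3" "card (singular_points Q1 (has_type X9)) = 1"
  using arr1_counts by (simp_all add: sing1_def)

lemma singularity2:
  "singular_at Q2 v \<Longrightarrow> \<exists>T. ordinary_of_type T (local_equation Q2 v)"
  "card (singular_points Q2 (ordinary 2)) = 12" "card (singular_points Q2 (ordinary 3)) = 3"
  "card (singular_points Q2 (ordinary 4)) = 1" "card (singular_points Q2 (has_type A1)) = 12"
  "card (singular_points Q2 (has_type D4)) = 3" "card (singular_points Q2 (has_type X9)) = 1"
  using arr2_counts by (simp_all add: sing2_def)

lemma ordinary_of_type_cases:
  assumes "\<exists>T. ordinary_of_type T F"
  shows "quasi_homogeneous F" "\<exists>m \<in> {2, 3, 4}. ordinary m F" "\<exists>T. has_type T F"
proof -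
  obtain T where T: "ordinary_of_type T F" using assms by blast
  then show "quasi_homogeneous F" by (rule ordinary_of_type_quasi_homogeneous)
  have "ordinary (mult_of T) F" using T by (simp add: ordinary_of_type_def)
  moreover have "mult_of T \<in> {2, 3, 4}" by (cases T) auto
  ultimately show "\<exists>m \<in> {2, 3, 4}. ordinary m F" by blast
  show "\<exists>T. has_type T F" using ordinary_of_type_has_type_iff[OF T] by blast
qed

lemma weak_combinatorics_eq: "weak_combinatorics Q1 = weak_combinatorics Q2"
proof -
  have "card (components_of_degree Q1 i) = card (components_of_degree Q2 i)" for i
    using arr1.card_components_Q arr2.card_components_Q by (simp add: arr1_Q arr2_Q length_qs)
  moreover have "card (singular_points Q1 (has_type T)) = card (singular_points Q2 (has_type T))" for T
    using singularity1 singularity2 by (cases T) simp_all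
  ultimately show ?thesis by (simp add: weak_combinatorics_def)
qed

lemma ziegler: "weak_ziegler_pair Q1 Q2"
  unfolding weak_ziegler_pair_def
proof (intro conjI)
  show "\<forall>h\<in>{Q1, Q2}. reduced_curve h \<and> smooth_components h \<and>
      (\<forall>v. singular_at h v \<longrightarrow> (\<exists>T. has_type T (local_equation h v)))"
    using conic_line1 conic_line2 ordinary_of_type_cases(3) singularity1(1) singularity2(1)
    by (auto simp: conic_line_arrangement_def)
  show "weak_combinatorics Q1 = weak_combinatorics Q2" by (rule weak_combinatorics_eq)
  show "\<exists>\<beta>. has_graded_betti_numbers (AR Q1) \<beta>" "\<exists>\<gamma>. has_graded_betti_numbers (AR Q2) \<gamma>"
    unfolding has_graded_betti_numbers_def using resolution1 resolution2 by blast+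
  show "\<forall>\<beta> \<gamma>. has_graded_betti_numbers (AR Q1) \<beta> \<and> has_graded_betti_numbers (AR Q2) \<gamma> \<longrightarrow> \<beta> \<noteq> \<gamma>"
    using graded_betti_numbers_differ[OF resolution1 resolution2] by auto
qed

theorem mainTheorem1:
  shows "(\<forall>Q \<in> {Q1, Q2}.
            conic_line_arrangement 1 6 Q \<and>
            (\<forall>v. singular_at Q v \<longrightarrow>
               quasi_homogeneous (local_equation Q v) \<and>
               (\<exists>m \<in> {2, 3, 4}. ordinary m (local_equation Q v))) \<and>
            card (singular_points Q (ordinary 2)) = 12 \<and>
            card (singular_points Q (ordinary 3)) = 3 \<and>
            card (singular_points Q (ordinary 4)) = 1 \<and>
            card (singular_points Q (has_type A1)) = 12 \<and>
            card (singular_points Q (has_type D4)) = 3 \<and>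
            card (singular_points Q (has_type X9)) = 1) \<and>
         min_graded_free_res (AR Q1) [[6, 5, 5, 4], [7, 6]] \<and>
         min_graded_free_res (AR Q2) [[5, 5, 4], [7]] \<and>
         weak_ziegler_pair Q1 Q2"
proof (intro conjI ballI)
  fix Q assume Q: "Q \<in> {Q1, Q2}"
  show "conic_line_arrangement 1 6 Q" using Q conic_line1 conic_line2 by blast
  show "card (singular_points Q (ordinary 2)) = 12" using Q singularity1(2) singularity2(2) by blast
  show "card (singular_points Q (ordinary 3)) = 3" using Q singularity1(3) singularity2(3) by blast
  show "card (singular_points Q (ordinary 4)) = 1" using Q singularity1(4) singularity2(4) by blast
  show "card (singular_points Q (has_type A1)) = 12" using Q singularity1(5) singularity2(5) by blast
  show "card (singular_points Q (has_type D4)) = 3" using Q singularity1(6) singularity2(6) by blast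
  show "card (singular_points Q (has_type X9)) = 1" using Q singularity1(7) singularity2(7) by blast
  show "\<forall>v. singular_at Q v \<longrightarrow> quasi_homogeneous (local_equation Q v) \<and>
      (\<exists>m \<in> {2, 3, 4}. ordinary m (local_equation Q v))"
  proof (intro allI impI)
    fix v assume "singular_at Q v"
    then have "\<exists>T. ordinary_of_type T (local_equation Q v)"
      using Q singularity1(1) singularity2(1) by blast
    from ordinary_of_type_cases(1,2)[OF this]
    show "quasi_homogeneous (local_equation Q v) \<and> (\<exists>m \<in> {2, 3, 4}. ordinary m (local_equation Q v))"
      by blast
  qed
qed (use resolution1 resolution2 ziegler in simp_all)

end
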